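(* There exists a set of non-crossing shortest paths (NCS) $P$, as defined in the context, such that $\mathrm{PCFN}(P)=4$.
   Context: All graphs are undirected. For a path $p$, $x_p,y_p$ denote its extremal vertices. Two paths are single-touch if their intersection is a (possibly empty) path. A set of paths $P$ is a set of non-crossing shortest paths (NCS) if there is a plane graph $G$ (with positive edge weights) with external face $f^\infty$ such that: for each $p\in P$ the extremal vertices of $p$ lie on $f^\infty$; each $p\in P$ is a shortest path in $G$ and the paths of $P$ are pairwise single-touch; any two paths of $P$ are non-crossing in the embedding of $G$. Terminal pairs are assumed distinct and well-formed: letting $\gamma_p$ be the path on $f^\infty$ going clockwise from $x_p$ to $y_p$, for all $q,r\in P$ either $\gamma_q\subseteq\gamma_r$, or $\gamma_r\subseteq\gamma_q$, or they share no edge. The Path Covering with Forests Number $\mathrm{PCFN}(P)$ is the minimum size of a set $F$ of forests such that every path of $P$ is contained in at least one forest of $F$. *)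

theory Defs
  imports "Graph_Theory.Graph_Theory" "HOL-Combinatorics.Orbits" "HOL-Library.Sublist"
begin

text \<open>
  Finite simple undirected graphs are symmetric loop-free pair digraphs (\<^locale>\<open>pair_graph\<close>): an edge
  between \<open>u\<close> and \<open>v\<close> is the pair of arcs \<open>(u, v)\<close>, \<open>(v, u)\<close>. A path is a nonempty list of distinct
  vertices (\<^const>\<open>vpath\<close>); it is stored together with a direction, its extremal vertices being
  \<open>x\<^sub>p = hd p\<close> and \<open>y\<^sub>p = last p\<close>.

  Plane graphs are given by rotation systems (Heffter--Edmonds): \<open>rot\<close> sends an arc to the clockwise
  next arc with the same tail. An arc \<open>(u, v)\<close> is followed on the boundary of the face to its left
  by the arc that comes clockwise after \<open>(v, u)\<close> around \<open>v\<close>. Hence inner faces are traversed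
  anticlockwise and the external face is traversed clockwise around the graph.
\<close>

definition face_succ :: "('a \<times> 'a \<Rightarrow> 'a \<times> 'a) \<Rightarrow> 'a \<times> 'a \<Rightarrow> 'a \<times> 'a" where
  "face_succ rot e = rot (prod.swap e)"

definition faces :: "'a pair_pre_digraph \<Rightarrow> ('a \<times> 'a \<Rightarrow> 'a \<times> 'a) \<Rightarrow> ('a \<times> 'a) set set" where
  "faces G rot = orbit (face_succ rot) ` parcs G"

text \<open>
  The Euler formula says that the rotation system describes an embedding into the sphere; choosing
  the external face \<open>ext\<close> turns it into an embedding into the plane.
\<close>

locale plane_graph = pair_graph G
  for G :: "'a pair_pre_digraph" +
  fixes rot :: "'a \<times> 'a \<Rightarrow> 'a \<times> 'a"
    and ext :: "('a \<times> 'a) set"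
  assumes connected: "Digraph_Component.connected G"
    and rot_permutes: "rot permutes parcs G"
    and rot_cyclic: "\<And>v. v \<in> pverts G \<Longrightarrow> out_arcs G v \<noteq> {} \<Longrightarrow> cyclic_on rot (out_arcs G v)"
    and euler: "card (pverts G) + card (faces G rot) = card (parcs G) div 2 + 2"
    and ext_face: "ext \<in> faces G rot"

text \<open>
  The edges of the path that runs clockwise along the external face from \<open>x\<close> to \<open>y\<close>. If the boundary
  of that face is a cycle, the conditions that \<open>x\<close> is not revisited and \<open>y\<close> is not visited earlier just
  say that the walk stops at its first arrival in \<open>y\<close>; in general they select among the occurrences of
  \<open>x\<close> and \<open>y\<close> on the boundary walk.
\<close>

definition clockwise_edges ::
    "('a \<times> 'a \<Rightarrow> 'a \<times> 'a) \<Rightarrow> ('a \<times> 'a) set \<Rightarrow> 'a \<Rightarrow> 'a \<Rightarrow> 'a set set" where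
  "clockwise_edges rot ext x y =
     {{u, v} | u v. \<exists>e n i. e \<in> ext \<and> fst e = x \<and> fst ((face_succ rot ^^ n) e) = y \<and>
        (\<forall>j. 0 < j \<and> j \<le> n \<longrightarrow> fst ((face_succ rot ^^ j) e) \<noteq> x) \<and>
        (\<forall>j<n. fst ((face_succ rot ^^ j) e) \<noteq> y) \<and>
        i < n \<and> (face_succ rot ^^ i) e = (u, v)}"

definition path_edges :: "'a vwalk \<Rightarrow> 'a set set" where
  "path_edges p = (\<lambda>(u, v). {u, v}) ` set (vwalk_arcs p)"

text \<open>The witness \<open>r\<close> is the intersection path, with \<open>r = []\<close> for the empty path.\<close>

definition single_touch :: "'a vwalk \<Rightarrow> 'a vwalk \<Rightarrow> bool" where
  "single_touch p q \<longleftrightarrow>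
     (\<exists>r. distinct r \<and> set r = set p \<inter> set q \<and> path_edges r = path_edges p \<inter> path_edges q)"

text \<open>
  For distinct neighbours \<open>x\<close>, \<open>y\<close>, \<open>z\<close> of \<open>v\<close>: the edge from \<open>v\<close> to \<open>y\<close> leaves a path traversing
  \<open>x\<close>, \<open>v\<close>, \<open>z\<close> to the left, as going clockwise around \<open>v\<close> from \<open>x\<close> one meets \<open>y\<close> before \<open>z\<close>.
\<close>

definition on_left :: "('a \<times> 'a \<Rightarrow> 'a \<times> 'a) \<Rightarrow> 'a \<Rightarrow> 'a \<Rightarrow> 'a \<Rightarrow> 'a \<Rightarrow> bool" where
  "on_left rot x v z y \<longleftrightarrow> funpow_dist rot (v, x) (v, y) < funpow_dist rot (v, x) (v, z)"

text \<open>
  \<open>q\<close> crosses \<open>p\<close> along a common subpath \<open>c\<close>, possibly a single vertex, that both traverse in the same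
  direction: \<open>p\<close> passes \<open>a\<close>, \<open>c\<close>, \<open>b\<close>, and \<open>q\<close> arrives from \<open>a'\<close> on one side of \<open>p\<close> and departs to \<open>b'\<close>
  on the other side. Here \<open>s\<close> is the vertex after \<open>hd c\<close> on \<open>p\<close>, and \<open>t\<close> the vertex before \<open>last c\<close>.
\<close>

definition crosses_along ::
    "('a \<times> 'a \<Rightarrow> 'a \<times> 'a) \<Rightarrow> 'a vwalk \<Rightarrow> 'a vwalk \<Rightarrow> 'a vwalk \<Rightarrow> bool" where
  "crosses_along rot p q c \<longleftrightarrow> c \<noteq> [] \<and>
     (\<exists>a b a' b'. sublist (a # c @ [b]) p \<and> sublist (a' # c @ [b']) q \<and>
       (let s = hd (tl (c @ [b])); t = last (a # butlast c) in
         a' \<notin> {a, s} \<and> b' \<notin> {b, t} \<and>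
         on_left rot a (hd c) s a' \<noteq> on_left rot t (last c) b b'))"

definition non_crossing :: "('a \<times> 'a \<Rightarrow> 'a \<times> 'a) \<Rightarrow> 'a vwalk \<Rightarrow> 'a vwalk \<Rightarrow> bool" where
  "non_crossing rot p q \<longleftrightarrow> (\<nexists>c. crosses_along rot p q c \<or> crosses_along rot p (rev q) c)"

definition shortest_path :: "'a pair_pre_digraph \<Rightarrow> ('a \<times> 'a) weight_fun \<Rightarrow> 'a vwalk \<Rightarrow> bool" where
  "shortest_path G w p \<longleftrightarrow>
     vpath p G \<and> ereal (wf_digraph.awalk_cost w (vwalk_arcs p)) = wf_digraph.\<mu> G w (hd p) (last p)"

definition well_formed :: "('a \<times> 'a \<Rightarrow> 'a \<times> 'a) \<Rightarrow> ('a \<times> 'a) set \<Rightarrow> 'a vwalk set \<Rightarrow> bool" where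
  "well_formed rot ext P \<longleftrightarrow>
     (\<forall>q\<in>P. \<forall>r\<in>P.
        let \<gamma>\<^sub>q = clockwise_edges rot ext (hd q) (last q);
            \<gamma>\<^sub>r = clockwise_edges rot ext (hd r) (last r)
        in \<gamma>\<^sub>q \<subseteq> \<gamma>\<^sub>r \<or> \<gamma>\<^sub>r \<subseteq> \<gamma>\<^sub>q \<or> \<gamma>\<^sub>q \<inter> \<gamma>\<^sub>r = {})"

definition NCS :: "'a vwalk set \<Rightarrow> bool" where
  "NCS P \<longleftrightarrow>
     (\<exists>G w rot ext. plane_graph G rot ext \<and>
       (\<forall>(u, v)\<in>parcs G. 0 < w (u, v) \<and> w (u, v) = w (v, u)) \<and>
       (\<forall>p\<in>P. shortest_path G w p \<and> hd p \<in> fst ` ext \<and> last p \<in> fst ` ext) \<and>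
       (\<forall>p\<in>P. \<forall>q\<in>P. p \<noteq> q \<longrightarrow>
          single_touch p q \<and> non_crossing rot p q \<and> {hd p, last p} \<noteq> {hd q, last q}) \<and>
       well_formed rot ext P)"

text \<open>
  In a symmetric digraph an edge traversed back and forth is a \<^const>\<open>pre_digraph.cycle\<close> of length 2,
  so the library's \<^const>\<open>Digraph_Component.forest\<close> does not describe undirected forests. The cycles
  of the undirected graph are those of length at least 3.
\<close>

definition undirected_forest :: "'a pair_pre_digraph \<Rightarrow> bool" where
  "undirected_forest T \<longleftrightarrow> pair_graph T \<and> \<not> (\<exists>c. pre_digraph.cycle T c \<and> 3 \<le> length c)"

definition PCFN :: "'a vwalk set \<Rightarrow> nat" where
  "PCFN P = (LEAST k. \<exists>F :: 'a pair_pre_digraph set. finite F \<and> card F = k \<and>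
     (\<forall>T\<in>F. undirected_forest T) \<and> (\<forall>p\<in>P. \<exists>T\<in>F. vpath p T))"

end

theory Submission
  imports Defs "HOL-Library.Code_Binary_Nat"
begin

text \<open>
  In a complete binary tree replace every branching by a triangle. In the resulting plane cactus,
  with unit weights, all vertices are on the external face, any two vertices are joined by a unique
  shortest path, and a set of leaf-to-leaf paths is an NCS as soon as no two of its terminal pairs
  interleave. A union of paths is a forest iff it contains no full triangle, so the task is to find
  non-interleaving leaf pairs that cannot be coloured with three colours such that no triangle has
  its three sides covered by paths of one colour, whereas four colours suffice.

  The paths crossing a cut vertex are linearly ordered, so a colouring gives a word at every cut
  vertex; below the cut vertex the word is split in two, and the paths new at the triangle must not
  have a colour that occurs in both parts. The family is chosen so that every initial segment with
  three different colours leads to a contradiction (\<open>g8\<close>, \<open>g9\<close>); this is used to rule out all words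
  at the root.
\<close>

section \<open>The triangle cactus and its rotation system\<close>

text \<open>Once the part of a word that continues to one side shows all three colours, the new
  paths at that triangle are restricted by the letters split off to the other side alone. Two kinds
  of node exploit this. Splitting off one letter of a repeated final pair gives the single new path
  a different colour, so the final pair becomes unequal. Splitting off two unequal letters leaves
  only the third colour, so the new paths form a constant block of whatever length the plan
  prescribes. Alternating the two rewrites the tail of a word until two rainbow triples stand side
  by side and no colour is left for one more path (\<open>g0\<close>). The plans \<open>g12\<close>
  to \<open>g17\<close> see to it that every choice at the root runs into such a situation; this
  finite remainder is propositional. All of this concerns \<open>ok\<close> only;
  \<open>turns\<close> ties it to concrete leaf pairs by recording which side of which triangle each
  path is meant to use, and that is checked by computation. The depth 14 is the height of
  \<open>g17\<close>, so the leaves start at 16384, and the 130 chords are the new paths of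
  \<open>g17\<close>.\<close>

definition sib :: "nat \<Rightarrow> nat" where
  "sib v = (if even v then v + 1 else v - 1)"

definition triangle_arcs :: "nat \<Rightarrow> (nat \<times> nat) set" where
  "triangle_arcs v = {(v, 2 * v), (2 * v, v), (v, 2 * v + 1), (2 * v + 1, v),
     (2 * v, 2 * v + 1), (2 * v + 1, 2 * v)}"

text \<open>The vertices are numbered as in a heap: below \<open>v\<close> there is the triangle \<open>v\<close>, \<open>2 * v\<close>, \<open>2 * v + 1\<close>,
  and the leaves are the \<open>2 ^ D\<close> vertices from \<open>2 ^ D\<close> on.\<close>

definition cactus :: "nat \<Rightarrow> nat pair_pre_digraph" where
  "cactus D = \<lparr>pverts = {1..<2 ^ Suc D}, parcs = (\<Union>v\<in>{1..<2 ^ D}. triangle_arcs v)\<rparr>"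

text \<open>The neighbours in clockwise order.\<close>

definition nbrs :: "nat \<Rightarrow> nat \<Rightarrow> nat list" where
  "nbrs D v =
     (if v = 1 then [2, 3]
      else if 2 ^ D \<le> v then [v div 2, sib v]
      else if even v then [v div 2, 2 * v, 2 * v + 1, sib v]
      else [v div 2, sib v, 2 * v, 2 * v + 1])"

definition next_in :: "'a list \<Rightarrow> 'a \<Rightarrow> 'a" where
  "next_in xs a = (case dropWhile (\<lambda>b. b \<noteq> a) xs of _ # b # _ \<Rightarrow> b | _ \<Rightarrow> hd xs)"

text \<open>In the picture the root is at the bottom and the smaller child on the left. Outside the
  arcs the rotation is the identity, as \<open>permutes\<close> demands.\<close>

definition cactus_rot :: "nat \<Rightarrow> nat \<times> nat \<Rightarrow> nat \<times> nat" where
  "cactus_rot D e = (if e \<in> parcs (cactus D) then (fst e, next_in (nbrs D (fst e)) (snd e)) else e)"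

lemma pverts_cactus [simp]: "pverts (cactus D) = {1..<2 ^ Suc D}"
  by (simp add: cactus_def)

lemma parcs_cactus: "parcs (cactus D) = (\<Union>v\<in>{1..<2 ^ D}. triangle_arcs v)"
  by (simp add: cactus_def)

lemma arc_iff:
  "(a, b) \<in> parcs (cactus D) \<longleftrightarrow>
     (1 \<le> a \<and> a < 2 ^ D \<and> (b = 2 * a \<or> b = 2 * a + 1)) \<or>
     (2 \<le> a \<and> a < 2 ^ Suc D \<and> (b = a div 2 \<or> b = sib a))"
proof
  assume "(a, b) \<in> parcs (cactus D)"
  then obtain v where "v \<in> {1..<2 ^ D}" "(a, b) \<in> triangle_arcs v"
    unfolding parcs_cactus by blast
  then show "(1 \<le> a \<and> a < 2 ^ D \<and> (b = 2 * a \<or> b = 2 * a + 1)) \<or>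
     (2 \<le> a \<and> a < 2 ^ Suc D \<and> (b = a div 2 \<or> b = sib a))"
    by (auto simp: triangle_arcs_def sib_def)
next
  assume *: "(1 \<le> a \<and> a < 2 ^ D \<and> (b = 2 * a \<or> b = 2 * a + 1)) \<or>
     (2 \<le> a \<and> a < 2 ^ Suc D \<and> (b = a div 2 \<or> b = sib a))"
  show "(a, b) \<in> parcs (cactus D)"
  proof (cases "1 \<le> a \<and> a < 2 ^ D \<and> (b = 2 * a \<or> b = 2 * a + 1)")
    case True
    then show ?thesis unfolding parcs_cactus by (auto simp: triangle_arcs_def)
  next
    case False
    with * have "a div 2 \<in> {1..<2 ^ D}" and "b = a div 2 \<or> b = sib a" by auto
    moreover have "(a, b) \<in> triangle_arcs (a div 2)"
      using calculation(2) by (cases "even a") (auto simp: triangle_arcs_def sib_def elim!: evenE oddE)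
    ultimately show ?thesis unfolding parcs_cactus by blast
  qed
qed

lemma sib_div2: "2 \<le> a \<Longrightarrow> sib a div 2 = a div 2"
  by (auto simp: sib_def elim!: oddE evenE)

lemma sib_neq: "2 \<le> a \<Longrightarrow> sib a \<noteq> a"
  by (auto simp: sib_def)

lemma sib_bounds: "2 \<le> a \<Longrightarrow> a < 2 ^ Suc D \<Longrightarrow> 2 \<le> sib a \<and> sib a < 2 ^ Suc D"
proof -
  assume a: "2 \<le> a" "a < 2 ^ Suc D"
  show ?thesis
  proof (cases "even a")
    case True
    moreover have "even ((2::nat) ^ Suc D)" by simp
    ultimately have "a + 1 \<noteq> 2 ^ Suc D" by (metis even_plus_one_iff)
    with a True show ?thesis by (simp add: sib_def)
  qed (use a in \<open>auto simp: sib_def elim!: oddE\<close>)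
qed

lemma arc_sym: "(a, b) \<in> parcs (cactus D) \<Longrightarrow> (b, a) \<in> parcs (cactus D)"
  unfolding parcs_cactus triangle_arcs_def by blast

lemma arc_vertices:
  assumes "(a, b) \<in> parcs (cactus D)"
  shows "a \<in> {1..<2 ^ Suc D}" "b \<in> {1..<2 ^ Suc D}" "a \<noteq> b"
  using assms sib_bounds[of a D] sib_neq[of a] unfolding arc_iff by auto

lemma pair_graph_cactus: "pair_graph (cactus D)"
proof
  show "finite (pverts (cactus D))" by simp
  show "finite (parcs (cactus D))" by (auto simp: parcs_cactus triangle_arcs_def)
  show "symmetric (with_proj (cactus D))"
    unfolding symmetric_def with_proj_simps by (blast intro: symI arc_sym)
qed (use arc_vertices in force)+

interpretation cactus: pair_graph "cactus D" for D
  by (rule pair_graph_cactus)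

lemma cactus_connected: "Digraph_Component.connected (with_proj (cactus D))"
proof -
  let ?r = "\<lambda>u v. u \<rightarrow>\<^sup>*\<^bsub>with_proj (cactus D)\<^esub> v"
  have root: "?r v 1" if "v \<in> {1..<2 ^ Suc D}" for v
    using that
  proof (induction v rule: less_induct)
    case (less v)
    show ?case
    proof (cases "v = 1")
      case False
      with less.prems have v: "2 \<le> v" "v < 2 ^ Suc D" by auto
      then have "(v, v div 2) \<in> parcs (cactus D)" by (auto simp: arc_iff)
      then have "?r v (v div 2)" by (metis cactus.reachable_adjI with_proj_simps(3))
      also have "?r (v div 2) 1" by (rule less.IH) (use v in auto)
      finally show ?thesis .
    qed (use less.prems in auto)
  qed
  have sym: "symmetric (with_proj (cactus D))" by (rule cactus.sym_arcs)
  have "?r u v" if "u \<in> {1..<2 ^ Suc D}" "v \<in> {1..<2 ^ Suc D}" for u v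
    using root[OF that(1)] root[OF that(2)] symmetric_reachable[OF sym] cactus.reachable_trans by blast
  then show ?thesis
    unfolding Digraph_Component.connected_def
    using one_less_power[of "2::nat" "Suc D"]
    by (intro strongly_connectedI) (auto simp: cactus.reachable_mk_symmetric_eq[OF sym])
qed

text \<open>Listing an orbit in order turns orbits, powers and distances of
  \<open>cactus_rot\<close> and \<open>face_succ\<close> into index arithmetic modulo the length of
  the list.\<close>

definition cycles :: "('a \<Rightarrow> 'a) \<Rightarrow> 'a list \<Rightarrow> bool" where
  "cycles f es \<longleftrightarrow> es \<noteq> [] \<and> distinct es \<and> successively (\<lambda>a b. f a = b) es \<and> f (last es) = hd es"

lemma cycles_nth:
  assumes "cycles f es" "i < length es"
  shows "f (es ! i) = es ! (Suc i mod length es)"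
proof (cases "Suc i < length es")
  case True
  then show ?thesis using assms by (simp add: cycles_def successively_conv_nth)
next
  case False
  with assms(2) have "length es = Suc i" by simp
  then have "last es = es ! i" "hd es = es ! 0"
    using assms by (auto simp: cycles_def last_conv_nth hd_conv_nth)
  then show ?thesis using assms \<open>length es = Suc i\<close> by (simp add: cycles_def)
qed

lemma cycles_funpow:
  assumes "cycles f es" "i < length es"
  shows "(f ^^ k) (es ! i) = es ! ((i + k) mod length es)"
proof (induction k)
  case (Suc k)
  have "(i + k) mod length es < length es" using assms(2) by (intro mod_less_divisor) linarith
  from cycles_nth[OF assms(1) this] Suc show ?case by (simp add: mod_Suc_eq)
qed (use assms in simp)

lemma cycles_orbit:
  assumes "cycles f es" "e \<in> set es"
  shows "orbit f e = set es"
proof -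
  obtain i where i: "i < length es" "e = es ! i" using assms(2) by (auto simp: in_set_conv_nth)
  show ?thesis
  proof
    show "orbit f e \<subseteq> set es"
      using i by (auto simp: orbit_altdef cycles_funpow[OF assms(1)] intro!: nth_mem mod_less_divisor)
    show "set es \<subseteq> orbit f e"
    proof
      fix a assume "a \<in> set es"
      then obtain j where j: "j < length es" "a = es ! j" by (auto simp: in_set_conv_nth)
      have "(i + (length es - i + j)) mod length es = j" using i j by simp
      then have "(f ^^ (length es - i + j)) e = a"
        unfolding i(2) j(2) by (subst cycles_funpow[OF assms(1) i(1)]) simp
      moreover have "0 < length es - i + j" using i by simp
      ultimately show "a \<in> orbit f e" unfolding orbit_altdef by blast
    qed
  qed
qed

text \<open>Every exponent leading from position \<open>i\<close> to position \<open>j\<close> is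
  congruent to j - i modulo the length, so the least one is the residue. The summand
  \<open>length es\<close> keeps the subtraction on naturals from being cut off.\<close>

lemma cycles_funpow_dist:
  assumes "cycles f es" "i < length es" "j < length es"
  shows "funpow_dist f (es ! i) (es ! j) = (j + length es - i) mod length es"
  unfolding funpow_dist_def
proof (rule Least_equality)
  have d: "distinct es" using assms(1) by (simp add: cycles_def)
  let ?n = "length es"
  have "(i + (j + ?n - i) mod ?n) mod ?n = j"
    using assms by (simp add: mod_add_right_eq)
  then show "(f ^^ ((j + ?n - i) mod ?n)) (es ! i) = es ! j"
    by (simp add: cycles_funpow[OF assms(1,2)])
  fix k assume "(f ^^ k) (es ! i) = es ! j"
  moreover have lt: "(i + k) mod ?n < ?n" using assms(2) by (intro mod_less_divisor) linarith
  ultimately have "(i + k) mod ?n = j"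
    using nth_eq_iff_index_eq[OF d, of "(i + k) mod ?n" j] assms(2,3)
    by (simp add: cycles_funpow[OF assms(1,2)] lt)
  then have "(j + ?n - i) mod ?n = ((i + k) mod ?n + ?n - i) mod ?n" by simp
  also have "\<dots> = ((i + k) mod ?n + (?n - i)) mod ?n" using assms(2) by simp
  also have "\<dots> = (i + k + (?n - i)) mod ?n" by (rule mod_add_left_eq)
  also have "\<dots> = k mod ?n" using assms(2) by simp
  also have "\<dots> \<le> k" by simp
  finally show "(j + ?n - i) mod ?n \<le> k" .
qed

lemma next_in_nth:
  assumes "distinct xs" "i < length xs"
  shows "next_in xs (xs ! i) = xs ! (Suc i mod length xs)"
proof -
  have "dropWhile (\<lambda>b. b \<noteq> xs ! i) xs = drop i xs"
    using assms
  proof (induction xs arbitrary: i)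
    case (Cons a xs)
    then show ?case by (cases i) auto
  qed simp
  moreover have "drop i xs = xs ! i # drop (Suc i) xs" using assms(2) by (simp add: Cons_nth_drop_Suc)
  moreover have wrap: "Suc i mod length xs = 0" if "\<not> Suc i < length xs"
    using that assms(2) by (metis Suc_lessI mod_self)
  moreover have "drop (Suc i) xs = (if Suc i < length xs then xs ! Suc i # drop (Suc (Suc i)) xs else [])"
    by (simp add: Cons_nth_drop_Suc)
  ultimately show ?thesis
    using assms(2) wrap hd_conv_nth[of xs]
    by (cases "Suc i < length xs"; cases "xs = []") (simp_all add: next_in_def)
qed

lemma cycles_rot:
  assumes "\<And>b. b \<in> set xs \<Longrightarrow> rot (v, b) = (v, next_in xs b)" "distinct xs" "xs \<noteq> []"
  shows "cycles rot (map (Pair v) xs)"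
proof -
  have "rot (v, xs ! i) = (v, xs ! (Suc i mod length xs))" if "i < length xs" for i
    using assms that by (simp add: next_in_nth)
  moreover from this[of "length xs - 1"] have "rot (last (map (Pair v) xs)) = hd (map (Pair v) xs)"
    using assms(3) by (simp add: last_map hd_map last_conv_nth hd_conv_nth)
  ultimately show ?thesis
    using assms(2,3) by (auto simp: cycles_def distinct_map inj_on_def successively_conv_nth)
qed

lemma distinct_nbrs: "1 \<le> v \<Longrightarrow> distinct (nbrs D v)"
  by (auto simp: nbrs_def sib_def elim!: evenE oddE)

text \<open>For \<open>D = 0\<close> the root is isolated, but \<open>nbrs\<close> still lists two
  neighbours for it; hence \<open>0 < D\<close>.\<close>

lemma arc_iff_nbrs:
  assumes "0 < D"
  shows "(a, b) \<in> parcs (cactus D) \<longleftrightarrow> a \<in> {1..<2 ^ Suc D} \<and> b \<in> set (nbrs D a)"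
proof -
  have "1 < (2::nat) ^ D" using assms by (intro one_less_power) simp_all
  then show ?thesis by (auto simp: arc_iff nbrs_def)
qed

lemma cactus_rot_nbr:
  assumes "0 < D" "v \<in> {1..<2 ^ Suc D}" "b \<in> set (nbrs D v)"
  shows "cactus_rot D (v, b) = (v, next_in (nbrs D v) b)"
  using assms by (simp add: cactus_rot_def arc_iff_nbrs)

lemma cycles_cactus_rot:
  assumes "0 < D" "v \<in> {1..<2 ^ Suc D}"
  shows "cycles (cactus_rot D) (map (Pair v) (nbrs D v))"
  using assms by (intro cycles_rot cactus_rot_nbr distinct_nbrs) (auto simp: nbrs_def)

lemma out_arcs_cactus:
  assumes "0 < D" "v \<in> {1..<2 ^ Suc D}"
  shows "out_arcs (with_proj (cactus D)) v = set (map (Pair v) (nbrs D v))"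
  using assms by (auto simp: out_arcs_def arc_iff_nbrs)

lemma cactus_rot_cyclic:
  assumes "0 < D" "v \<in> {1..<2 ^ Suc D}"
  shows "cyclic_on (cactus_rot D) (out_arcs (with_proj (cactus D)) v)"
proof -
  have "(v, hd (nbrs D v)) \<in> set (map (Pair v) (nbrs D v))" by (auto simp: nbrs_def)
  then show ?thesis
    unfolding out_arcs_cactus[OF assms]
    by (intro cyclic_on_singleI) (auto simp: cycles_orbit[OF cycles_cactus_rot[OF assms]])
qed

lemma cactus_rot_permutes:
  assumes "0 < D"
  shows "cactus_rot D permutes parcs (cactus D)"
proof (rule inj_imp_permutes)
  have nbr_arcs: "out_arcs (with_proj (cactus D)) v \<subseteq> parcs (cactus D)" for v
    by (auto simp: out_arcs_def)
  have out: "v \<in> {1..<2 ^ Suc D}" "(v, b) \<in> out_arcs (with_proj (cactus D)) v"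
    if "(v, b) \<in> parcs (cactus D)" for v b
    using that by (auto simp: arc_iff_nbrs[OF assms] out_arcs_def)
  show closed: "cactus_rot D e \<in> parcs (cactus D)" if "e \<in> parcs (cactus D)" for e
  proof -
    obtain v b where vb: "e = (v, b)" by force
    with that have "(v, b) \<in> parcs (cactus D)" by simp
    note o = out[OF this]
    from cyclic_on_inI[OF cactus_rot_cyclic[OF assms o(1)] o(2)] nbr_arcs[of v] show ?thesis
      unfolding vb by (rule set_rev_mp)
  qed
  \<comment> \<open>Each arc returns to itself under a positive power of the rotation, and the last
    step of this loop exhibits a preimage. On a finite set injectivity then follows.\<close>
  have surj: "parcs (cactus D) \<subseteq> cactus_rot D ` parcs (cactus D)"
  proof
    fix e assume e: "e \<in> parcs (cactus D)"
    obtain v b where vb: "e = (v, b)" by force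
    with e have "(v, b) \<in> parcs (cactus D)" by simp
    note o = out[OF this]
    have "(v, b) \<in> orbit (cactus_rot D) (v, b)"
      using cactus_rot_cyclic[OF assms o(1)] o(2) unfolding cyclic_on_alldef by blast
    then obtain n where n: "0 < n" "(cactus_rot D ^^ n) (v, b) = (v, b)" unfolding orbit_altdef by auto
    then obtain m where "n = Suc m" by (cases n) auto
    with n have "e = cactus_rot D ((cactus_rot D ^^ m) (v, b))" unfolding vb by simp
    moreover have "(cactus_rot D ^^ m) (v, b) \<in> parcs (cactus D)"
      using cyclic_on_funpow_in[OF cactus_rot_cyclic[OF assms o(1)] o(2)] nbr_arcs[of v] by (rule set_rev_mp)
    ultimately show "e \<in> cactus_rot D ` parcs (cactus D)" by (rule image_eqI)
  qed
  show fin: "finite (parcs (cactus D))" by (rule cactus.finite_arcs)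
  have "cactus_rot D ` parcs (cactus D) = parcs (cactus D)" using surj closed by blast
  with fin show "inj_on (cactus_rot D) (parcs (cactus D))" by (simp add: eq_card_imp_inj_on)
qed (simp add: cactus_rot_def)

section \<open>Faces\<close>

text \<open>The clockwise orientation of triangle \<open>v\<close>, which belongs to the external
  face; \<open>inner_face\<close> is the anticlockwise one, a bounded face by itself.\<close>

definition outer_arcs :: "nat \<Rightarrow> (nat \<times> nat) set" where
  "outer_arcs v = {(v, 2 * v), (2 * v, 2 * v + 1), (2 * v + 1, v)}"

definition inner_face :: "nat \<Rightarrow> (nat \<times> nat) set" where
  "inner_face v = {(2 * v, v), (v, 2 * v + 1), (2 * v + 1, 2 * v)}"

fun outer_walk :: "nat \<Rightarrow> nat \<Rightarrow> (nat \<times> nat) list" where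
  "outer_walk 0 v = []"
| "outer_walk (Suc d) v =
     (v, 2 * v) # outer_walk d (2 * v) @ (2 * v, 2 * v + 1) # outer_walk d (2 * v + 1) @ [(2 * v + 1, v)]"

definition outer_face :: "nat \<Rightarrow> (nat \<times> nat) set" where
  "outer_face D = (\<Union>v\<in>{1..<2 ^ D}. outer_arcs v)"

lemma triangle_arcs_split: "triangle_arcs v = outer_arcs v \<union> inner_face v"
  by (auto simp: triangle_arcs_def outer_arcs_def inner_face_def)

lemma outer_arcs_disjoint:
  assumes "1 \<le> v" "1 \<le> w" "v \<noteq> w"
  shows "outer_arcs v \<inter> outer_arcs w = {}" "inner_face v \<inter> inner_face w = {}"
    "triangle_arcs v \<inter> triangle_arcs w = {}"
  using assms by (auto simp: outer_arcs_def inner_face_def triangle_arcs_def)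

lemma outer_inner_disjoint:
  assumes "1 \<le> v" "1 \<le> w"
  shows "outer_arcs v \<inter> inner_face w = {}"
  using assms by (auto simp: outer_arcs_def inner_face_def) presburger+

lemma card_outer_face: "card (outer_face D) = 3 * (2 ^ D - 1)"
proof -
  have "card (outer_arcs v) = 3" if "1 \<le> v" for v using that by (simp add: outer_arcs_def card_insert_if)
  then have "card (outer_face D) = (\<Sum>v\<in>{1..<(2::nat) ^ D}. 3)"
    unfolding outer_face_def
    by (subst card_UN_disjoint) (auto simp: outer_arcs_disjoint outer_arcs_def)
  then show ?thesis by simp
qed

lemma card_parcs_cactus: "card (parcs (cactus D)) = 6 * (2 ^ D - 1)"
proof -
  have "card (triangle_arcs v) = 6" if "1 \<le> v" for v using that by (simp add: triangle_arcs_def card_insert_if)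
  then have "card (parcs (cactus D)) = (\<Sum>v\<in>{1..<(2::nat) ^ D}. 6)"
    unfolding parcs_cactus
    by (subst card_UN_disjoint) (auto simp: outer_arcs_disjoint triangle_arcs_def)
  then show ?thesis by simp
qed

lemma set_outer_walk:
  assumes "1 \<le> v"
  shows "set (outer_walk d v) = (\<Union>w\<in>{w. \<exists>k<d. w div 2 ^ k = v}. outer_arcs w)"
  using assms
proof (induction d arbitrary: v)
  case (Suc d)
  have "(\<exists>k<Suc d. w div 2 ^ k = v) \<longleftrightarrow> w = v \<or> (\<exists>k<d. w div 2 ^ k = 2 * v) \<or> (\<exists>k<d. w div 2 ^ k = 2 * v + 1)"
    (is "?L \<longleftrightarrow> ?R") for w
  proof
    assume ?L
    then obtain k where k: "k < Suc d" "w div 2 ^ k = v" by blast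
    show ?R
    proof (cases k)
      case (Suc j)
      then have "w div 2 ^ j div 2 = v" using k by (simp add: div_mult2_eq[symmetric] mult.commute)
      then have "w div 2 ^ j = 2 * v \<or> w div 2 ^ j = 2 * v + 1" by linarith
      then show ?thesis using Suc k by auto
    qed (use k in simp)
  next
    assume ?R
    moreover have "w div 2 ^ Suc j = v" if "w div 2 ^ j = 2 * v \<or> w div 2 ^ j = 2 * v + 1" for j
    proof -
      have "w div 2 ^ Suc j = w div 2 ^ j div 2" by (simp add: div_mult2_eq[symmetric] mult.commute)
      then show ?thesis using that by auto
    qed
    moreover have "w div 2 ^ 0 = w" by simp
    ultimately show ?L by (metis Suc_mono zero_less_Suc)
  qed
  then have "{w. \<exists>k<Suc d. w div 2 ^ k = v} =
      insert v ({w. \<exists>k<d. w div 2 ^ k = 2 * v} \<union> {w. \<exists>k<d. w div 2 ^ k = 2 * v + 1})" by blast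
  then show ?case
    using Suc.prems by (auto simp: Suc.IH outer_arcs_def)
qed simp

lemma length_outer_walk: "length (outer_walk d v) = 3 * (2 ^ d - 1)"
proof -
  have "length (outer_walk d v) + 3 = 3 * 2 ^ d"
    by (induction d v rule: outer_walk.induct) auto
  then show ?thesis by simp
qed

lemma set_outer_walk_root: "set (outer_walk D 1) = outer_face D"
proof -
  have "(\<exists>k<D. w div 2 ^ k = 1) \<longleftrightarrow> w \<in> {1..<2 ^ D}" for w :: nat
  proof
    assume "\<exists>k<D. w div 2 ^ k = 1"
    then obtain k where k: "k < D" "w div 2 ^ k = 1" by blast
    have "w < 2 ^ Suc k" using k(2) dividend_less_div_times[of "2 ^ k" w] by simp
    also have "\<dots> \<le> 2 ^ D" using k by (intro power_increasing) auto
    finally show "w \<in> {1..<2 ^ D}" using k by (cases "w = 0") auto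
  next
    assume w: "w \<in> {1..<2 ^ D}"
    then show "\<exists>k<D. w div 2 ^ k = 1"
    proof (induction D arbitrary: w)
      case (Suc D)
      show ?case
      proof (cases "w = 1")
        case False
        then have "w div 2 \<in> {1..<2 ^ D}" using Suc.prems by auto
        from Suc.IH[OF this] obtain k where "k < D" "w div 2 div 2 ^ k = 1" by blast
        then have "Suc k < Suc D" "w div 2 ^ Suc k = 1" by (simp_all add: div_mult2_eq)
        then show ?thesis by blast
      qed (auto intro: exI[of _ 0])
    qed simp
  qed
  then show ?thesis by (auto simp: set_outer_walk outer_face_def)
qed

text \<open>By counting: the walk is exactly as long as the number of arcs that it visits.\<close>

lemma distinct_outer_walk: "distinct (outer_walk D 1)"
  by (rule card_distinct) (simp only: set_outer_walk_root card_outer_face length_outer_walk)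

lemma face_succ_cactus:
  assumes "0 < D" "(a, b) \<in> parcs (cactus D)"
  shows "face_succ (cactus_rot D) (a, b) = (b, next_in (nbrs D b) a)"
  using assms arc_sym by (auto simp: face_succ_def cactus_rot_def)

lemma successively_glue:
  "successively P (xs @ [a]) \<Longrightarrow> successively P (a # ys) \<Longrightarrow> successively P (xs @ a # ys)"
  by (auto simp: successively_append_iff successively_Cons)

text \<open>The arcs by which the walk around the outer face enters and leaves the part below \<open>v\<close>.\<close>

definition entry :: "nat \<Rightarrow> nat \<times> nat" where
  "entry v = (if even v then v div 2 else v - 1, v)"

definition leave :: "nat \<Rightarrow> nat \<times> nat" where
  "leave v = (v, if even v then v + 1 else v div 2)"

text \<open>At a leaf the walk turns back at once. At an inner vertex it first goes on to the left
  child and leaves only after its return from the right child.\<close>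

lemma face_succ_steps:
  assumes "0 < D" "2 \<le> v" "v < 2 ^ Suc D"
  shows "2 ^ D \<le> v \<Longrightarrow> face_succ (cactus_rot D) (entry v) = leave v"
    and "v < 2 ^ D \<Longrightarrow> face_succ (cactus_rot D) (entry v) = (v, 2 * v)"
    and "v < 2 ^ D \<Longrightarrow> face_succ (cactus_rot D) (2 * v + 1, v) = leave v"
proof -
  have e: "entry v \<in> parcs (cactus D)"
    using assms(2,3) arc_sym[of v "sib v" D] arc_sym[of v "v div 2" D]
    by (cases "even v") (auto simp: entry_def arc_iff sib_def elim!: oddE)
  show "2 ^ D \<le> v \<Longrightarrow> face_succ (cactus_rot D) (entry v) = leave v"
    using assms face_succ_cactus[OF assms(1) e[unfolded entry_def]] one_less_power[of "2::nat" D]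
    by (auto simp: entry_def leave_def nbrs_def next_in_def sib_def elim!: oddE)
  show "v < 2 ^ D \<Longrightarrow> face_succ (cactus_rot D) (entry v) = (v, 2 * v)"
    using assms face_succ_cactus[OF assms(1) e[unfolded entry_def]]
    by (auto simp: entry_def leave_def nbrs_def next_in_def sib_def elim!: oddE)
  show "face_succ (cactus_rot D) (2 * v + 1, v) = leave v" if "v < 2 ^ D"
  proof -
    have "(2 * v + 1, v) \<in> parcs (cactus D)" using that assms by (intro arc_sym[of v]) (simp add: arc_iff)
    from face_succ_cactus[OF assms(1) this] show ?thesis
      using assms that by (auto simp: leave_def nbrs_def next_in_def sib_def elim!: oddE)
  qed
qed

text \<open>The level \<open>l\<close> guarantees that the walk of depth \<open>d\<close> ends
  exactly at the leaves. The walks below two siblings overlap in one arc,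
  \<open>leave (2 * v) = entry (2 * v + 1)\<close>, and are glued there.\<close>

lemma successively_outer_walk:
  assumes "0 < D" "l + d = D" "2 ^ l \<le> v" "v < 2 ^ Suc l" "2 \<le> v"
  shows "successively (\<lambda>a b. face_succ (cactus_rot D) a = b) (entry v # outer_walk d v @ [leave v])"
  using assms
proof (induction d arbitrary: l v)
  case 0
  then show ?case using face_succ_steps(1)[of D v] by simp
next
  case (Suc d)
  let ?S = "successively (\<lambda>a b. face_succ (cactus_rot D) a = b)"
  have "(2::nat) ^ Suc l \<le> 2 ^ D" using Suc.prems(2) by (intro power_increasing) auto
  with Suc.prems have v: "v < 2 ^ D" "v < 2 ^ Suc D" by auto
  have *: "leave (2 * v) = entry (2 * v + 1)" "entry (2 * v) = (v, 2 * v)"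
     "leave (2 * v) = (2 * v, 2 * v + 1)" "leave (2 * v + 1) = (2 * v + 1, v)"
    by (auto simp: leave_def entry_def)
  have "?S (entry (2 * v) # outer_walk d (2 * v) @ [leave (2 * v)])"
    by (rule Suc.IH[of "Suc l"]) (use Suc.prems in auto)
  moreover have "?S (leave (2 * v) # outer_walk d (2 * v + 1) @ [leave (2 * v + 1)])"
    unfolding *(1) by (rule Suc.IH[of "Suc l"]) (use Suc.prems in auto)
  ultimately have "?S ((entry (2 * v) # outer_walk d (2 * v) @ leave (2 * v) # outer_walk d (2 * v + 1)) @ [leave (2 * v + 1)])"
    using successively_glue[of _ "entry (2 * v) # outer_walk d (2 * v)" "leave (2 * v)"] by simp
  moreover have "?S [leave (2 * v + 1), leave v]"
    using face_succ_steps(3)[OF Suc.prems(1,5) v(2) v(1)] unfolding *(4) by simp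
  ultimately have "?S ((entry (2 * v) # outer_walk d (2 * v) @ leave (2 * v) # outer_walk d (2 * v + 1)) @ leave (2 * v + 1) # [leave v])"
    by (rule successively_glue)
  then show ?case
    using face_succ_steps(2)[OF Suc.prems(1,5) v(2) v(1)] by (simp add: *(2,3) *(3,4)[simplified])
qed

text \<open>The root has no arc of entry or leave, so the walks below its two children are joined by
  hand and closed up by the arc from 3 to 1.\<close>

lemma cycles_outer_walk:
  assumes "0 < D"
  shows "cycles (face_succ (cactus_rot D)) (outer_walk D 1)"
proof -
  let ?S = "successively (\<lambda>a b. face_succ (cactus_rot D) a = b)"
  obtain d where d: "D = Suc d" using assms by (cases D) auto
  have "?S (entry 2 # outer_walk d 2 @ [leave 2])" "?S (entry 3 # outer_walk d 3 @ [leave 3])"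
    by (rule successively_outer_walk[of D 1]; use assms d in simp)+
  moreover have *: "entry 2 = (1, 2)" "leave 2 = (2, 3)" "entry 3 = (2, 3)" "leave 3 = (3, 1)"
    by (auto simp: entry_def leave_def)
  ultimately have "?S (outer_walk D 1)"
    using successively_glue[of _ "entry 2 # outer_walk d 2" "leave 2"] by (simp add: d)
  moreover have "face_succ (cactus_rot D) (last (outer_walk D 1)) = hd (outer_walk D 1)"
  proof -
    have "(3, 1) \<in> parcs (cactus D)" using one_less_power[of "2::nat" D] assms by (auto simp: arc_iff)
    then show ?thesis using assms by (simp add: d face_succ_cactus next_in_def nbrs_def)
  qed
  moreover have "outer_walk D 1 \<noteq> []" by (simp add: d)
  ultimately show ?thesis using distinct_outer_walk unfolding cycles_def by blast
qed

lemma cycles_inner_face: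
  assumes "0 < D" "v \<in> {1..<2 ^ D}"
  shows "cycles (face_succ (cactus_rot D)) [(2 * v, v), (v, 2 * v + 1), (2 * v + 1, 2 * v)]"
proof -
  have v: "1 \<le> v" "v < 2 ^ D" using assms by auto
  have "(2 * v, v) \<in> parcs (cactus D)" "(v, 2 * v + 1) \<in> parcs (cactus D)" "(2 * v + 1, 2 * v) \<in> parcs (cactus D)"
    using assms(2) by (auto simp: arc_iff sib_def)
  note f = this[THEN face_succ_cactus[OF assms(1)]]
  have "next_in (nbrs D v) (2 * v) = 2 * v + 1"
    using v by (auto simp: nbrs_def next_in_def sib_def elim!: oddE)
  moreover have "next_in (nbrs D (2 * v + 1)) v = 2 * v"
    using v by (auto simp: nbrs_def next_in_def sib_def)
  moreover have "next_in (nbrs D (2 * v)) (2 * v + 1) = v"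
    using v by (auto simp: nbrs_def next_in_def sib_def)
  ultimately show ?thesis using v f by (simp add: cycles_def)
qed

lemma faces_cactus:
  assumes "0 < D"
  shows "faces (cactus D) (cactus_rot D) = insert (outer_face D) (inner_face ` {1..<2 ^ D})"
proof -
  let ?f = "face_succ (cactus_rot D)"
  have outer: "orbit ?f e = outer_face D" if "e \<in> outer_face D" for e
    using cycles_orbit[OF cycles_outer_walk[OF assms]] that by (simp add: set_outer_walk_root del: One_nat_def)
  have inner: "orbit ?f e = inner_face v" if "v \<in> {1..<2 ^ D}" "e \<in> inner_face v" for e v
    using cycles_orbit[OF cycles_inner_face[OF assms that(1)], of e] that(2) by (simp add: inner_face_def)
  have "parcs (cactus D) = outer_face D \<union> (\<Union>v\<in>{1..<2 ^ D}. inner_face v)"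
    by (auto simp: parcs_cactus outer_face_def triangle_arcs_split)
  moreover have "orbit ?f ` outer_face D = {outer_face D}"
  proof -
    have "(1, 2) \<in> outer_face D"
      using assms one_less_power[of "2::nat" D] by (auto simp: outer_face_def outer_arcs_def intro!: bexI[of _ 1])
    then show ?thesis using outer by blast
  qed
  moreover have "orbit ?f ` (\<Union>v\<in>{1..<2 ^ D}. inner_face v) = inner_face ` {1..<2 ^ D}"
  proof -
    have "orbit ?f ` inner_face v = {inner_face v}" if "v \<in> {1..<2 ^ D}" for v
      using inner[OF that] by (auto simp: inner_face_def)
    then show ?thesis by (auto simp: image_UN)
  qed
  ultimately show ?thesis by (simp add: faces_def image_Un)
qed

lemma plane_graph_cactus:
  assumes "0 < D"
  shows "plane_graph (cactus D) (cactus_rot D) (outer_face D)"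
proof -
  have faces: "card (faces (cactus D) (cactus_rot D)) = 2 ^ D"
  proof -
    have "inj_on inner_face {1..<2 ^ D}"
    proof (rule inj_onI, rule ccontr)
      fix v w assume vw: "v \<in> {1..<2 ^ D}" "w \<in> {1..<2 ^ D}" "inner_face v = inner_face w" "v \<noteq> w"
      then have "inner_face v \<inter> inner_face w = {}" by (intro outer_arcs_disjoint) auto
      with vw(3) have "inner_face v = {}" by simp
      then show False by (simp add: inner_face_def)
    qed
    then have "card (inner_face ` {1..<2 ^ D}) = 2 ^ D - 1" by (simp add: card_image)
    moreover have "outer_face D \<notin> inner_face ` {1..<2 ^ D}"
    proof
      assume "outer_face D \<in> inner_face ` {1..<2 ^ D}"
      then obtain v where v: "1 \<le> v" "v < 2 ^ D" "outer_face D = inner_face v" by auto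
      then have "outer_arcs v \<subseteq> inner_face v" by (auto simp: outer_face_def)
      with outer_inner_disjoint[OF v(1) v(1)] have "outer_arcs v = {}" by blast
      then show False by (simp add: outer_arcs_def)
    qed
    ultimately show ?thesis by (simp add: faces_cactus[OF assms])
  qed
  \<comment> \<open>Here \<open>n\<close> is \<open>2 ^ D\<close>: there are 2n - 1 vertices, n
    faces and 6(n - 1) arcs.\<close>
  have arith: "2 * n - 1 + n = 6 * (n - 1) div 2 + 2" if "1 \<le> n" for n :: nat
    using that by linarith
  have "card (pverts (cactus D)) = 2 * 2 ^ D - 1" by simp
  then have euler: "card (pverts (cactus D)) + card (faces (cactus D) (cactus_rot D)) =
      card (parcs (cactus D)) div 2 + 2"
    unfolding faces card_parcs_cactus by (simp only: arith[OF one_le_power[OF one_le_numeral]])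
  show ?thesis
  proof (intro plane_graph.intro plane_graph_axioms.intro)
    show "pair_graph (cactus D)" by (rule pair_graph_cactus)
    show "Digraph_Component.connected (with_proj (cactus D))" by (rule cactus_connected)
    show "cactus_rot D permutes parcs (cactus D)" by (rule cactus_rot_permutes[OF assms])
    show "cyclic_on (cactus_rot D) (out_arcs (with_proj (cactus D)) v)" if "v \<in> pverts (cactus D)" for v
      using cactus_rot_cyclic[OF assms] that by simp
    show "outer_face D \<in> faces (cactus D) (cactus_rot D)" unfolding faces_cactus[OF assms] by simp
  qed (rule euler)
qed

section \<open>Shortest paths between leaves\<close>

text \<open>The ancestor relation of the heap, reflexive. The number 0, which is no vertex, counts
  as an ancestor of everything.\<close>

definition below :: "nat \<Rightarrow> nat \<Rightarrow> bool" where
  "below v x \<longleftrightarrow> (\<exists>k. x div 2 ^ k = v)"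

definition on_level :: "nat \<Rightarrow> nat \<Rightarrow> bool" where
  "on_level d x \<longleftrightarrow> 2 ^ d \<le> x \<and> x < 2 ^ Suc d"

lemma below_rec: "below v x \<longleftrightarrow> v = x \<or> below v (x div 2)"
proof -
  have "below v x \<longleftrightarrow> x div 2 ^ 0 = v \<or> (\<exists>k. x div 2 ^ Suc k = v)"
    unfolding below_def by (metis not0_implies_Suc)
  then show ?thesis by (auto simp: below_def div_mult2_eq)
qed

lemma below_refl [simp]: "below v v"
  by (simp add: below_rec[of v v])

lemma below_trans: "below u v \<Longrightarrow> below v w \<Longrightarrow> below u w"
  unfolding below_def by (metis div_mult2_eq power_add)

lemma below_le: "below v x \<Longrightarrow> v \<le> x"
  by (auto simp: below_def)

lemma below_linear: "below u x \<Longrightarrow> below v x \<Longrightarrow> below u v \<or> below v u"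
proof -
  assume "below u x" "below v x"
  then obtain j k where *: "u = x div 2 ^ j" "v = x div 2 ^ k" by (auto simp: below_def)
  show ?thesis
  proof (cases "j \<le> k")
    case True
    then have "v = u div 2 ^ (k - j)" by (simp add: * div_mult2_eq[symmetric] power_add[symmetric])
    then show ?thesis by (auto simp: below_def)
  next
    case False
    then have "u = v div 2 ^ (j - k)" by (simp add: * div_mult2_eq[symmetric] power_add[symmetric])
    then show ?thesis by (auto simp: below_def)
  qed
qed

lemma on_level_div2: "on_level (Suc d) x \<Longrightarrow> on_level d (x div 2)"
  by (auto simp: on_level_def)

lemma on_level_0: "on_level 0 x \<longleftrightarrow> x = 1"
  by (auto simp: on_level_def)

lemma below_same_level:
  assumes "below u v" "on_level d u" "on_level d v"
  shows "u = v"
proof (rule ccontr)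
  assume "u \<noteq> v"
  then have "below u (v div 2)" using assms(1) below_rec by blast
  then have "u \<le> v div 2" by (rule below_le)
  then show False using assms(2,3) by (auto simp: on_level_def)
qed

text \<open>Meaningful only for distinct \<open>x\<close>, \<open>y\<close> on a common level.\<close>

function tree_path :: "nat \<Rightarrow> nat \<Rightarrow> nat list" where
  "tree_path x y =
     (if x div 2 = y div 2 then [x, y] else x # tree_path (x div 2) (y div 2) @ [y])"
  by auto
termination
proof (relation "measure (\<lambda>(x, y). x + y)")
  fix x y :: nat
  assume "x div 2 \<noteq> y div 2"
  then have "x \<noteq> 0 \<or> y \<noteq> 0" by auto
  then have "x div 2 + y div 2 < x + y" by linarith
  then show "((x div 2, y div 2), x, y) \<in> measure (\<lambda>(x, y). x + y)" by simp
qed simp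

declare tree_path.simps [simp del]

lemma tree_path_ends [simp]:
  "tree_path x y \<noteq> []" "hd (tree_path x y) = x" "last (tree_path x y) = y"
  by (simp_all add: tree_path.simps[of x y])

lemma rev_tree_path: "rev (tree_path x y) = tree_path y x"
proof (induction x y rule: tree_path.induct)
  case (1 x y)
  then show ?case by (subst (1 2) tree_path.simps) auto
qed

text \<open>Follows the recursion of \<open>tree_path\<close>: both ends climb in step until they
  are siblings. The level is also the depth of the cactus, so the induction hypothesis speaks about
  the cactus without its bottom level.\<close>

lemma level_induct [consumes 3, case_names sibling step]:
  assumes "on_level d x" "on_level d y" "x \<noteq> y"
    and sibling: "\<And>d x y. on_level (Suc d) x \<Longrightarrow> on_level (Suc d) y \<Longrightarrow> x \<noteq> y \<Longrightarrow> x div 2 = y div 2 \<Longrightarrow> P (Suc d) x y"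
    and step: "\<And>d x y. on_level (Suc d) x \<Longrightarrow> on_level (Suc d) y \<Longrightarrow> x div 2 \<noteq> y div 2 \<Longrightarrow>
      on_level d (x div 2) \<Longrightarrow> on_level d (y div 2) \<Longrightarrow> P d (x div 2) (y div 2) \<Longrightarrow> P (Suc d) x y"
  shows "P d x y"
  using assms(1-3)
proof (induction d arbitrary: x y)
  case 0
  then show ?case by (simp add: on_level_0)
next
  case (Suc d)
  show ?case
  proof (cases "x div 2 = y div 2")
    case False
    with Suc show ?thesis by (intro step) (auto simp: on_level_div2)
  qed (use Suc.prems sibling in blast)
qed

lemma on_level_ge2: "on_level (Suc d) x \<Longrightarrow> 2 \<le> x"
  using one_le_power[of "2::nat" d] unfolding on_level_def power_Suc by linarith

lemma on_level_sib: "on_level l v \<Longrightarrow> 2 \<le> v \<Longrightarrow> on_level l (sib v)"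
  by (cases l; cases "even v") (auto simp: on_level_def sib_def elim!: evenE oddE)

lemma set_tree_path_level:
  assumes "on_level d x" "on_level d y" "x \<noteq> y" "v \<in> set (tree_path x y)"
  shows "2 \<le> v \<and> v < 2 ^ Suc d"
  using assms
proof (induction arbitrary: rule: level_induct)
  case (sibling d x y)
  then show ?case
    using on_level_ge2 by (auto simp: tree_path.simps[of x y] on_level_def)
next
  case (step d x y)
  then show ?case
    using on_level_ge2[of d x] on_level_ge2[of d y] by (auto simp: tree_path.simps[of x y] on_level_def)
qed

text \<open>The path climbs through ancestors of \<open>x\<close>, crosses one sibling edge and
  descends through ancestors of \<open>y\<close>; the sibling edge bypasses precisely the common
  ancestors. Most later arguments use the path only through this description.\<close>

lemma set_tree_path:
  assumes "on_level d x" "on_level d y" "x \<noteq> y"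
  shows "set (tree_path x y) = {v. below v x \<noteq> below v y}"
  using assms
proof (induction rule: level_induct)
  case (sibling d x y)
  then have "\<not> below x y" "\<not> below y x" using below_same_level by metis+
  with sibling show ?case
    by (auto simp: tree_path.simps[of x y] below_rec[of _ x] below_rec[of _ y])
next
  case (step d x y)
  then have "\<not> below x y" "\<not> below y x" using below_same_level by metis+
  then have "\<not> below x (y div 2)" "\<not> below y (x div 2)" "\<not> below x (x div 2)" "\<not> below y (y div 2)"
    using below_rec[of x y] below_rec[of y x] below_le[of x "x div 2"] below_le[of y "y div 2"]
      on_level_ge2[OF step(1)] on_level_ge2[OF step(2)] by auto
  with step show ?case
    by (subst tree_path.simps) (auto simp: below_rec[of _ x] below_rec[of _ y])
qed

lemma distinct_tree_path:
  assumes "on_level d x" "on_level d y" "x \<noteq> y"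
  shows "distinct (tree_path x y)"
  using assms
proof (induction rule: level_induct)
  case (step d x y)
  then have "x div 2 \<noteq> y div 2" by simp
  from set_tree_path_level[OF step(4,5) this] step show ?case
    by (subst tree_path.simps) (force simp: on_level_def)
qed (simp add: tree_path.simps)

lemma siblings:
  "x div 2 = y div 2 \<Longrightarrow> x \<noteq> y \<Longrightarrow> 2 \<le> x \<Longrightarrow> y = sib x" for x y :: nat
  by (cases "even x"; cases "even y") (auto simp: sib_def elim!: evenE oddE)

lemma vwalk_arcs_tree_path_step:
  "x div 2 \<noteq> y div 2 \<Longrightarrow> vwalk_arcs (tree_path x y) =
     (x, x div 2) # vwalk_arcs (tree_path (x div 2) (y div 2)) @ [(y div 2, y)]"
  by (subst tree_path.simps) (simp add: vwalk_arcs_append)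

text \<open>The leaf \<open>x\<close> is a possible end of a path that leaves \<open>v\<close> through its neighbour \<open>w\<close>.\<close>

definition towards :: "nat \<Rightarrow> nat \<Rightarrow> nat \<Rightarrow> bool" where
  "towards v w x \<longleftrightarrow> (if w = v div 2 then \<not> below w x else below w x)"

text \<open>A path that moves up to the parent never returns to the sibling, which it would have
  reached by the sibling edge. Leaving upwards therefore means ending outside everything below the
  parent.\<close>

lemma tree_path_arcs:
  assumes "on_level d x" "on_level d y" "x \<noteq> y" "(v, w) \<in> set (vwalk_arcs (tree_path x y))"
  shows "(v, w) \<in> parcs (cactus d) \<and> towards v w y"
  using assms
proof (induction arbitrary: v w rule: level_induct)
  case (sibling d x y)
  then have "v = x" "w = y" "y = sib x" using siblings on_level_ge2 by (auto simp: tree_path.simps[of x y])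
  moreover have "y \<noteq> x div 2" using sibling on_level_div2[of d x] by (auto simp: on_level_def)
  ultimately show ?case using sibling on_level_ge2[of d x] by (simp add: towards_def arc_iff on_level_def)
next
  case (step d x y)
  from step.prems step.hyps(3) consider "v = x" "w = x div 2"
    | "(v, w) \<in> set (vwalk_arcs (tree_path (x div 2) (y div 2)))" | "v = y div 2" "w = y"
    by (auto simp: vwalk_arcs_tree_path_step)
  then show ?case
  proof cases
    case 1
    have "\<not> below (x div 2) (y div 2)" using step below_same_level by metis
    moreover have "x div 2 \<noteq> y" using step by (auto simp: on_level_def)
    ultimately have "\<not> below w y" using 1 below_rec by metis
    then show ?thesis using 1 step on_level_ge2[of d x] by (auto simp: towards_def arc_iff on_level_def)
  next
    case 2
    have a: "(v, w) \<in> parcs (cactus d)" "towards v w (y div 2)" using step.IH[OF 2] by auto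
    then have "w < 2 ^ Suc d" using arc_vertices by force
    then have "w \<noteq> y" using step by (auto simp: on_level_def)
    then have "below w y \<longleftrightarrow> below w (y div 2)" using below_rec by blast
    with a(2) have "towards v w y" by (simp only: towards_def)
    moreover have "(v, w) \<in> parcs (cactus (Suc d))" using a by (auto simp: arc_iff)
    ultimately show ?thesis by simp
  next
    case 3
    have "y = 2 * (y div 2) \<or> y = 2 * (y div 2) + 1" by linarith
    with 3 step show ?thesis by (auto simp: towards_def arc_iff on_level_def)
  qed
qed

lemma vpath_tree_path:
  assumes "on_level d x" "on_level d y" "x \<noteq> y"
  shows "vpath (tree_path x y) (with_proj (cactus d))"
  using distinct_tree_path[OF assms] set_tree_path_level[OF assms] tree_path_arcs[OF assms]
  by (auto simp: vpath_def vwalk_def dest!: set_tree_path_level[OF assms])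

lemma arc_level_cases:
  assumes "(a, b) \<in> parcs (cactus (Suc d))"
  obtains "(a, b) \<in> parcs (cactus d)" | "on_level (Suc d) a" "b = a div 2 \<or> b = sib a"
    | "on_level (Suc d) b" "a = b div 2"
proof (cases "(a, b) \<in> parcs (cactus d)")
  case False
  from assms consider "1 \<le> a" "a < 2 ^ Suc d" "b = 2 * a \<or> b = 2 * a + 1"
    | "2 \<le> a" "a < 2 ^ Suc (Suc d)" "b = a div 2 \<or> b = sib a" by (auto simp: arc_iff)
  then show ?thesis
  proof cases
    case 1
    with False have "2 ^ d \<le> a" by (auto simp: arc_iff)
    with 1 have "on_level (Suc d) b" "a = b div 2" by (auto simp: on_level_def)
    then show ?thesis by (rule that(3))
  next
    case 2
    with False have "2 ^ Suc d \<le> a" by (auto simp: arc_iff)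
    with 2 show ?thesis by (intro that(2)) (auto simp: on_level_def)
  qed
qed (rule that(1))

text \<open>A dual certificate for shortest paths: such an \<open>f\<close> grows by at most 1 along
  each arc, so summing along any walk from \<open>x\<close> to \<open>y\<close> bounds its length
  from below by that of the tree path.\<close>

lemma potential:
  assumes "on_level D x" "on_level D y" "x \<noteq> y"
  shows "\<exists>f :: nat \<Rightarrow> int. (\<forall>(a, b)\<in>parcs (cactus D). f b - f a \<le> 1) \<and>
    f y - f x = int (length (tree_path x y)) - 1"
  using assms
proof (induction rule: level_induct)
  case (sibling d x y)
  then show ?case
    by (intro exI[of _ "\<lambda>w. if w = y then 1 else 0"]) (auto simp: tree_path.simps[of x y])
next
  case (step d x y)
  then obtain f where f: "\<And>a b. (a, b) \<in> parcs (cactus d) \<Longrightarrow> f b - f a \<le> (1::int)"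
    "f (y div 2) - f (x div 2) = int (length (tree_path (x div 2) (y div 2))) - 1" by auto
  \<comment> \<open>The new bottom level inherits the value of the parent, lowered at
    \<open>x\<close> and raised at \<open>y\<close>. Two siblings would differ by 2 only if they
    were \<open>x\<close> and \<open>y\<close> themselves, and these have different parents
    here.\<close>
  define g where "g w = (if w < 2 ^ Suc d then f w else if w = x then f (w div 2) - 1
    else if w = y then f (w div 2) + 1 else f (w div 2))" for w
  have "g b - g a \<le> 1" if "(a, b) \<in> parcs (cactus (Suc d))" for a b
    using that
  proof (cases rule: arc_level_cases)
    case 1
    then have "a < 2 ^ Suc d" "b < 2 ^ Suc d" using arc_vertices by force+
    with f(1)[OF 1] show ?thesis by (simp add: g_def)
  next
    case 2
    then have "2 \<le> a" using on_level_ge2 by blast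
    have "on_level (Suc d) (sib a)" by (rule on_level_sib[OF 2(1) \<open>2 \<le> a\<close>])
    then have "\<not> sib a < 2 ^ Suc d" "\<not> a < 2 ^ Suc d" "a div 2 < 2 ^ Suc d"
      using 2(1) by (auto simp: on_level_def)
    then have g: "g (a div 2) = f (a div 2)"
      "g a = (if a = x then f (a div 2) - 1 else if a = y then f (a div 2) + 1 else f (a div 2))"
      by (auto simp: g_def)
    have g': "g (sib a) = (if sib a = x then f (a div 2) - 1 else if sib a = y then f (a div 2) + 1 else f (a div 2))"
      using \<open>\<not> sib a < 2 ^ Suc d\<close>
      unfolding sib_div2[OF \<open>2 \<le> a\<close>, symmetric] by (auto simp: g_def)
    have "\<not> (a = x \<and> sib a = y)" using step(3) sib_div2[OF \<open>2 \<le> a\<close>] by auto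
    then show ?thesis using 2(2) sib_neq[OF \<open>2 \<le> a\<close>] g g' by (auto split: if_splits)
  next
    case 3
    then have "\<not> b < 2 ^ Suc d" "a < 2 ^ Suc d" by (auto simp: on_level_def)
    then have "g a = f (b div 2)" "g b = f (b div 2) - 1 \<or> g b = f (b div 2) + 1 \<or> g b = f (b div 2)"
      unfolding 3(2) g_def by auto
    then show ?thesis by auto
  qed
  moreover have "g y - g x = int (length (tree_path x y)) - 1"
  proof -
    have "length (tree_path x y) = length (tree_path (x div 2) (y div 2)) + 2"
      using step(3) by (subst tree_path.simps) simp
    moreover have "x \<noteq> y" using step(3) by auto
    then have "g y = f (y div 2) + 1" "g x = f (x div 2) - 1"
      using step(1,2) by (simp_all add: g_def on_level_def)
    ultimately show ?thesis using f(2) by simp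
  qed
  ultimately show ?case by blast
qed

lemma (in pair_wf_digraph) awalk_vwalk_arcs:
  assumes "vwalk p (with_proj G)"
  shows "awalk (hd p) (vwalk_arcs p) (last p)"
  using assms
  by (induction p rule: vwalk_arcs.induct) (auto simp: vwalk_def awalk_Cons_iff awalk_Nil_iff)

lemma shortest_tree_path:
  assumes "on_level D x" "on_level D y" "x \<noteq> y"
  shows "shortest_path (cactus D) (\<lambda>_. 1) (tree_path x y)"
proof -
  obtain f :: "nat \<Rightarrow> int" where f: "\<And>a b. (a, b) \<in> parcs (cactus D) \<Longrightarrow> f b - f a \<le> 1"
    "f y - f x = int (length (tree_path x y)) - 1"
    using potential[OF assms] by auto
  have cost: "cactus.awalk_cost (\<lambda>_. 1) p = real (length p)" for p :: "(nat \<times> nat) list"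
    by (induction p) auto
  have bound: "f v - f u \<le> int (length p)" if "cactus.awalk D u p v" for u p v
    using that
  proof (induction p arbitrary: u)
    case (Cons e p)
    then have "e \<in> parcs (cactus D)" "fst e = u" "cactus.awalk D (snd e) p v"
      by (auto simp: cactus.awalk_Cons_iff)
    with Cons.IH f(1)[of u "snd e"] show ?case by (cases e) force
  qed (simp add: cactus.awalk_Nil_iff)
  have walk: "cactus.awalk D x (vwalk_arcs (tree_path x y)) y"
    using cactus.awalk_vwalk_arcs vpath_tree_path[OF assms] by (metis tree_path_ends(2,3) vpath_def)
  have "cactus.\<mu> D (\<lambda>_. 1) x y = ereal (real (length (tree_path x y) - 1))"
    unfolding cactus.\<mu>_def
  proof (rule antisym)
    show "(INF p\<in>{p. cactus.awalk D x p y}. ereal (cactus.awalk_cost (\<lambda>_. 1) p)) \<le> ereal (real (length (tree_path x y) - 1))"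
      by (rule INF_lower2[of "vwalk_arcs (tree_path x y)"]) (use walk in \<open>auto simp: cost vwalk_length_def[symmetric]\<close>)
    show "ereal (real (length (tree_path x y) - 1)) \<le> (INF p\<in>{p. cactus.awalk D x p y}. ereal (cactus.awalk_cost (\<lambda>_. 1) p))"
      using bound f(2) by (intro INF_greatest) (force simp: cost)
  qed
  then show ?thesis
    using vpath_tree_path[OF assms] by (simp add: shortest_path_def cost vwalk_length_def[symmetric])
qed

section \<open>Crossings\<close>

lemma ex_on_level: "1 \<le> v \<Longrightarrow> \<exists>l. on_level l v"
proof (induction v rule: less_induct)
  case (less v)
  show ?case
  proof (cases "v = 1")
    case False
    then have "1 \<le> v div 2" "v div 2 < v" using less.prems by auto
    then obtain l where "on_level l (v div 2)" using less.IH by blast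
    then have "on_level (Suc l) v" by (auto simp: on_level_def)
    then show ?thesis by blast
  qed (auto simp: on_level_def intro: exI[of _ 0])
qed

lemma on_level_unique: "on_level d x \<Longrightarrow> on_level e x \<Longrightarrow> d = e"
proof (rule ccontr)
  assume *: "on_level d x" "on_level e x" "d \<noteq> e"
  then consider "Suc d \<le> e" | "Suc e \<le> d" by linarith
  then show False
  proof cases
    case 1
    then have "(2::nat) ^ Suc d \<le> 2 ^ e" by (intro power_increasing) auto
    with * show False by (auto simp: on_level_def)
  next
    case 2
    then have "(2::nat) ^ Suc e \<le> 2 ^ d" by (intro power_increasing) auto
    with * show False by (auto simp: on_level_def)
  qed
qed

lemma on_level_div_power:
  assumes "on_level D x" "k \<le> D"
  shows "on_level (D - k) (x div 2 ^ k)"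
  using assms(2)
proof (induction k)
  case (Suc k)
  then have "on_level (Suc (D - Suc k)) (x div 2 ^ k)" by (simp add: Suc_diff_Suc)
  from on_level_div2[OF this] show ?case by (simp add: div_mult2_eq[symmetric] mult.commute)
qed (use assms in simp)

text \<open>With both levels fixed, being below \<open>v\<close> is a single division. As division
  is monotone, the leaves below a vertex are consecutive numbers, which gives
  \<open>below_less\<close> and \<open>below_convex\<close>.\<close>

lemma below_iff_div:
  assumes "on_level D x" "on_level l v"
  shows "below v x \<longleftrightarrow> l \<le> D \<and> x div 2 ^ (D - l) = v"
proof
  assume "below v x"
  then obtain k where k: "x div 2 ^ k = v" by (auto simp: below_def)
  have "k \<le> D"
  proof (rule ccontr)
    assume "\<not> k \<le> D"
    then have "(2::nat) ^ Suc D \<le> 2 ^ k" by (intro power_increasing) auto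
    then have "v = 0" using k assms(1) by (auto simp: on_level_def)
    then show False using assms(2) by (auto simp: on_level_def)
  qed
  with on_level_div_power[OF assms(1)] k assms(2) have "l = D - k" using on_level_unique by blast
  with \<open>k \<le> D\<close> k show "l \<le> D \<and> x div 2 ^ (D - l) = v" by simp
qed (auto simp: below_def)

lemma below_less:
  assumes "on_level l u" "on_level l v" "u < v" "below u a" "below v b" "on_level D a" "on_level D b"
  shows "a < b"
proof (rule ccontr)
  assume "\<not> a < b"
  then have "b div 2 ^ (D - l) \<le> a div 2 ^ (D - l)" by (intro div_le_mono) simp
  moreover have "a div 2 ^ (D - l) = u" using below_iff_div[OF assms(6,1)] assms(4) by simp
  moreover have "b div 2 ^ (D - l) = v" using below_iff_div[OF assms(7,2)] assms(5) by simp
  ultimately show False using assms(3) by simp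
qed

lemma below_convex:
  assumes "1 \<le> u" "below u a" "below u b" "a \<le> c" "c \<le> b" "on_level D a" "on_level D b" "on_level D c"
  shows "below u c"
proof -
  obtain l where l: "on_level l u" using ex_on_level assms(1) by blast
  have "a div 2 ^ (D - l) \<le> c div 2 ^ (D - l)" "c div 2 ^ (D - l) \<le> b div 2 ^ (D - l)"
    using assms(4,5) by (auto intro: div_le_mono)
  moreover have "l \<le> D" "a div 2 ^ (D - l) = u" using below_iff_div[OF assms(6) l] assms(2) by simp_all
  moreover have "b div 2 ^ (D - l) = u" using below_iff_div[OF assms(7) l] assms(3) by simp
  ultimately show ?thesis using below_iff_div[OF assms(8) l] by simp
qed

definition cyclic_order :: "nat \<Rightarrow> nat \<Rightarrow> nat \<Rightarrow> bool" where
  "cyclic_order a b c \<longleftrightarrow> a < b \<and> b < c \<or> b < c \<and> c < a \<or> c < a \<and> a < b"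

text \<open>The arithmetic of one inner vertex. Position 0 is the parent, whose leaves lie outside
  the range spanned by the others; positions 1 to 3 lead to increasing blocks of leaves. So
  positions and leaves have the same cyclic order.\<close>

lemma cyclic_order_positions:
  fixes i j k :: nat
  assumes ijk: "i < 4" "j < 4" "k < 4" "i \<noteq> j" "i \<noteq> k" "j \<noteq> k"
    and lt: "0 < i \<Longrightarrow> i < j \<Longrightarrow> a < b" "0 < j \<Longrightarrow> j < i \<Longrightarrow> b < a"
    "0 < i \<Longrightarrow> i < k \<Longrightarrow> a < c" "0 < k \<Longrightarrow> k < i \<Longrightarrow> c < a"
    "0 < j \<Longrightarrow> j < k \<Longrightarrow> b < c" "0 < k \<Longrightarrow> k < j \<Longrightarrow> c < b"
    and out: "i = 0 \<Longrightarrow> \<not> (b \<le> a \<and> a \<le> c) \<and> \<not> (c \<le> a \<and> a \<le> b)"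
    "j = 0 \<Longrightarrow> \<not> (a \<le> b \<and> b \<le> c) \<and> \<not> (c \<le> b \<and> b \<le> a)"
    "k = 0 \<Longrightarrow> \<not> (a \<le> c \<and> c \<le> b) \<and> \<not> (b \<le> c \<and> c \<le> a)"
  shows "((j + 4 - i) mod 4 < (k + 4 - i) mod 4 \<longleftrightarrow> cyclic_order a b c) \<and> a \<noteq> b \<and> a \<noteq> c \<and> b \<noteq> c"
proof -
  have "i = 0 \<or> i = 1 \<or> i = 2 \<or> i = 3" "j = 0 \<or> j = 1 \<or> j = 2 \<or> j = 3"
    "k = 0 \<or> k = 1 \<or> k = 2 \<or> k = 3" using ijk(1-3) by linarith+
  then have pos: "(j + 4 - i) mod 4 < (k + 4 - i) mod 4 \<longleftrightarrow> cyclic_order i j k"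
    using ijk(4-6) unfolding cyclic_order_def by (elim disjE; hypsubst; simp)
  have "i < j \<or> j < i" "i < k \<or> k < i" "j < k \<or> k < j" using ijk by auto
  consider "i = 0" "0 < j" "0 < k" | "j = 0" "0 < i" "0 < k" | "k = 0" "0 < i" "0 < j" | "0 < i" "0 < j" "0 < k"
    using ijk(4-6) by (cases "i = 0"; cases "j = 0"; cases "k = 0") simp_all
  then show ?thesis
  proof cases
    case 1
    with out(1) have o: "\<not> (b \<le> a \<and> a \<le> c) \<and> \<not> (c \<le> a \<and> a \<le> b)" by simp
    from \<open>j < k \<or> k < j\<close> show ?thesis
    proof
      assume "j < k"
      then show ?thesis unfolding pos cyclic_order_def using 1 lt(5)[OF 1(2)] o by linarith
    next
      assume "k < j"
      then show ?thesis unfolding pos cyclic_order_def using 1 lt(6)[OF 1(3)] o by linarith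
    qed
  next
    case 2
    with out(2) have o: "\<not> (a \<le> b \<and> b \<le> c) \<and> \<not> (c \<le> b \<and> b \<le> a)" by simp
    from \<open>i < k \<or> k < i\<close> show ?thesis
    proof
      assume "i < k"
      then show ?thesis unfolding pos cyclic_order_def using 2 lt(3)[OF 2(2)] o by linarith
    next
      assume "k < i"
      then show ?thesis unfolding pos cyclic_order_def using 2 lt(4)[OF 2(3)] o by linarith
    qed
  next
    case 3
    with out(3) have o: "\<not> (a \<le> c \<and> c \<le> b) \<and> \<not> (b \<le> c \<and> c \<le> a)" by simp
    from \<open>i < j \<or> j < i\<close> show ?thesis
    proof
      assume "i < j"
      then show ?thesis unfolding pos cyclic_order_def using 3 lt(1)[OF 3(2)] o by linarith
    next
      assume "j < i"
      then show ?thesis unfolding pos cyclic_order_def using 3 lt(2)[OF 3(3)] o by linarith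
    qed
  next
    case 4
    have "a < b \<longleftrightarrow> i < j" "b < a \<longleftrightarrow> j < i" "a < c \<longleftrightarrow> i < k" "c < a \<longleftrightarrow> k < i" "b < c \<longleftrightarrow> j < k" "c < b \<longleftrightarrow> k < j"
      using lt(1,3)[OF 4(1)] lt(2,5)[OF 4(2)] lt(4,6)[OF 4(3)] ijk(4-6)
      by (meson linorder_neqE_nat less_asym)+
    then show ?thesis unfolding pos cyclic_order_def using ijk(4-6) by auto
  qed
qed
lemma inner_nbrs:
  assumes "2 \<le> v" "v < 2 ^ D"
  shows "length (nbrs D v) = 4" "nbrs D v ! 0 = v div 2"
    "0 < j \<Longrightarrow> j < 4 \<Longrightarrow> towards v (nbrs D v ! j) a \<Longrightarrow> below (v div 2) a"
    "0 < i \<Longrightarrow> i < j \<Longrightarrow> j < 4 \<Longrightarrow> towards v (nbrs D v ! i) a \<Longrightarrow> towards v (nbrs D v ! j) b \<Longrightarrow>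
      on_level D a \<Longrightarrow> on_level D b \<Longrightarrow> a < b"
proof -
  have nb: "nbrs D v = (if even v then [v div 2, 2 * v, 2 * v + 1, sib v] else [v div 2, sib v, 2 * v, 2 * v + 1])"
    using assms by (simp add: nbrs_def)
  then show "length (nbrs D v) = 4" "nbrs D v ! 0 = v div 2" by auto
  have up: "below (v div 2) w" if "w = 2 * v \<or> w = 2 * v + 1 \<or> w = sib v" for w
  proof -
    have "below (v div 2) v" using below_rec[of "v div 2" v] by simp
    moreover have "below v (2 * v)" "below v (2 * v + 1)" using below_rec[of v "2 * v"] below_rec[of v "2 * v + 1"] by simp_all
    moreover have "below (v div 2) (sib v)"
      using below_rec[of "v div 2" "sib v"] sib_div2[OF assms(1)] by simp
    ultimately show ?thesis using that below_trans by blast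
  qed
  have ne: "v div 2 \<noteq> 2 * v" "v div 2 \<noteq> 2 * v + 1" "v div 2 \<noteq> sib v"
    using assms(1) by (auto simp: sib_def elim!: evenE oddE)
  show "below (v div 2) a" if "0 < j" "j < 4" "towards v (nbrs D v ! j) a"
  proof -
    from that(1,2) have "j = 1 \<or> j = 2 \<or> j = 3" by auto
    then obtain w where "nbrs D v ! j = w" "w = 2 * v \<or> w = 2 * v + 1 \<or> w = sib v" "w \<noteq> v div 2"
      using ne by (auto simp: nb)
    with that(3) show ?thesis using up below_trans by (auto simp: towards_def)
  qed
  obtain l where l: "on_level l v" using ex_on_level assms(1) by force
  have l2: "on_level (Suc l) (2 * v)" "on_level (Suc l) (2 * v + 1)" using l by (auto simp: on_level_def)
  have ls: "on_level l (sib v)"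
    using l assms(1) by (rule on_level_sib)
  have b: "below v a" if "below (2 * v) a \<or> below (2 * v + 1) a" for a
  proof -
    have "below v (2 * v)" "below v (2 * v + 1)" using below_rec[of v "2 * v"] below_rec[of v "2 * v + 1"] by simp_all
    then show ?thesis using that below_trans by blast
  qed
  show "a < b" if "0 < i" "i < j" "j < 4" "towards v (nbrs D v ! i) a" "towards v (nbrs D v ! j) b"
      "on_level D a" "on_level D b"
  proof -
    from that(1-3) have ij: "i = 1 \<and> j = 2 \<or> i = 1 \<and> j = 3 \<or> i = 2 \<and> j = 3" by auto
    show ?thesis
    proof (cases "even v")
      case True
      then have "v < sib v" by (simp add: sib_def)
      then show ?thesis
        using ij that(4-7) ne True b[of a] below_less[OF l2, of a b D] below_less[OF l ls, of a b D]
        by (auto simp: nb towards_def)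
    next
      case False
      then have "sib v < v" using assms(1) by (auto simp: sib_def)
      then show ?thesis
        using ij that(4-7) ne False b[of b] below_less[OF l2, of a b D] below_less[OF ls l, of a b D]
        by (auto simp: nb towards_def)
    qed
  qed
qed

text \<open>Translates a local side at \<open>v\<close> into a global position: the leaves reached
  through the neighbours of \<open>v\<close> lie around the external face in the same cyclic order
  as these neighbours lie around \<open>v\<close>.\<close>

lemma on_left_iff:
  assumes "0 < D" "2 \<le> v" "v < 2 ^ D"
    and nb: "x \<in> set (nbrs D v)" "y \<in> set (nbrs D v)" "z \<in> set (nbrs D v)" "x \<noteq> y" "x \<noteq> z" "y \<noteq> z"
    and tw: "towards v x a" "towards v y b" "towards v z c"
    and lev: "on_level D a" "on_level D b" "on_level D c"
  shows "on_left (cactus_rot D) x v z y \<longleftrightarrow> cyclic_order a b c"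
    and "a \<noteq> b" "a \<noteq> c" "b \<noteq> c"
proof -
  let ?n = "nbrs D v"
  note I = inner_nbrs[OF assms(2,3)]
  obtain i j k where ijk: "i < 4" "j < 4" "k < 4" "x = ?n ! i" "y = ?n ! j" "z = ?n ! k"
    using nb I(1) by (metis in_set_conv_nth)
  have v: "v \<in> {1..<2 ^ Suc D}" using assms by auto
  have dist: "funpow_dist (cactus_rot D) (v, ?n ! p) (v, ?n ! q) = (q + 4 - p) mod 4" if "p < 4" "q < 4" for p q
    using cycles_funpow_dist[OF cycles_cactus_rot[OF assms(1) v], of p q] that I(1) by simp
  have left: "on_left (cactus_rot D) x v z y \<longleftrightarrow> (j + 4 - i) mod 4 < (k + 4 - i) mod 4"
    using ijk dist by (simp add: on_left_def)
  have neq: "i \<noteq> j" "i \<noteq> k" "j \<noteq> k" using ijk nb by auto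
  have first: "\<not> (below (v div 2) r)" if "towards v (?n ! 0) r" for r
    using that I(2) by (simp add: towards_def)
  have outside: "\<not> (p \<le> r \<and> r \<le> q)"
    if "towards v (?n ! 0) r" "towards v (?n ! m) p" "towards v (?n ! m') q" "0 < m" "m < 4" "0 < m'" "m' < 4"
      "on_level D p" "on_level D q" "on_level D r" for p q r m m'
  proof -
    have "1 \<le> v div 2" using assms(2) by linarith
    with below_convex[of "v div 2" p q r D] first[OF that(1)] I(3)[OF _ _ that(2)] I(3)[OF _ _ that(3)] that
    show ?thesis by auto
  qed
  have T: "towards v (?n ! i) a" "towards v (?n ! j) b" "towards v (?n ! k) c" using tw ijk by auto
  have lt: "0 < i \<Longrightarrow> i < j \<Longrightarrow> a < b" "0 < j \<Longrightarrow> j < i \<Longrightarrow> b < a"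
    "0 < i \<Longrightarrow> i < k \<Longrightarrow> a < c" "0 < k \<Longrightarrow> k < i \<Longrightarrow> c < a"
    "0 < j \<Longrightarrow> j < k \<Longrightarrow> b < c" "0 < k \<Longrightarrow> k < j \<Longrightarrow> c < b"
    using I(4) T ijk(1-3) lev by blast+
  have out: "i = 0 \<Longrightarrow> \<not> (b \<le> a \<and> a \<le> c) \<and> \<not> (c \<le> a \<and> a \<le> b)"
    "j = 0 \<Longrightarrow> \<not> (a \<le> b \<and> b \<le> c) \<and> \<not> (c \<le> b \<and> b \<le> a)"
    "k = 0 \<Longrightarrow> \<not> (a \<le> c \<and> c \<le> b) \<and> \<not> (b \<le> c \<and> c \<le> a)"
    using outside T ijk(1-3) lev neq by (metis gr0I)+
  have "(on_left (cactus_rot D) x v z y \<longleftrightarrow> cyclic_order a b c) \<and> a \<noteq> b \<and> a \<noteq> c \<and> b \<noteq> c"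
    unfolding left using ijk(1-3) neq lt out by (rule cyclic_order_positions)
  then show "on_left (cactus_rot D) x v z y \<longleftrightarrow> cyclic_order a b c" "a \<noteq> b" "a \<noteq> c" "b \<noteq> c" by auto
qed

lemma vwalk_arcs_mid: "(u, w) \<in> set (vwalk_arcs (xs @ u # w # ys))"
  by (cases xs) (auto simp: vwalk_arcs_append simp flip: append_Cons)

lemma tree_path_consecutive:
  assumes "0 < D" "on_level D x" "on_level D y" "x \<noteq> y" "tree_path x y = xs @ u # w # ys"
  shows "towards u w y" "towards w u x" "w \<in> set (nbrs D u)" "u \<in> set (nbrs D w)"
proof -
  have "(u, w) \<in> set (vwalk_arcs (tree_path x y))" unfolding assms(5) by (rule vwalk_arcs_mid)
  from tree_path_arcs[OF assms(2-4) this] show "towards u w y" "w \<in> set (nbrs D u)"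
    by (auto simp: arc_iff_nbrs[OF assms(1)])
  have "tree_path y x = rev ys @ w # u # rev xs"
    using rev_tree_path[of x y] by (simp add: assms(5))
  then have "(w, u) \<in> set (vwalk_arcs (tree_path y x))" by (simp add: vwalk_arcs_mid)
  from tree_path_arcs[OF assms(3,2) assms(4)[symmetric] this] show "towards w u x" "u \<in> set (nbrs D w)"
    by (auto simp: arc_iff_nbrs[OF assms(1)])
qed

text \<open>The root and the leaves have only two neighbours, so a crossing can start or end only at
  a vertex to which \<open>on_left_iff\<close> applies.\<close>

lemma three_nbrs:
  assumes "a \<in> set (nbrs D v)" "b \<in> set (nbrs D v)" "c \<in> set (nbrs D v)" "a \<noteq> b" "a \<noteq> c" "b \<noteq> c" "1 \<le> v"
  shows "2 \<le> v \<and> v < 2 ^ D"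
  using assms by (auto simp: nbrs_def not_le split: if_splits)

text \<open>By \<open>on_left_iff\<close>, the side on which the second path arrives is determined
  by the stretch of leaves between \<open>x\<close> and \<open>y\<close> that contains
  \<open>x'\<close>, and the side of departure by the one that contains \<open>y'\<close>. A
  crossing thus makes the ends interleave.\<close>

lemma crosses_along_separates:
  assumes D: "0 < D" and lev: "on_level D x" "on_level D y" "x \<noteq> y" "on_level D x'" "on_level D y'" "x' \<noteq> y'"
    and cr: "crosses_along (cactus_rot D) (tree_path x y) (tree_path x' y') c"
  shows "cyclic_order x x' y \<noteq> cyclic_order x y' y" "x' \<notin> {x, y}" "y' \<notin> {x, y}"
proof -
  from cr obtain a b a' b' ps ss ps' ss' where *: "c \<noteq> []"
    "tree_path x y = ps @ (a # c @ [b]) @ ss" "tree_path x' y' = ps' @ (a' # c @ [b']) @ ss'"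
    "a' \<noteq> a" "a' \<noteq> hd (tl (c @ [b]))" "b' \<noteq> b" "b' \<noteq> last (a # butlast c)"
    "on_left (cactus_rot D) a (hd c) (hd (tl (c @ [b]))) a' \<noteq> on_left (cactus_rot D) (last (a # butlast c)) (last c) b b'"
    unfolding crosses_along_def Let_def sublist_def by blast
  define s t v w where "s = hd (tl (c @ [b]))" and "t = last (a # butlast c)" and "v = hd c" and "w = last c"
  have dist: "distinct (a # c @ [b])" using distinct_tree_path[OF lev(1-3)] by (simp add: *(2))
  \<comment> \<open>Splitting \<open>c\<close> at its first and at its last vertex exposes the
    consecutive triples \<open>a\<close>, \<open>v\<close>, \<open>s\<close> and \<open>t\<close>,
    \<open>w\<close>, \<open>b\<close>. If \<open>c\<close> is a single vertex, then
    \<open>s\<close> is \<open>b\<close> and \<open>t\<close> is \<open>a\<close>.\<close>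
  obtain c1 where c1: "c = v # c1" using *(1) v_def by (cases c) auto
  obtain c2 where c2: "c = c2 @ [w]" using *(1) w_def by (metis append_butlast_last_id)
  obtain r where r: "c1 @ [b] = s # r" unfolding s_def c1 by (cases c1) auto
  obtain r' where r': "a # c2 = r' @ [t]" unfolding t_def c2 by (metis append_butlast_last_id butlast_snoc list.distinct(1))
  have p: "tree_path x y = ps @ a # v # (c1 @ [b]) @ ss" using *(2) by (simp add: c1)
  then have p': "tree_path x y = (ps @ [a]) @ v # s # r @ ss" unfolding r by simp
  have "tree_path x y = ps @ (a # c2) @ w # b # ss" using *(2) unfolding c2 by simp
  then have p'': "tree_path x y = (ps @ r') @ t # w # b # ss" unfolding r' by simp
  then have p3: "tree_path x y = (ps @ r' @ [t]) @ w # b # ss" by simp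
  have q: "tree_path x' y' = ps' @ a' # v # (c1 @ [b'] @ ss')" "tree_path x' y' = (ps' @ a' # c2) @ w # b' # ss'"
    using *(3) by (simp add: c1, unfold c2, simp)
  note P = tree_path_consecutive[OF D lev(1-3)] and Q = tree_path_consecutive[OF D lev(4-6)]
  have pos: "1 \<le> v" "1 \<le> w"
  proof -
    have "v \<in> set (tree_path x y)" unfolding p by simp
    then show "1 \<le> v" using set_tree_path_level[OF lev(1-3)] by fastforce
    have "w \<in> set (tree_path x y)" unfolding p'' by simp
    then show "1 \<le> w" using set_tree_path_level[OF lev(1-3)] by fastforce
  qed
  have ne: "a \<noteq> s" "t \<noteq> b"
  proof -
    have "distinct (a # v # (c1 @ [b]))" using dist c1 by simp
    then show "a \<noteq> s" unfolding r by auto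
    have "distinct ((a # c2) @ [w, b])" using dist unfolding c2 by simp
    then show "t \<noteq> b" unfolding r' by auto
  qed
  have ne': "a \<noteq> a'" "a' \<noteq> s" "t \<noteq> b'" "b' \<noteq> b" using *(4-7) unfolding s_def t_def by blast+
  have v: "2 \<le> v" "v < 2 ^ D"
    using three_nbrs[OF P(4)[OF p] Q(4)[OF q(1)] P(3)[OF p'] ne'(1) ne(1) ne'(2) pos(1)] by auto
  have w: "2 \<le> w" "w < 2 ^ D"
    using three_nbrs[OF P(4)[OF p''] Q(3)[OF q(2)] P(3)[OF p3] ne'(3) ne(2) ne'(4) pos(2)] by auto
  note L1 = on_left_iff[OF D v P(4)[OF p] Q(4)[OF q(1)] P(3)[OF p'] ne'(1) ne(1) ne'(2)
    P(2)[OF p] Q(2)[OF q(1)] P(1)[OF p'] lev(1,4,2)]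
  note L2 = on_left_iff[OF D w P(4)[OF p''] Q(3)[OF q(2)] P(3)[OF p3] ne'(3) ne(2) ne'(4)
    P(2)[OF p''] Q(1)[OF q(2)] P(1)[OF p3] lev(1,5,2)]
  show "cyclic_order x x' y \<noteq> cyclic_order x y' y" "x' \<notin> {x, y}" "y' \<notin> {x, y}"
    using L1 L2 *(8) by (auto simp: s_def t_def v_def w_def)
qed

section \<open>Single touch\<close>

text \<open>Intervals of leaves may share ends; many paths of the family start or end at the same
  leaf.\<close>

definition laminar_pair :: "nat \<times> nat \<Rightarrow> nat \<times> nat \<Rightarrow> bool" where
  "laminar_pair p q \<longleftrightarrow> fst p \<le> fst q \<and> snd q \<le> snd p \<or> fst q \<le> fst p \<and> snd p \<le> snd q \<or>
     snd p \<le> fst q \<or> snd q \<le> fst p"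

definition chords :: "nat \<Rightarrow> (nat \<times> nat) set \<Rightarrow> bool" where
  "chords D S \<longleftrightarrow> 0 < D \<and> (\<forall>(x, y)\<in>S. on_level D x \<and> on_level D y \<and> x < y) \<and>
     (\<forall>p\<in>S. \<forall>q\<in>S. laminar_pair p q)"

abbreviation paths_of :: "(nat \<times> nat) set \<Rightarrow> nat vwalk set" where
  "paths_of S \<equiv> (\<lambda>(x, y). tree_path x y) ` S"

lemma non_crossing_tree_path:
  assumes "0 < D" "on_level D x" "on_level D y" "x < y" "on_level D x'" "on_level D y'" "x' < y'"
    and "laminar_pair (x, y) (x', y')"
  shows "non_crossing (cactus_rot D) (tree_path x y) (tree_path x' y')"
proof -
  have no: "\<not> crosses_along (cactus_rot D) (tree_path x y) (tree_path u v) c"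
    if "(u, v) = (x', y') \<or> (u, v) = (y', x')" for u v c
  proof
    assume "crosses_along (cactus_rot D) (tree_path x y) (tree_path u v) c"
    from crosses_along_separates[OF assms(1-3) _ _ _ _ this] that assms
    show False by (auto simp: cyclic_order_def laminar_pair_def)
  qed
  show ?thesis
    unfolding non_crossing_def rev_tree_path using no[of x' y'] no[of y' x'] by blast
qed

lemma path_edges_conv: "path_edges p = {{u, v} | u v. (u, v) \<in> set (vwalk_arcs p)}"
  by (auto simp: path_edges_def)

lemma set_vwalk_arcs_iff: "(u, w) \<in> set (vwalk_arcs p) \<longleftrightarrow> (\<exists>xs ys. p = xs @ u # w # ys)"
proof
  assume "(u, w) \<in> set (vwalk_arcs p)"
  then show "\<exists>xs ys. p = xs @ u # w # ys"
  proof (induction p rule: vwalk_arcs.induct)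
    case (3 x y xs)
    then show ?case by (auto; metis append_Cons append_Nil)
  qed auto
qed (auto simp: vwalk_arcs_mid)

text \<open>Tree paths are induced subgraphs. In the inductive step an end has only its parent and
  its sibling as neighbours, and the sibling is not on the path.\<close>

lemma induced_edge:
  assumes "on_level d x" "on_level d y" "x \<noteq> y" "(v, w) \<in> parcs (cactus d)"
    "v \<in> set (tree_path x y)" "w \<in> set (tree_path x y)"
  shows "{v, w} \<in> path_edges (tree_path x y)"
  using assms
proof (induction arbitrary: v w rule: level_induct)
  case (sibling d x y)
  then show ?case
    using arc_vertices(3)[of v w] by (auto simp: tree_path.simps[of x y] path_edges_def insert_commute)
next
  case (step d x y)
  let ?x = "x div 2" and ?y = "y div 2"
  have "?x \<noteq> ?y" by (rule step.hyps(3))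
  have upper: "u < 2 ^ Suc d" if "u \<in> set (tree_path ?x ?y)" for u
    using set_tree_path_level[OF step.hyps(4,5) \<open>?x \<noteq> ?y\<close> that] by simp
  have set: "set (tree_path x y) = insert x (insert y (set (tree_path ?x ?y)))"
    using step.hyps(3) by (subst tree_path.simps) auto
  have edges: "path_edges (tree_path x y) = insert {x, ?x} (insert {y, ?y} (path_edges (tree_path ?x ?y)))"
    using step.hyps(3) by (auto simp: path_edges_def vwalk_arcs_tree_path_step)
  have lower: "\<not> u < 2 ^ Suc d \<and> 2 \<le> u" if "u = x \<or> u = y" for u
    using step.hyps(1,2) that on_level_ge2 by (auto simp: on_level_def)
  have end_edge: "{a, b} \<in> path_edges (tree_path x y)"
    if "(a, b) \<in> parcs (cactus (Suc d))" "a = x \<or> a = y" "b \<in> set (tree_path x y)" for a b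
  proof -
    have a: "on_level (Suc d) a" "2 \<le> a" using that(2) step.hyps(1,2) lower by auto
    then have b: "b = a div 2 \<or> b = sib a"
      using that(1) by (auto simp: arc_iff on_level_def)
    have "b \<noteq> sib a"
    proof
      assume "b = sib a"
      then have "on_level (Suc d) b" "b div 2 = a div 2" "b \<noteq> a"
        using on_level_sib[OF a] sib_div2[OF a(2)] sib_neq[OF a(2)] by auto
      moreover from this have "b = x \<or> b = y" using that(3) upper[of b] set by (auto simp: on_level_def)
      ultimately show False using that(2) step.hyps(3) by auto
    qed
    with b that(2) show ?thesis unfolding edges by auto
  qed
  show ?case
  proof (cases "v \<in> set (tree_path ?x ?y) \<and> w \<in> set (tree_path ?x ?y)")
    case True
    with upper have "v < 2 ^ Suc d" "w < 2 ^ Suc d" by auto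
    with step.prems(1) have "(v, w) \<in> parcs (cactus d)"
      by (cases rule: arc_level_cases) (auto simp: on_level_def)
    then show ?thesis using step.IH True edges by blast
  next
    case False
    with step.prems set consider "v = x \<or> v = y" | "w = x \<or> w = y" by auto
    then show ?thesis
    proof cases
      case 1
      then show ?thesis using end_edge step.prems by blast
    next
      case 2
      then have "{w, v} \<in> path_edges (tree_path x y)"
        using end_edge arc_sym step.prems by blast
      then show ?thesis by (simp add: insert_commute)
    qed
  qed
qed

lemma contiguous_part:
  assumes "distinct p"
    and convex: "\<And>xs ys zs u v w. p = xs @ u # ys @ w # zs \<Longrightarrow> u \<in> A \<Longrightarrow> w \<in> A \<Longrightarrow> set ys \<subseteq> A"
  shows "\<exists>xs r zs. p = xs @ r @ zs \<and> set r = set p \<inter> A"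
proof (cases "set p \<inter> A = {}")
  case True
  then show ?thesis by (intro exI[of _ p] exI[of _ "[]"]) simp
next
  case False
  then have "\<exists>z\<in>set p. z \<in> A" by auto
  then obtain xs u q where xs: "p = xs @ u # q" "u \<in> A" "\<forall>z\<in>set xs. z \<notin> A"
    by (rule split_list_first_propE)
  show ?thesis
  proof (cases "set q \<inter> A = {}")
    case True
    then show ?thesis using xs by (intro exI[of _ xs] exI[of _ "[u]"] exI[of _ q]) auto
  next
    case False
    then have "\<exists>z\<in>set q. z \<in> A" by auto
    then obtain ys w zs where q: "q = ys @ w # zs" "w \<in> A" "\<forall>z\<in>set zs. z \<notin> A"
      by (rule split_list_last_propE)
    then have "set ys \<subseteq> A" using convex xs by blast
    then show ?thesis
      using xs q by (intro exI[of _ xs] exI[of _ "u # ys @ [w]"] exI[of _ zs]) auto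
  qed
qed

text \<open>On the climbing half each vertex is an ancestor of all vertices before it; on the
  descending half the premise \<open>below v x\<close> is false.\<close>

lemma tree_path_sorted:
  assumes "on_level D x" "on_level D y" "x \<noteq> y"
  shows "sorted_wrt (\<lambda>u v. below v x \<longrightarrow> below v u) (tree_path x y)"
  using assms
proof (induction rule: level_induct)
  case (sibling d x y)
  then show ?case using below_same_level by (auto simp: tree_path.simps[of x y])
next
  case (step d x y)
  let ?x = "x div 2" and ?y = "y div 2"
  have "?x \<noteq> ?y" by (rule step.hyps(3))
  have "v \<noteq> x" if "v \<in> set (tree_path ?x ?y)" for v
    using set_tree_path_level[OF step.hyps(4,5) \<open>?x \<noteq> ?y\<close> that] step.hyps(1) by (auto simp: on_level_def)
  then have "sorted_wrt (\<lambda>u v. below v x \<longrightarrow> below v u) (tree_path ?x ?y)"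
    using step.IH below_rec[of _ x] by (auto intro: sorted_wrt_mono_rel[rotated])
  moreover have "\<not> below y x" using step.hyps below_same_level by metis
  ultimately show ?case
    using step.hyps(3) by (subst tree_path.simps) (auto simp: sorted_wrt_append)
qed

text \<open>The case that \<open>v\<close> is on the climbing half; the other one follows by
  reversal. As \<open>v\<close> is an ancestor of \<open>u\<close>, it is one of the end
  \<open>e\<close> of the second path, so the point is that it is not an ancestor of the other end
  \<open>e'\<close>.\<close>

lemma tree_path_convex_aux:
  assumes "on_level D x" "on_level D y" "x \<noteq> y" "on_level D x'" "on_level D y'" "x' \<noteq> y'"
    and p: "tree_path x y = xs @ u # ys @ w # zs"
    and q: "u \<in> set (tree_path x' y')" "w \<in> set (tree_path x' y')"
    and v: "v \<in> set ys" "below v x"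
  shows "v \<in> set (tree_path x' y')"
proof -
  note P = set_tree_path[OF assms(1-3)] and Q = set_tree_path[OF assms(4-6)]
  have srt: "below v u" "below w x \<Longrightarrow> below w v"
    using tree_path_sorted[OF assms(1-3)] v by (auto simp: p sorted_wrt_append)
  have on: "v \<in> set (tree_path x y)" "w \<in> set (tree_path x y)" using p v by auto
  then have vy: "\<not> below v y" using v(2) P by auto
  obtain e e' where e: "{e, e'} = {x', y'}" "below u e" using q(1) Q by auto
  have we: "below w e \<noteq> below w e'" using q(2) Q e(1) by (auto simp: doubleton_eq_iff)
  have ve: "below v e" using srt(1) e(2) below_trans by blast
  \<comment> \<open>If \<open>w\<close> is an ancestor of \<open>x\<close>, then also of
    \<open>v\<close> and \<open>e\<close>, hence not of \<open>e'\<close>, and so neither is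
    \<open>v\<close>. Otherwise \<open>v\<close> and \<open>w\<close> are incomparable and nothing
    is below both; then \<open>w\<close> is above \<open>e'\<close> and \<open>v\<close> is
    not.\<close>
  have "\<not> below v e'"
  proof (cases "below w x")
    case True
    then show ?thesis using srt(2) ve we below_trans by blast
  next
    case False
    then have "below w y" using on P by auto
    then have "\<not> below v w" "\<not> below w v" using False vy v(2) below_trans by blast+
    then have "\<not> (below v z \<and> below w z)" for z using below_linear by blast
    then show ?thesis using ve we by blast
  qed
  then show ?thesis using ve e(1) Q by (auto simp: doubleton_eq_iff)
qed

lemma tree_path_convex:
  assumes "on_level D x" "on_level D y" "x \<noteq> y" "on_level D x'" "on_level D y'" "x' \<noteq> y'"
    and "tree_path x y = xs @ u # ys @ w # zs" "u \<in> set (tree_path x' y')" "w \<in> set (tree_path x' y')"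
  shows "set ys \<subseteq> set (tree_path x' y')"
proof
  fix v assume v: "v \<in> set ys"
  then have "v \<in> set (tree_path x y)" using assms(7) by simp
  then consider "below v x" | "below v y" using set_tree_path[OF assms(1-3)] by auto
  then show "v \<in> set (tree_path x' y')"
  proof cases
    case 1
    then show ?thesis using tree_path_convex_aux[OF assms v] by blast
  next
    case 2
    have "tree_path y x = rev zs @ w # rev ys @ u # rev xs"
      using rev_tree_path[of x y] by (simp add: assms(7))
    from tree_path_convex_aux[OF assms(2,1) assms(3)[symmetric] assms(4-6) this assms(9,8)] v 2
    show ?thesis by simp
  qed
qed

text \<open>By convexity the common vertices form a segment of the first path, and by
  \<open>induced_edge\<close> its edges belong to the second path too.\<close>

lemma single_touch_tree_path:
  assumes "on_level D x" "on_level D y" "x \<noteq> y" "on_level D x'" "on_level D y'" "x' \<noteq> y'"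
  shows "single_touch (tree_path x y) (tree_path x' y')"
proof -
  let ?p = "tree_path x y" and ?q = "tree_path x' y'"
  have dist: "distinct ?p" by (rule distinct_tree_path[OF assms(1-3)])
  obtain xs r zs where r: "?p = xs @ r @ zs" "set r = set ?p \<inter> set ?q"
    using contiguous_part[OF dist, of "set ?q"] tree_path_convex[OF assms] by metis
  have "path_edges r = path_edges ?p \<inter> path_edges ?q"
  proof
    show "path_edges r \<subseteq> path_edges ?p \<inter> path_edges ?q"
    proof
      fix e assume "e \<in> path_edges r"
      then obtain u v as bs where e: "e = {u, v}" "r = as @ u # v # bs"
        by (auto simp: path_edges_conv set_vwalk_arcs_iff)
      then have "?p = (xs @ as) @ u # v # (bs @ zs)" using r(1) by simp
      then have *: "(u, v) \<in> set (vwalk_arcs ?p)" unfolding set_vwalk_arcs_iff by blast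
      then have "(u, v) \<in> parcs (cactus D)" using tree_path_arcs[OF assms(1-3)] by blast
      moreover have "u \<in> set ?q" "v \<in> set ?q" using e(2) r(2) by auto
      ultimately show "e \<in> path_edges ?p \<inter> path_edges ?q"
        using induced_edge[OF assms(4-6)] * e(1) by (auto simp: path_edges_conv)
    qed
    show "path_edges ?p \<inter> path_edges ?q \<subseteq> path_edges r"
    proof
      fix e assume e: "e \<in> path_edges ?p \<inter> path_edges ?q"
      then obtain u v as bs where uv: "e = {u, v}" "?p = as @ u # v # bs"
        by (auto simp: path_edges_conv set_vwalk_arcs_iff)
      have "u \<in> set ?q" "v \<in> set ?q"
        using e uv(1) by (auto simp: path_edges_conv set_vwalk_arcs_iff doubleton_eq_iff)
      then have "u \<in> set r" "v \<in> set r" using uv r(2) by auto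
      then obtain r1 r2 where "r = r1 @ u # r2" by (metis split_list)
      then have "?p = (xs @ r1) @ u # (r2 @ zs)" using r(1) by simp
      then have "xs @ r1 = as \<and> r2 @ zs = v # bs"
        using uv(2) dist by (metis append_Cons_eq_iff distinct.simps(2) distinct_append not_distinct_conv_prefix)
      moreover have "v \<notin> set zs" using \<open>v \<in> set r\<close> dist r(1) by auto
      ultimately obtain r3 where "r2 = v # r3" by (cases r2) auto
      then have "(u, v) \<in> set (vwalk_arcs r)" using \<open>r = r1 @ u # r2\<close> by (simp add: vwalk_arcs_mid)
      then show "e \<in> path_edges r" using uv(1) by (auto simp: path_edges_conv)
    qed
  qed
  moreover have "distinct r" using dist r(1) by simp
  ultimately show ?thesis using r(2) unfolding single_touch_def by blast
qed

section \<open>Well-formedness\<close>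

text \<open>The block of leaf numbers below \<open>v\<close> is carried along in the induction,
  since it separates the leaves met below the left child from those met below the right
  child.\<close>

lemma sorted_outer_walk:
  assumes "l + d = D" "on_level l v"
  shows "sorted_wrt (\<lambda>a b. 2 ^ D \<le> fst a \<longrightarrow> 2 ^ D \<le> fst b \<longrightarrow> fst a < fst b) (outer_walk d v) \<and>
    (\<forall>a\<in>set (outer_walk d v). 2 ^ D \<le> fst a \<longrightarrow> v * 2 ^ d \<le> fst a \<and> fst a < (v + 1) * 2 ^ d)"
  using assms
proof (induction d arbitrary: l v)
  case (Suc d)
  have lev: "on_level (Suc l) (2 * v)" "on_level (Suc l) (2 * v + 1)"
    using Suc.prems(2) by (auto simp: on_level_def)
  have IH: "sorted_wrt (\<lambda>a b. 2 ^ D \<le> fst a \<longrightarrow> 2 ^ D \<le> fst b \<longrightarrow> fst a < fst b) (outer_walk d u)"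
    "a \<in> set (outer_walk d u) \<Longrightarrow> 2 ^ D \<le> fst a \<Longrightarrow> u * 2 ^ d \<le> fst a \<and> fst a < (u + 1) * 2 ^ d"
    if "u = 2 * v \<or> u = 2 * v + 1" for u a
    using Suc.IH[of "Suc l" u] Suc.prems(1) lev that by auto
  have "(2::nat) ^ Suc l \<le> 2 ^ D" using Suc.prems(1) by (intro power_increasing) auto
  then have v: "\<not> 2 ^ D \<le> v" using Suc.prems(2) by (auto simp: on_level_def)
  show ?case
  proof (cases d)
    case 0
    then show ?thesis using v by simp
  next
    case (Suc e)
    then have "(2::nat) ^ Suc (Suc l) \<le> 2 ^ D" using Suc.prems(1) by (intro power_increasing) auto
    then have v2: "\<not> 2 ^ D \<le> 2 * v" "\<not> 2 ^ D \<le> 2 * v + 1" using lev by (auto simp: on_level_def)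
    have L: "v * 2 ^ Suc d \<le> fst a \<and> fst a < (2 * v + 1) * 2 ^ d"
      if "a \<in> set (outer_walk d (2 * v))" "2 ^ D \<le> fst a" for a
      using IH(2)[of "2 * v", OF _ that] by (simp add: mult.assoc mult.left_commute)
    have R: "(2 * v + 1) * 2 ^ d \<le> fst a \<and> fst a < (v + 1) * 2 ^ Suc d"
      if "a \<in> set (outer_walk d (2 * v + 1))" "2 ^ D \<le> fst a" for a
      using IH(2)[of "2 * v + 1", OF _ that] by (simp add: algebra_simps)
    have "v * 2 ^ Suc d \<le> (2 * v + 1) * 2 ^ d" "(2 * v + 1) * 2 ^ d \<le> (v + 1) * 2 ^ Suc d"
      by (simp_all add: algebra_simps)
    then have B: "v * 2 ^ Suc d \<le> fst a \<and> fst a < (v + 1) * 2 ^ Suc d"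
      if "a \<in> set (outer_walk d (2 * v)) \<union> set (outer_walk d (2 * v + 1))" "2 ^ D \<le> fst a" for a
      using that L R by (meson UnE le_trans less_le_trans)
    have LR: "fst a < fst b" if "a \<in> set (outer_walk d (2 * v))" "b \<in> set (outer_walk d (2 * v + 1))"
      "2 ^ D \<le> fst a" "2 ^ D \<le> fst b" for a b
      using L[OF that(1,3)] R[OF that(2,4)] by linarith
    show ?thesis
      using v v2 IH(1)[of "2 * v"] IH(1)[of "2 * v + 1"] B LR by (simp add: sorted_wrt_append)
  qed
qed simp

text \<open>A leaf is the tail of just one arc of the external face, whereas an inner vertex other
  than the root is passed twice. This gives each leaf a unique position on the walk.\<close>

lemma leaf_positions:
  assumes "0 < D"
  obtains pos where "\<And>x. on_level D x \<Longrightarrow> pos x < length (outer_walk D 1) \<and> fst (outer_walk D 1 ! pos x) = x"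
    "\<And>x y. on_level D x \<Longrightarrow> on_level D y \<Longrightarrow> x < y \<Longrightarrow> pos x < pos y"
    "\<And>x i. on_level D x \<Longrightarrow> i < length (outer_walk D 1) \<Longrightarrow> fst (outer_walk D 1 ! i) = x \<Longrightarrow> i = pos x"
proof -
  let ?es = "outer_walk D 1"
  have srt: "sorted_wrt (\<lambda>a b. 2 ^ D \<le> fst a \<longrightarrow> 2 ^ D \<le> fst b \<longrightarrow> fst a < fst b) ?es"
    using sorted_outer_walk[of 0 D D 1] by (simp add: on_level_0)
  have mono: "fst (?es ! i) < fst (?es ! j)"
    if "i < j" "j < length ?es" "on_level D (fst (?es ! i))" "on_level D (fst (?es ! j))" for i j
    using sorted_wrt_nth_less[OF srt that(1,2)] that(3,4) by (simp add: on_level_def)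
  have "\<exists>i<length ?es. fst (?es ! i) = x" if "on_level D x" for x
  proof -
    obtain d where d: "D = Suc d" using assms by (cases D) auto
    have "on_level d (x div 2)" using that on_level_div2 d by blast
    then have *: "x div 2 \<in> {1..<2 ^ D}" using one_le_power[of "2::nat" d] by (auto simp: on_level_def d)
    have "x = 2 * (x div 2) \<or> x = 2 * (x div 2) + 1" by linarith
    then obtain y where "(x, y) \<in> outer_arcs (x div 2)" unfolding outer_arcs_def by blast
    then have "(x, y) \<in> set ?es" unfolding set_outer_walk_root outer_face_def using * by blast
    then show ?thesis by (metis in_set_conv_nth fst_conv)
  qed
  then obtain pos where pos: "\<And>x. on_level D x \<Longrightarrow> pos x < length ?es \<and> fst (?es ! pos x) = x" by metis
  show thesis
  proof
    show "pos x < length ?es \<and> fst (?es ! pos x) = x" if "on_level D x" for x using pos[OF that] .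
    show "pos x < pos y" if "on_level D x" "on_level D y" "x < y" for x y
    proof (rule ccontr)
      assume "\<not> pos x < pos y"
      then consider "pos x = pos y" | "pos y < pos x" by linarith
      then show False
      proof cases
        case 1
        then show False using pos[OF that(1)] pos[OF that(2)] that(3) by simp
      next
        case 2
        then show False using mono[OF 2] pos[OF that(1)] pos[OF that(2)] that by simp
      qed
    qed
    show "i = pos x" if "on_level D x" "i < length ?es" "fst (?es ! i) = x" for x i
      using mono[of i "pos x"] mono[of "pos x" i] pos[OF that(1)] that by (metis less_irrefl linorder_neqE_nat)
  qed
qed

lemma outer_face_antisym:
  assumes "(u, v) \<in> outer_face D" "(v, u) \<in> outer_face D"
  shows False
  using assms by (auto simp: outer_face_def outer_arcs_def)

text \<open>The clockwise path from \<open>x\<close> to \<open>y\<close> is the stretch of the walk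
  between their positions, so nested or disjoint intervals of leaves become nested or disjoint sets
  of edges.\<close>

lemma well_formed_chords:
  assumes "chords D S"
  shows "well_formed (cactus_rot D) (outer_face D) (paths_of S)"
proof -
  let ?es = "outer_walk D 1"
  let ?f = "face_succ (cactus_rot D)"
  have D: "0 < D" using assms by (simp add: chords_def)
  obtain pos where pos: "\<And>x. on_level D x \<Longrightarrow> pos x < length ?es \<and> fst (?es ! pos x) = x"
    "\<And>x y. on_level D x \<Longrightarrow> on_level D y \<Longrightarrow> x < y \<Longrightarrow> pos x < pos y"
    "\<And>x i. on_level D x \<Longrightarrow> i < length ?es \<Longrightarrow> fst (?es ! i) = x \<Longrightarrow> i = pos x"
    using leaf_positions[OF D] by blast
  note cyc = cycles_outer_walk[OF D]
  define E where "E i = {fst (?es ! i), snd (?es ! i)}" for i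
  have mem: "?es ! i \<in> outer_face D" if "i < length ?es" for i
    using nth_mem[OF that] unfolding set_outer_walk_root .
  \<comment> \<open>No edge is run through in both directions by the external face, so different
    positions carry different undirected edges and disjoint stretches remain disjoint.\<close>
  have inj: "i = j" if "i < length ?es" "j < length ?es" "E i = E j" for i j
  proof -
    have *: "?es ! i \<in> outer_face D" "?es ! j \<in> outer_face D"
      using mem that by blast+
    obtain a b c d where **: "?es ! i = (a, b)" "?es ! j = (c, d)" by (meson surj_pair)
    with that(3) have "{a, b} = {c, d}" by (simp only: E_def fst_conv snd_conv)
    then have "a = c \<and> b = d \<or> a = d \<and> b = c" by (simp only: doubleton_eq_iff)
    moreover have "\<not> (a = d \<and> b = c)" using *[unfolded **] outer_face_antisym by blast
    ultimately have "?es ! i = ?es ! j" unfolding ** by simp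
    then show ?thesis using nth_eq_iff_index_eq[OF distinct_outer_walk that(1,2)] by simp
  qed
  have clock: "clockwise_edges (cactus_rot D) (outer_face D) x y = E ` {pos x..<pos y}"
    if x: "on_level D x" and y: "on_level D y" and less: "x < y" for x y
  proof
    note px = pos(1)[OF x] and py = pos(1)[OF y] and pxy = pos(2)[OF x y less]
    have step: "(?f ^^ k) (?es ! pos x) = ?es ! (pos x + k)" if "pos x + k \<le> pos y" for k
      using cycles_funpow[OF cyc, of "pos x" k] px py that by simp
    show "clockwise_edges (cactus_rot D) (outer_face D) x y \<subseteq> E ` {pos x..<pos y}"
    proof
      fix s assume "s \<in> clockwise_edges (cactus_rot D) (outer_face D) x y"
      then obtain u v e n i where *: "s = {u, v}" "e \<in> outer_face D" "fst e = x"
        "fst ((?f ^^ n) e) = y" "\<forall>j<n. fst ((?f ^^ j) e) \<noteq> y" "i < n" "(?f ^^ i) e = (u, v)"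
        unfolding clockwise_edges_def by blast
      from *(2) obtain k where "k < length ?es" "?es ! k = e"
        unfolding set_outer_walk_root[symmetric] in_set_conv_nth by blast
      then have e: "e = ?es ! pos x" using pos(3)[OF x] *(3) by auto
      have "n \<le> pos y - pos x"
      proof (rule ccontr)
        assume "\<not> n \<le> pos y - pos x"
        then have "fst ((?f ^^ (pos y - pos x)) e) \<noteq> y" using *(5) by simp
        moreover have "(?f ^^ (pos y - pos x)) e = ?es ! pos y"
          using step[of "pos y - pos x"] pxy unfolding e by simp
        ultimately show False using py by simp
      qed
      with *(6) have "pos x + i < pos y" using pxy by linarith
      moreover from this have "(?f ^^ i) e = ?es ! (pos x + i)" unfolding e by (intro step) simp
      then have uv: "?es ! (pos x + i) = (u, v)" using *(7) by (simp only:)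
      have "s = E (pos x + i)" unfolding E_def *(1) uv by (simp only: fst_conv snd_conv)
      ultimately show "s \<in> E ` {pos x..<pos y}" by auto
    qed
    show "E ` {pos x..<pos y} \<subseteq> clockwise_edges (cactus_rot D) (outer_face D) x y"
    proof
      fix s assume "s \<in> E ` {pos x..<pos y}"
      then obtain m where m: "pos x \<le> m" "m < pos y" "s = E m" by auto
      let ?e = "?es ! pos x" and ?n = "pos y - pos x" and ?i = "m - pos x"
      have "?e \<in> outer_face D" "fst ?e = x" using px mem by blast+
      moreover have "fst ((?f ^^ ?n) ?e) = y" using step[of ?n] pxy py by simp
      moreover have "fst ((?f ^^ j) ?e) \<noteq> x" if "0 < j" "j \<le> ?n" for j
      proof
        assume "fst ((?f ^^ j) ?e) = x"
        then have "fst (?es ! (pos x + j)) = x" using step[of j] that pxy by simp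
        then have "pos x + j = pos x" using that pxy py by (intro pos(3)[OF x]) auto
        then show False using that by simp
      qed
      moreover have "fst ((?f ^^ j) ?e) \<noteq> y" if "j < ?n" for j
      proof
        assume "fst ((?f ^^ j) ?e) = y"
        then have "fst (?es ! (pos x + j)) = y" using step[of j] that pxy by simp
        then have "pos x + j = pos y" using that pxy py by (intro pos(3)[OF y]) auto
        then show False using that by simp
      qed
      moreover have "?i < ?n" "(?f ^^ ?i) ?e = (fst (?es ! m), snd (?es ! m))"
        using m step[of ?i] by simp_all
      ultimately show "s \<in> clockwise_edges (cactus_rot D) (outer_face D) x y"
        unfolding clockwise_edges_def m(3) E_def by blast
    qed
  qed
  have mono: "pos x \<le> pos y" if "on_level D x" "on_level D y" "x \<le> y" for x y
    using pos(2)[OF that(1,2)] that(3) by (cases "x = y") auto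
  have "let A = clockwise_edges (cactus_rot D) (outer_face D) (hd q) (last q);
            B = clockwise_edges (cactus_rot D) (outer_face D) (hd r) (last r)
        in A \<subseteq> B \<or> B \<subseteq> A \<or> A \<inter> B = {}" if "q \<in> paths_of S" "r \<in> paths_of S" for q r
  proof -
    from that obtain x y x' y' where xy: "q = tree_path x y" "(x, y) \<in> S" "r = tree_path x' y'" "(x', y') \<in> S"
      by auto
    then have lev: "on_level D x" "on_level D y" "x < y" "on_level D x'" "on_level D y'" "x' < y'"
      and lam: "laminar_pair (x, y) (x', y')"
      using assms unfolding chords_def by fast+
    from lam consider "pos x \<le> pos x'" "pos y' \<le> pos y" | "pos x' \<le> pos x" "pos y \<le> pos y'"
      | "pos y \<le> pos x'" | "pos y' \<le> pos x"
      unfolding laminar_pair_def using mono lev by auto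
    then have "E ` {pos x..<pos y} \<subseteq> E ` {pos x'..<pos y'} \<or> E ` {pos x'..<pos y'} \<subseteq> E ` {pos x..<pos y} \<or>
      E ` {pos x..<pos y} \<inter> E ` {pos x'..<pos y'} = {}"
    proof cases
      case 1
      then have "{pos x'..<pos y'} \<subseteq> {pos x..<pos y}" by auto
      then show ?thesis by blast
    next
      case 2
      then have "{pos x..<pos y} \<subseteq> {pos x'..<pos y'}" by auto
      then show ?thesis by blast
    next
      case 3
      have "i \<noteq> j" if "i \<in> {pos x..<pos y}" "j \<in> {pos x'..<pos y'}" for i j using that 3 by auto
      moreover have "i < length ?es" if "i \<in> {pos x..<pos y} \<union> {pos x'..<pos y'}" for i
        using that pos(1)[OF lev(2)] pos(1)[OF lev(5)] by auto
      ultimately have "E i \<noteq> E j" if "i \<in> {pos x..<pos y}" "j \<in> {pos x'..<pos y'}" for i j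
        using inj[of i j] that by blast
      then show ?thesis by blast
    next
      case 4
      have "i \<noteq> j" if "i \<in> {pos x..<pos y}" "j \<in> {pos x'..<pos y'}" for i j using that 4 by auto
      moreover have "i < length ?es" if "i \<in> {pos x..<pos y} \<union> {pos x'..<pos y'}" for i
        using that pos(1)[OF lev(2)] pos(1)[OF lev(5)] by auto
      ultimately have "E i \<noteq> E j" if "i \<in> {pos x..<pos y}" "j \<in> {pos x'..<pos y'}" for i j
        using inj[of i j] that by blast
      then show ?thesis by blast
    qed
    then show ?thesis unfolding xy tree_path_ends clock[OF lev(1-3)] clock[OF lev(4-6)] Let_def .
  qed
  then show ?thesis unfolding well_formed_def by blast
qed

theorem NCS_chords:
  assumes "chords D S"
  shows "NCS (paths_of S)"
proof -
  have D: "0 < D" using assms by (simp add: chords_def)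
  have S: "on_level D x \<and> on_level D y \<and> x < y" if "(x, y) \<in> S" for x y
    using assms that unfolding chords_def by fast
  have leaf: "x \<in> fst ` outer_face D" if "on_level D x" for x
  proof (rule leaf_positions[OF D])
    fix pos assume "\<And>x. on_level D x \<Longrightarrow> pos x < length (outer_walk D 1) \<and> fst (outer_walk D 1 ! pos x) = x"
    from this[OF that] have *: "pos x < length (outer_walk D 1)" "fst (outer_walk D 1 ! pos x) = x" by auto
    have "outer_walk D 1 ! pos x \<in> outer_face D"
      using nth_mem[OF *(1)] unfolding set_outer_walk_root .
    then have "fst (outer_walk D 1 ! pos x) \<in> fst ` outer_face D" by (rule imageI)
    then show ?thesis using *(2) by simp
  qed
  have one: "shortest_path (cactus D) (\<lambda>_. 1) p \<and> hd p \<in> fst ` outer_face D \<and> last p \<in> fst ` outer_face D"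
    if "p \<in> paths_of S" for p
  proof -
    from that obtain x y where p: "p = tree_path x y" "(x, y) \<in> S" by auto
    then have "on_level D x" "on_level D y" "x \<noteq> y" using S by auto
    then show ?thesis unfolding p(1) tree_path_ends by (simp add: shortest_tree_path leaf)
  qed
  have two: "single_touch p q \<and> non_crossing (cactus_rot D) p q \<and> {hd p, last p} \<noteq> {hd q, last q}"
    if "p \<in> paths_of S" "q \<in> paths_of S" "p \<noteq> q" for p q
  proof -
    from that(1,2) obtain x y x' y' where p: "p = tree_path x y" "(x, y) \<in> S"
      and q: "q = tree_path x' y'" "(x', y') \<in> S" by auto
    have lev: "on_level D x" "on_level D y" "x < y" "on_level D x'" "on_level D y'" "x' < y'"
      using S p(2) q(2) by auto
    have "laminar_pair (x, y) (x', y')" using assms p(2) q(2) unfolding chords_def by fast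
    then have "non_crossing (cactus_rot D) p q"
      unfolding p(1) q(1) by (rule non_crossing_tree_path[OF D lev])
    moreover have "single_touch p q"
      unfolding p(1) q(1) using lev by (intro single_touch_tree_path[of D]) auto
    moreover have "(x, y) \<noteq> (x', y')" using that(3) p(1) q(1) by blast
    then have "{x, y} \<noteq> {x', y'}" using lev(3,6) by (auto simp: doubleton_eq_iff)
    then have "{hd p, last p} \<noteq> {hd q, last q}" unfolding p(1) q(1) tree_path_ends .
    ultimately show ?thesis by blast
  qed
  show ?thesis
    unfolding NCS_def
  proof (intro exI conjI)
    show "plane_graph (cactus D) (cactus_rot D) (outer_face D)" by (rule plane_graph_cactus[OF D])
    show "\<forall>(u, v)\<in>parcs (cactus D). 0 < (\<lambda>_. 1 :: real) (u, v) \<and> (\<lambda>_. 1 :: real) (u, v) = (\<lambda>_. 1) (v, u)"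
      by simp
    show "\<forall>p\<in>paths_of S. shortest_path (cactus D) (\<lambda>_. 1) p \<and> hd p \<in> fst ` outer_face D \<and> last p \<in> fst ` outer_face D"
      using one by blast
    show "\<forall>p\<in>paths_of S. \<forall>q\<in>paths_of S. p \<noteq> q \<longrightarrow>
        single_touch p q \<and> non_crossing (cactus_rot D) p q \<and> {hd p, last p} \<noteq> {hd q, last q}"
      using two by blast
    show "well_formed (cactus_rot D) (outer_face D) (paths_of S)" by (rule well_formed_chords[OF assms])
  qed
qed

section \<open>Forests in the cactus\<close>

text \<open>By \<open>set_tree_path\<close> this says that both vertices lie on the path; for
  adjacent vertices the path then contains the edge between them.\<close>

definition uses :: "nat \<Rightarrow> nat \<Rightarrow> nat \<times> nat \<Rightarrow> bool" where
  "uses v w p \<longleftrightarrow> (below v (fst p) \<noteq> below v (snd p)) \<and> (below w (fst p) \<noteq> below w (snd p))"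

lemma uses_iff:
  assumes "on_level D x" "on_level D y" "x \<noteq> y" "(v, w) \<in> parcs (cactus D)"
  shows "uses v w (x, y) \<longleftrightarrow> {v, w} \<in> path_edges (tree_path x y)"
proof
  assume "uses v w (x, y)"
  then show "{v, w} \<in> path_edges (tree_path x y)"
    using induced_edge[OF assms] set_tree_path[OF assms(1-3)] by (simp add: uses_def)
next
  assume "{v, w} \<in> path_edges (tree_path x y)"
  then have "v \<in> set (tree_path x y)" "w \<in> set (tree_path x y)"
    by (auto simp: path_edges_conv set_vwalk_arcs_iff doubleton_eq_iff)
  then show "uses v w (x, y)" using set_tree_path[OF assms(1-3)] by (simp add: uses_def)
qed

lemma triangle_cycle:
  assumes "(a, b) \<in> parcs T" "(b, c) \<in> parcs T" "(c, a) \<in> parcs T" "a \<noteq> b" "b \<noteq> c" "a \<noteq> c"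
    and "pair_graph T"
  shows "\<not> undirected_forest T"
proof -
  interpret pair_graph T by fact
  have "cycle [(a, b), (b, c), (c, a)]"
    unfolding cycle_def using assms(1-6) in_arcsD1 in_arcsD2
    by (intro exI[of _ a]) (auto simp: awalk_Cons_iff awalk_Nil_iff)
  moreover have "3 \<le> length [(a, b), (b, c), (c, a)]" by simp
  ultimately show ?thesis unfolding undirected_forest_def by blast
qed

lemma vpath_arc:
  assumes "vpath p (with_proj T)" "pair_graph T" "{u, v} \<in> path_edges p"
  shows "(u, v) \<in> parcs T"
proof -
  interpret pair_graph T by fact
  from assms(3) have "(u, v) \<in> set (vwalk_arcs p) \<or> (v, u) \<in> set (vwalk_arcs p)"
    by (auto simp: path_edges_conv doubleton_eq_iff)
  then have "(u, v) \<in> parcs T \<or> (v, u) \<in> parcs T"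
    using assms(1) by (auto simp: vpath_def vwalk_def)
  then show ?thesis using arcs_symmetric by blast
qed

text \<open>Here \<open>T\<close> is an arbitrary graph and not only a subgraph of the cactus: the
  three paths by themselves put the sides of the triangle into \<open>T\<close>.\<close>

lemma not_forest_if_full_triangle:
  assumes "v \<in> {1..<2 ^ D}" "\<And>x y. (x, y) \<in> {p, q, r} \<Longrightarrow> on_level D x \<and> on_level D y \<and> x \<noteq> y"
    and "uses v (2 * v) p" "uses (2 * v) (2 * v + 1) q" "uses v (2 * v + 1) r"
    and "\<And>x y. (x, y) \<in> {p, q, r} \<Longrightarrow> vpath (tree_path x y) (with_proj T)"
  shows "\<not> undirected_forest T"
proof (cases "pair_graph T")
  case True
  have arcs: "(v, 2 * v) \<in> parcs (cactus D)" "(2 * v, 2 * v + 1) \<in> parcs (cactus D)" "(v, 2 * v + 1) \<in> parcs (cactus D)"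
    using assms(1) unfolding parcs_cactus triangle_arcs_def by blast+
  obtain px py qx qy rx ry where pqr: "p = (px, py)" "q = (qx, qy)" "r = (rx, ry)" by (meson surj_pair)
  have lev: "on_level D px" "on_level D py" "px \<noteq> py" "on_level D qx" "on_level D qy" "qx \<noteq> qy"
    "on_level D rx" "on_level D ry" "rx \<noteq> ry"
    using assms(2) unfolding pqr by blast+
  have "{v, 2 * v} \<in> path_edges (tree_path px py)" "{2 * v, 2 * v + 1} \<in> path_edges (tree_path qx qy)"
    "{2 * v + 1, v} \<in> path_edges (tree_path rx ry)"
    using assms(3-5) uses_iff[OF lev(1-3) arcs(1)] uses_iff[OF lev(4-6) arcs(2)] uses_iff[OF lev(7-9) arcs(3)]
    unfolding pqr by (simp_all only: insert_commute)
  moreover have "vpath (tree_path px py) (with_proj T)" "vpath (tree_path qx qy) (with_proj T)" "vpath (tree_path rx ry) (with_proj T)"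
    using assms(6) unfolding pqr by blast+
  ultimately have "(v, 2 * v) \<in> parcs T" "(2 * v, 2 * v + 1) \<in> parcs T" "(2 * v + 1, v) \<in> parcs T"
    using vpath_arc[OF _ True] by blast+
  then show ?thesis using assms(1) by (intro triangle_cycle[OF _ _ _ _ _ _ True]) auto
qed (simp add: undirected_forest_def)

lemma pcas_nth:
  assumes "pcas u c v" "i < length c"
  shows "fst (c ! i) = (if i = 0 then u else snd (c ! (i - 1)))" "c \<noteq> [] \<Longrightarrow> snd (last c) = v"
proof -
  show "fst (c ! i) = (if i = 0 then u else snd (c ! (i - 1)))"
    using assms
  proof (induction c arbitrary: u i)
    case (Cons e c)
    then show ?case by (cases i) (auto split: if_splits)
  qed simp
  show "c \<noteq> [] \<Longrightarrow> snd (last c) = v"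
    using assms(1) by (induction c arbitrary: u) auto
qed

lemma pawalk_verts_conv: "pcas u c v \<Longrightarrow> pawalk_verts u c = u # map snd c"
  by (induction c arbitrary: u) auto

lemma cycle_neighbours:
  assumes "pair_graph T" "pre_digraph.cycle (with_proj T) c" "3 \<le> length c" "z \<in> set (map snd c)"
  obtains a b where "a \<noteq> b" "(a, z) \<in> parcs T" "(z, b) \<in> parcs T" "a \<in> set (map snd c)" "b \<in> set (map snd c)"
proof -
  interpret pair_graph T by fact
  obtain u where u: "set c \<subseteq> parcs T" "pcas u c u" "distinct (map snd c)"
    using assms(2) pawalk_verts_conv unfolding cycle_def awalk_def by fastforce
  let ?n = "length c"
  obtain i where i: "i < ?n" "z = snd (c ! i)" using assms(4) by (auto simp: in_set_conv_nth)
  \<comment> \<open>The cyclic predecessor and successor of position \<open>i\<close>; they differ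
    because the cycle has length at least 3.\<close>
  define p q where "p = (if i = 0 then ?n - 1 else i - 1)" and "q = (if Suc i = ?n then 0 else Suc i)"
  have pq: "p < ?n" "q < ?n" "p \<noteq> q" using i(1) assms(3) by (auto simp: p_def q_def)
  have "c \<noteq> []" using assms(3) by auto
  with pcas_nth(2)[OF u(2) i(1)] have last: "snd (c ! (?n - 1)) = u" by (simp add: last_conv_nth)
  have "fst (c ! i) = snd (c ! p)" using pcas_nth(1)[OF u(2) i(1)] last by (simp add: p_def)
  then have "(snd (c ! p), z) = c ! i" using i(2) by (simp add: prod_eq_iff)
  then have "(snd (c ! p), z) \<in> parcs T" using u(1) nth_mem[OF i(1)] by auto
  moreover have "fst (c ! q) = z"
  proof (cases "Suc i = ?n")
    case True
    then have "?n - 1 = i" by simp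
    with True show ?thesis using pcas_nth(1)[OF u(2) pq(2)] last i(2) by (simp add: q_def)
  next
    case False
    then show ?thesis using pcas_nth(1)[OF u(2) pq(2)] i(2) by (simp add: q_def)
  qed
  then have "(z, snd (c ! q)) = c ! q" by (simp add: prod_eq_iff)
  then have "(z, snd (c ! q)) \<in> parcs T" using u(1) nth_mem[OF pq(2)] by auto
  moreover have "snd (c ! p) \<noteq> snd (c ! q)"
    using nth_eq_iff_index_eq[OF u(3), of p q] pq by simp
  ultimately show thesis using pq by (intro that[of "snd (c ! p)" "snd (c ! q)"]) auto
qed

text \<open>The vertex of largest number on a cycle is the right child of its parent, and the triangle
  below that parent lies on the cycle.\<close>

lemma forest_if_no_full_triangle:
  assumes T: "pair_graph T" and sub: "parcs T \<subseteq> parcs (cactus D)"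
    and no: "\<And>v. (v, 2 * v) \<in> parcs T \<Longrightarrow> (2 * v, 2 * v + 1) \<in> parcs T \<Longrightarrow> (v, 2 * v + 1) \<in> parcs T \<Longrightarrow> False"
  shows "undirected_forest T"
  unfolding undirected_forest_def
proof (intro conjI notI)
  show "pair_graph T" by fact
  assume "\<exists>c. pre_digraph.cycle (with_proj T) c \<and> 3 \<le> length c"
  then obtain c where c: "pre_digraph.cycle (with_proj T) c" "3 \<le> length c" by blast
  interpret pair_graph T by fact
  let ?Z = "set (map snd c)"
  define m where "m = Max ?Z"
  have fin: "finite ?Z" "?Z \<noteq> {}" using c(2) by auto
  have le: "w \<le> m" if "w \<in> ?Z" for w
    using Max_ge[OF fin(1) that] unfolding m_def .
  have nbr: "2 \<le> x \<and> (y = x div 2 \<or> y = sib x)" if "(x, y) \<in> parcs T" "y < x" for x y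
  proof -
    have "(x, y) \<in> parcs (cactus D)" using that(1) sub by blast
    with that(2) show ?thesis by (auto simp: arc_iff)
  qed
  have mZ: "m \<in> ?Z" using Max_in[OF fin] unfolding m_def .
  obtain a b where ab: "a \<noteq> b" "(a, m) \<in> parcs T" "(m, b) \<in> parcs T" "a \<in> ?Z" "b \<in> ?Z"
    by (rule cycle_neighbours[OF T c mZ])
  have "a < m" "b < m" using le[OF ab(4)] le[OF ab(5)] no_loops'[OF ab(2)] no_loops'[OF ab(3)] by auto
  with nbr[OF arcs_symmetric[OF ab(2)]] nbr[OF ab(3)] ab(1)
  have m2: "2 \<le> m" and ab': "a = m div 2 \<and> b = sib m \<or> a = sib m \<and> b = m div 2" by auto
  with \<open>a < m\<close> \<open>b < m\<close> have "sib m < m" by auto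
  then have "odd m" by (auto simp: sib_def split: if_splits)
  then obtain v where v: "m = 2 * v + 1" by (elim oddE)
  have v1: "1 \<le> v" using m2 v by simp
  have sv: "sib m = 2 * v" "m div 2 = v" by (simp_all add: v sib_def)
  have "(m div 2, m) \<in> parcs T" "(sib m, m) \<in> parcs T" "sib m \<in> ?Z"
    using ab' ab(2,4,5) arcs_symmetric[OF ab(3)] by metis+
  then have arcs: "(v, 2 * v + 1) \<in> parcs T" "(2 * v, 2 * v + 1) \<in> parcs T" "2 * v \<in> ?Z"
    unfolding sv by (simp_all only: v)
  obtain a' b' where ab2: "a' \<noteq> b'" "(a', 2 * v) \<in> parcs T" "(2 * v, b') \<in> parcs T" "a' \<in> ?Z" "b' \<in> ?Z"
    by (rule cycle_neighbours[OF T c arcs(3)])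
  \<comment> \<open>The children of \<open>2 * v\<close> exceed the maximum
    \<open>m = 2 * v + 1\<close>, so on the cycle only the parent and the sibling are left as
    neighbours.\<close>
  have "w = v \<or> w = 2 * v + 1" if "(2 * v, w) \<in> parcs T" "w \<in> ?Z" for w
  proof -
    have "(2 * v, w) \<in> parcs (cactus D)" using that(1) sub by blast
    moreover have "w \<le> 2 * v + 1" using le[OF that(2)] v by simp
    ultimately show ?thesis using v1 by (auto simp: arc_iff sib_def)
  qed
  from this[OF arcs_symmetric[OF ab2(2)] ab2(4)] this[OF ab2(3,5)] ab2(1)
  have "a' = v \<or> b' = v" by auto
  then have "(v, 2 * v) \<in> parcs T" using ab2(2) arcs_symmetric[OF ab2(3)] by auto
  from no[OF this arcs(2,1)] show False .
qed

definition union_graph :: "nat \<Rightarrow> (nat \<times> nat) set \<Rightarrow> nat pair_pre_digraph" where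
  "union_graph D Q = \<lparr>pverts = {1..<2 ^ Suc D}, parcs = {(u, v). \<exists>p\<in>paths_of Q. {u, v} \<in> path_edges p}\<rparr>"

lemma union_graph_forest:
  assumes lev: "\<And>x y. (x, y) \<in> Q \<Longrightarrow> on_level D x \<and> on_level D y \<and> x \<noteq> y"
    and no: "\<And>v p q r. p \<in> Q \<Longrightarrow> q \<in> Q \<Longrightarrow> r \<in> Q \<Longrightarrow>
      uses v (2 * v) p \<Longrightarrow> uses (2 * v) (2 * v + 1) q \<Longrightarrow> uses v (2 * v + 1) r \<Longrightarrow> False"
  shows "undirected_forest (union_graph D Q)" "p \<in> paths_of Q \<Longrightarrow> vpath p (with_proj (union_graph D Q))"
proof -
  have ex: "\<exists>(x, y)\<in>Q. {u, v} \<in> path_edges (tree_path x y)" if "(u, v) \<in> parcs (union_graph D Q)" for u v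
    using that by (auto simp: union_graph_def)
  have arc: "(u, v) \<in> parcs (cactus D)" if uv: "(u, v) \<in> parcs (union_graph D Q)" for u v
  proof -
    obtain x y where xy: "(x, y) \<in> Q" "{u, v} \<in> path_edges (tree_path x y)" using ex[OF uv] by blast
    then have "(u, v) \<in> set (vwalk_arcs (tree_path x y)) \<or> (v, u) \<in> set (vwalk_arcs (tree_path x y))"
      by (auto simp: path_edges_conv doubleton_eq_iff)
    then show ?thesis using tree_path_arcs[of D x y] lev[OF xy(1)] arc_sym by blast
  qed
  have use: "\<exists>p\<in>Q. uses u v p" if uv: "(u, v) \<in> parcs (union_graph D Q)" for u v
  proof -
    obtain x y where xy: "(x, y) \<in> Q" "{u, v} \<in> path_edges (tree_path x y)" using ex[OF uv] by blast
    then have "uses u v (x, y)" using uses_iff[of D x y u v] lev[OF xy(1)] arc[OF uv] by blast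
    then show ?thesis using xy(1) by blast
  qed
  have pg: "pair_graph (union_graph D Q)"
  proof
    show "finite (pverts (union_graph D Q))" by (simp add: union_graph_def)
    have "parcs (union_graph D Q) \<subseteq> parcs (cactus D)" using arc by auto
    then show "finite (parcs (union_graph D Q))" by (rule finite_subset) (rule cactus.finite_arcs)
    show "symmetric (with_proj (union_graph D Q))"
      unfolding symmetric_def with_proj_simps by (rule symI) (simp add: union_graph_def insert_commute)
  next
    fix e assume e: "e \<in> parcs (union_graph D Q)"
    obtain a b where ab: "e = (a, b)" by force
    have "(a, b) \<in> parcs (cactus D)" using e arc unfolding ab by blast
    from arc_vertices[OF this] show "fst e \<in> pverts (union_graph D Q)" "snd e \<in> pverts (union_graph D Q)" "fst e \<noteq> snd e"
      unfolding ab by (simp_all add: union_graph_def)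
  qed
  show "undirected_forest (union_graph D Q)"
  proof (rule forest_if_no_full_triangle[OF pg])
    show "parcs (union_graph D Q) \<subseteq> parcs (cactus D)" using arc by auto
    show False if "(v, 2 * v) \<in> parcs (union_graph D Q)" "(2 * v, 2 * v + 1) \<in> parcs (union_graph D Q)"
        "(v, 2 * v + 1) \<in> parcs (union_graph D Q)" for v
      using use[OF that(1)] use[OF that(2)] use[OF that(3)] no by blast
  qed
  assume p: "p \<in> paths_of Q"
  then obtain x y where xy: "p = tree_path x y" "(x, y) \<in> Q" by auto
  have v: "vpath p (with_proj (cactus D))" unfolding xy(1) using lev[OF xy(2)] by (intro vpath_tree_path) auto
  have "(a, b) \<in> parcs (union_graph D Q)" if "(a, b) \<in> set (vwalk_arcs p)" for a b
  proof -
    have "{a, b} \<in> path_edges p" using that unfolding path_edges_conv by blast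
    then have "\<exists>p\<in>paths_of Q. {a, b} \<in> path_edges p" using p by blast
    then show ?thesis
      unfolding union_graph_def by (simp only: pair_pre_digraph.simps mem_Collect_eq prod.case)
  qed
  then have "set (vwalk_arcs p) \<subseteq> parcs (union_graph D Q)" by auto
  then show "vpath p (with_proj (union_graph D Q))"
    using v by (auto simp: vpath_def vwalk_def union_graph_def)
qed

definition full_triangle :: "nat \<Rightarrow> nat \<times> nat \<Rightarrow> nat \<times> nat \<Rightarrow> nat \<times> nat \<Rightarrow> bool" where
  "full_triangle v p q r \<longleftrightarrow> uses v (2 * v) p \<and> uses (2 * v) (2 * v + 1) q \<and> uses v (2 * v + 1) r"

text \<open>Covers by forests are colourings without a monochromatic full triangle: a path gets the
  index of a forest that contains it, and conversely each colour class has a forest as its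
  union.\<close>

theorem PCFN_chords:
  assumes lev: "\<And>x y. (x, y) \<in> S \<Longrightarrow> on_level D x \<and> on_level D y \<and> x \<noteq> y"
    and upper: "\<And>p. p \<in> S \<Longrightarrow> c p < (4 :: nat)"
      "\<And>v p q r. p \<in> S \<Longrightarrow> q \<in> S \<Longrightarrow> r \<in> S \<Longrightarrow> c p = c q \<Longrightarrow> c q = c r \<Longrightarrow> \<not> full_triangle v p q r"
    and lower: "\<And>f :: nat \<times> nat \<Rightarrow> nat. (\<And>p. p \<in> S \<Longrightarrow> f p < 3) \<Longrightarrow>
      \<exists>v\<in>{1..<2 ^ D}. \<exists>p\<in>S. \<exists>q\<in>S. \<exists>r\<in>S. f p = f q \<and> f q = f r \<and> full_triangle v p q r"
  shows "PCFN (paths_of S) = 4"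
proof -
  let ?cover = "\<lambda>F. (\<forall>T\<in>F. undirected_forest T) \<and> (\<forall>p\<in>paths_of S. \<exists>T\<in>F. vpath p (with_proj T))"
  have low: "4 \<le> card F" if F: "finite F" "?cover F" for F :: "nat pair_pre_digraph set"
  proof (rule ccontr)
    assume "\<not> 4 \<le> card F"
    then have card: "card F \<le> 3" by simp
    obtain h where h: "bij_betw h {0..<card F} F" using ex_bij_betw_nat_finite[OF F(1)] by blast
    have "\<exists>i<3. h i \<in> F \<and> vpath (tree_path (fst p) (snd p)) (with_proj (h i))" if "p \<in> S" for p
    proof -
      have "tree_path (fst p) (snd p) \<in> paths_of S" using that by (force simp: case_prod_beta)
      then obtain T where T: "T \<in> F" "vpath (tree_path (fst p) (snd p)) (with_proj T)" using F(2) by blast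
      have "T \<in> h ` {0..<card F}" using h T(1) by (simp add: bij_betw_def)
      then obtain i where "i < card F" "h i = T" by auto
      then show ?thesis using T card by (intro exI[of _ i]) auto
    qed
    then obtain f where f: "\<And>p. p \<in> S \<Longrightarrow> f p < 3 \<and> h (f p) \<in> F \<and> vpath (tree_path (fst p) (snd p)) (with_proj (h (f p)))"
      by metis
    then obtain v p q r where *: "v \<in> {1..<2 ^ D}" "p \<in> S" "q \<in> S" "r \<in> S" "f p = f q" "f q = f r" "full_triangle v p q r"
      using lower[of f] by blast
    have "\<not> undirected_forest (h (f p))"
    proof (rule not_forest_if_full_triangle[OF *(1)])
      show "on_level D x \<and> on_level D y \<and> x \<noteq> y" if "(x, y) \<in> {p, q, r}" for x y
        using lev that *(2-4) by blast
      show "uses v (2 * v) p" "uses (2 * v) (2 * v + 1) q" "uses v (2 * v + 1) r"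
        using *(7) by (simp_all only: full_triangle_def)
      show "vpath (tree_path x y) (with_proj (h (f p)))" if "(x, y) \<in> {p, q, r}" for x y
        using that f[OF *(2)] f[OF *(3)] f[OF *(4)] *(5,6) by auto
    qed
    then show False using F(2) f[OF *(2)] by blast
  qed
  let ?Q = "\<lambda>i. {p \<in> S. c p = i}"
  let ?F = "(\<lambda>i. union_graph D (?Q i)) ` {0..<4}"
  have forest: "undirected_forest (union_graph D (?Q i))"
    "p \<in> paths_of (?Q i) \<Longrightarrow> vpath p (with_proj (union_graph D (?Q i)))" for i p
  proof -
    have Q: "on_level D x \<and> on_level D y \<and> x \<noteq> y" if "(x, y) \<in> ?Q i" for x y using lev[of x y] that by blast
    have "False" if "p \<in> ?Q i" "q \<in> ?Q i" "r \<in> ?Q i"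
      "uses v (2 * v) p" "uses (2 * v) (2 * v + 1) q" "uses v (2 * v + 1) r" for v p q r
      using upper(2)[of p q r v] that by (simp add: full_triangle_def)
    note U = union_graph_forest[OF Q this]
    show "undirected_forest (union_graph D (?Q i))" by (rule U(1))
    show "p \<in> paths_of (?Q i) \<Longrightarrow> vpath p (with_proj (union_graph D (?Q i)))" by (rule U(2))
  qed
  have "\<exists>T\<in>?F. vpath p (with_proj T)" if "p \<in> paths_of S" for p
  proof -
    from that obtain x y where xy: "p = tree_path x y" "(x, y) \<in> S" by auto
    then have "p \<in> paths_of (?Q (c (x, y)))" by auto
    moreover have "c (x, y) \<in> {0..<4}" using upper(1)[OF xy(2)] by simp
    ultimately show ?thesis using forest(2) by blast
  qed
  then have cover: "?cover ?F" using forest(1) by blast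
  have fin: "finite ?F" by simp
  \<comment> \<open>That the four unions are distinct graphs follows from the lower bound, which
    applies to every cover.\<close>
  have "card ?F \<le> 4" using card_image_le[of "{0..<4::nat}" "\<lambda>i. union_graph D (?Q i)"] by simp
  with low[OF fin cover] have four: "card ?F = 4" by (rule order_antisym[rotated])
  show ?thesis
    unfolding PCFN_def
  proof (rule Least_equality)
    show "\<exists>F. finite F \<and> card F = 4 \<and> ?cover F"
      by (rule exI[of _ ?F]) (intro conjI fin four cover)
    fix k assume "\<exists>F. finite F \<and> card F = k \<and> ?cover F"
    then obtain F where "finite F" "card F = k" "?cover F" by blast
    with low[of F] show "4 \<le> k" by blast
  qed
qed

section \<open>Families of paths described by plans\<close>

text \<open>
  A plan describes a family of paths below a vertex that \<open>k\<close> paths cross. In \<open>Node k i m l r\<close> the first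
  \<open>i\<close> of them, from left to right, continue to the left child and the others to the right child,
  and \<open>m\<close> new paths join the two children. The new paths are listed from the triangle downwards, so
  they appear in reverse order at the right child.
\<close>

datatype plan = Leaf | Node nat nat nat plan plan

datatype col3 = C0 | C1 | C2

text \<open>Colours \<open>w\<close> of the paths crossing the vertex can be extended to all new
  paths below. Paths going left, new paths and paths going right cover one side of the triangle
  each, whence the condition that no colour is common to all three.\<close>

fun ok :: "plan \<Rightarrow> 'c list \<Rightarrow> bool" where
  "ok Leaf w \<longleftrightarrow> True"
| "ok (Node k i m l r) w \<longleftrightarrow> length w = k \<and>
     (\<exists>xs. length xs = m \<and> set (take i w) \<inter> set xs \<inter> set (drop i w) = {} \<and>
       ok l (take i w @ xs) \<and> ok r (rev xs @ drop i w))"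

fun mirror :: "plan \<Rightarrow> plan" where
  "mirror Leaf = Leaf"
| "mirror (Node k i m l r) = Node k (k - i) m (mirror r) (mirror l)"

text \<open>Reflecting the cactus reads the words backwards, so each plan can also be applied to the
  right end of a word.\<close>

lemma ok_mirror: "ok (mirror t) w \<longleftrightarrow> ok t (rev w)"
proof (induction t arbitrary: w)
  case (Node k i m l r)
  have "take (k - i) w = rev (drop i (rev w))" "drop (k - i) w = rev (take i (rev w))" if "length w = k"
    using that by (simp_all add: rev_drop rev_take)
  then show ?case by (auto simp: Node.IH Int_ac)
qed simp

fun path_count :: "plan \<Rightarrow> nat" where
  "path_count Leaf = 0"
| "path_count (Node k i m l r) = m + path_count l + path_count r"

fun height :: "plan \<Rightarrow> nat" where
  "height Leaf = 0"
| "height (Node k i m l r) = Suc (max (height l) (height r))"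

text \<open>Runs a plan on actual paths. The list \<open>ps\<close> supplies the new paths in
  preorder, \<open>s\<close> is the number of leaves below \<open>v\<close>, and each entry records
  the paths meant for the three sides of triangle \<open>v\<close>.\<close>

fun turns :: "plan \<Rightarrow> 'a list \<Rightarrow> 'a list \<Rightarrow> nat \<Rightarrow> nat \<Rightarrow> (nat \<times> nat \<times> 'a list \<times> 'a list \<times> 'a list) list" where
  "turns Leaf w ps v s = []"
| "turns (Node k i m l r) w ps v s =
     (v, s, take i w, take m ps, drop i w) #
     turns l (take i w @ take m ps) (drop m ps) (2 * v) (s div 2) @
     turns r (rev (take m ps) @ drop i w) (drop (m + path_count l) ps) (2 * v + 1) (s div 2)"

fun plan_width :: "plan \<Rightarrow> nat \<Rightarrow> bool" where
  "plan_width Leaf k \<longleftrightarrow> True"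
| "plan_width (Node k i m l r) k' \<longleftrightarrow> k = k' \<and> i \<le> k \<and> plan_width l (i + m) \<and> plan_width r (m + (k - i))"

text \<open>The colours of the recorded new paths serve as the witnesses \<open>xs\<close> in
  \<open>ok\<close>.\<close>

lemma ok_turns:
  assumes "\<And>v s A B C. (v, s, A, B, C) \<in> set (turns t w ps u z) \<Longrightarrow> f ` set A \<inter> f ` set B \<inter> f ` set C = {}"
    and "plan_width t (length w)" "path_count t \<le> length ps"
  shows "ok t (map f w)"
  using assms
proof (induction t arbitrary: w ps u z)
  case (Node k i m l r)
  have hyp: "f ` set A \<inter> f ` set B \<inter> f ` set C = {}"
    if "(v, s, A, B, C) \<in> set (turns (Node k i m l r) w ps u z)" for v s A B C
    using Node.prems(1) that by blast
  have m: "length (take m ps) = m" using Node.prems(3) by simp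
  have "ok l (map f (take i w @ take m ps))"
  proof (rule Node.IH(1)[of _ "drop m ps" "2 * u" "z div 2"])
    show "f ` set A \<inter> f ` set B \<inter> f ` set C = {}"
      if "(v, s, A, B, C) \<in> set (turns l (take i w @ take m ps) (drop m ps) (2 * u) (z div 2))" for v s A B C
      using that by (intro hyp[of v s]) simp
    show "plan_width l (length (take i w @ take m ps))" "path_count l \<le> length (drop m ps)"
      using Node.prems(2,3) m by simp_all
  qed
  moreover have "ok r (map f (rev (take m ps) @ drop i w))"
  proof (rule Node.IH(2)[of _ "drop (m + path_count l) ps" "2 * u + 1" "z div 2"])
    show "f ` set A \<inter> f ` set B \<inter> f ` set C = {}"
      if "(v, s, A, B, C) \<in> set (turns r (rev (take m ps) @ drop i w) (drop (m + path_count l) ps) (2 * u + 1) (z div 2))" for v s A B C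
      using that by (intro hyp[of v s]) simp
    have len: "length (rev (take m ps) @ drop i w) = m + (k - i)" using Node.prems(2) m by simp
    show "plan_width r (length (rev (take m ps) @ drop i w))"
      unfolding len using Node.prems(2) by (metis plan_width.simps(2))
    show "path_count r \<le> length (drop (m + path_count l) ps)" using Node.prems(3) by simp
  qed
  moreover have "f ` set (take i w) \<inter> f ` set (take m ps) \<inter> f ` set (drop i w) = {}"
    by (rule hyp[of u z]) simp
  ultimately show ?case
    using Node.prems(2) m
    by (auto simp: take_map drop_map rev_map intro!: exI[of _ "map f (take m ps)"])
qed simp

lemma turns_level:
  assumes "(v, s, A, B, C) \<in> set (turns t w ps u z)" "on_level l u" "l + height t \<le> D" "z = 2 ^ (D - l)"
  shows "\<exists>l'. on_level l' v \<and> l' < D \<and> s = 2 ^ (D - l')"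
  using assms
proof (induction t arbitrary: w ps u z l)
  case (Node k i m t1 t2)
  then have l: "l < D" by simp
  then have "z div 2 = 2 ^ (D - Suc l)" using Node.prems(4) by (metis Suc_diff_Suc nonzero_mult_div_cancel_left power_Suc zero_neq_numeral)
  moreover have "on_level (Suc l) (2 * u)" "on_level (Suc l) (2 * u + 1)"
    using Node.prems(2) by (auto simp: on_level_def)
  moreover have "Suc l + height t1 \<le> D" "Suc l + height t2 \<le> D" using Node.prems(3) by auto
  moreover from Node.prems(1) consider "v = u" "s = z"
    | "(v, s, A, B, C) \<in> set (turns t1 (take i w @ take m ps) (drop m ps) (2 * u) (z div 2))"
    | "(v, s, A, B, C) \<in> set (turns t2 (rev (take m ps) @ drop i w) (drop (m + path_count t1) ps) (2 * u + 1) (z div 2))"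
    by auto
  ultimately show ?case
    using Node.IH(1)[of "take i w @ take m ps" "drop m ps" "2 * u" "z div 2" "Suc l"]
      Node.IH(2)[of "rev (take m ps) @ drop i w" "drop (m + path_count t1) ps" "2 * u + 1" "z div 2" "Suc l"]
      Node.prems(2,4) l by metis
qed simp

text \<open>An executable test for \<open>v\<close> being on the path, provided that
  \<open>s\<close> is the number of leaves below \<open>v\<close>.\<close>

definition separates :: "nat \<Rightarrow> nat \<Rightarrow> nat \<times> nat \<Rightarrow> bool" where
  "separates s v p \<longleftrightarrow> (fst p div s = v) \<noteq> (snd p div s = v)"

lemma separates_iff:
  assumes "on_level D x" "on_level D y" "on_level l v" "l \<le> D"
  shows "separates (2 ^ (D - l)) v (x, y) \<longleftrightarrow> below v x \<noteq> below v y"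
  using below_iff_div[OF assms(1,3)] below_iff_div[OF assms(2,3)] assms(4) by (simp add: separates_def)

definition correct_turns :: "nat \<times> nat \<times> (nat \<times> nat) list \<times> (nat \<times> nat) list \<times> (nat \<times> nat) list \<Rightarrow> bool" where
  "correct_turns = (\<lambda>(v, s, A, B, C).
     list_all (\<lambda>p. separates s v p \<and> separates (s div 2) (2 * v) p) A \<and>
     list_all (\<lambda>p. separates (s div 2) (2 * v) p \<and> separates (s div 2) (2 * v + 1) p) B \<and>
     list_all (\<lambda>p. separates s v p \<and> separates (s div 2) (2 * v + 1) p) C)"

lemma correct_turns_full:
  assumes "correct_turns (v, s, A, B, C)" "on_level l v" "l < D" "s = 2 ^ (D - l)"
    and lev: "\<And>x y. (x, y) \<in> set A \<union> set B \<union> set C \<Longrightarrow> on_level D x \<and> on_level D y"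
    and "p \<in> set A" "q \<in> set B" "r \<in> set C"
  shows "full_triangle v p q r"
proof -
  obtain x y where p: "p = (x, y)" by force
  obtain x' y' where q: "q = (x', y')" by force
  obtain x'' y'' where r: "r = (x'', y'')" by force
  have s: "s div 2 = 2 ^ (D - Suc l)"
    using assms(3,4) by (metis Suc_diff_Suc nonzero_mult_div_cancel_left power_Suc zero_neq_numeral)
  have L: "on_level (Suc l) (2 * v)" "on_level (Suc l) (2 * v + 1)" "l \<le> D" "Suc l \<le> D"
    using assms(2,3) by (auto simp: on_level_def)
  have P: "on_level D x" "on_level D y" and Q: "on_level D x'" "on_level D y'" and R: "on_level D x''" "on_level D y''"
    using lev assms(6-8) unfolding p q r by blast+
  have "separates s v p" "separates (s div 2) (2 * v) p" "separates (s div 2) (2 * v) q"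
    "separates (s div 2) (2 * v + 1) q" "separates s v r" "separates (s div 2) (2 * v + 1) r"
    using assms(1,6-8) unfolding correct_turns_def by (auto simp: list_all_iff)
  then show ?thesis
    unfolding s unfolding assms(4) p q r separates_iff[OF P assms(2) L(3)] separates_iff[OF P L(1,4)]
      separates_iff[OF Q L(1,4)] separates_iff[OF Q L(2,4)] separates_iff[OF R assms(2) L(3)] separates_iff[OF R L(2,4)]
    by (simp add: full_triangle_def uses_def)
qed

text \<open>The triangle in which the path crosses from one child to the other. Started with
  \<open>h = 1\<close>, the second component ends up as the number of leaves below each of these
  children.\<close>

function apex :: "nat \<Rightarrow> nat \<Rightarrow> nat \<Rightarrow> nat \<times> nat" where
  "apex x y h = (if x div 2 = y div 2 then (x div 2, h) else apex (x div 2) (y div 2) (2 * h))"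
  by auto
termination
proof (relation "measure (\<lambda>(x, y, h). x + y)")
  fix x y h :: nat
  assume "x div 2 \<noteq> y div 2"
  then have "x \<noteq> 0 \<or> y \<noteq> 0" by auto
  then have "x div 2 + y div 2 < x + y" by linarith
  then show "((x div 2, y div 2, 2 * h), x, y, h) \<in> measure (\<lambda>(x, y, h). x + y)" by simp
qed simp

declare apex.simps [simp del]

lemma apex_eq:
  assumes "on_level d x" "on_level d y" "x \<noteq> y" "uses (2 * v) (2 * v + 1) (x, y)"
  shows "\<exists>l<d. on_level l v \<and> apex x y h = (v, h * 2 ^ (d - Suc l))"
  using assms
proof (induction arbitrary: h rule: level_induct)
  case (sibling d x y)
  then have "2 * v \<in> set (tree_path x y)" "2 * v + 1 \<in> set (tree_path x y)"
    using set_tree_path[of "Suc d" x y] by (auto simp: uses_def)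
  then have "x = 2 * v \<and> y = 2 * v + 1 \<or> x = 2 * v + 1 \<and> y = 2 * v"
    using sibling.hyps(4) by (auto simp: tree_path.simps[of x y])
  then have "v = x div 2" by auto
  then show ?case
    using sibling.hyps on_level_div2 by (intro exI[of _ d]) (simp add: apex.simps[of x y])
next
  case (step d x y)
  have mem: "2 * v \<in> set (tree_path x y)" "2 * v + 1 \<in> set (tree_path x y)"
    using step.prems set_tree_path[of "Suc d" x y] step.hyps by (auto simp: uses_def)
  have set: "set (tree_path x y) = insert x (insert y (set (tree_path (x div 2) (y div 2))))"
    using step.hyps(3) by (subst tree_path.simps) auto
  have upper: "w < 2 ^ Suc d" if "w \<in> set (tree_path (x div 2) (y div 2))" for w
    using set_tree_path_level[OF step.hyps(4,5,3) that] by simp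
  have low: "\<not> x < 2 ^ Suc d" "\<not> y < 2 ^ Suc d" using step.hyps(1,2) by (auto simp: on_level_def)
  \<comment> \<open>The bound is even, so the siblings \<open>2 * v\<close> and
    \<open>2 * v + 1\<close> are both on the bottom level or both above it. On the bottom level they
    would be \<open>x\<close> and \<open>y\<close>, which have different parents.\<close>
  have "\<not> 2 ^ Suc d \<le> 2 * v + 1"
  proof
    assume a: "2 ^ Suc d \<le> 2 * v + 1"
    then have "2 ^ Suc d \<le> 2 * v" by (metis Suc_eq_plus1 dvd_triv_left even_Suc le_SucE power_Suc)
    with a have "2 * v = x \<or> 2 * v = y" "2 * v + 1 = x \<or> 2 * v + 1 = y" using mem upper unfolding set by fastforce+
    then show False using step.hyps(3) by auto
  qed
  then have "2 * v \<in> set (tree_path (x div 2) (y div 2))" "2 * v + 1 \<in> set (tree_path (x div 2) (y div 2))"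
    using mem low unfolding set by auto
  then have "uses (2 * v) (2 * v + 1) (x div 2, y div 2)"
    unfolding set_tree_path[OF step.hyps(4,5,3)] by (simp add: uses_def)
  from step.IH[OF this, of "2 * h"] obtain l where
    "l < d" "on_level l v" "apex (x div 2) (y div 2) (2 * h) = (v, 2 * h * 2 ^ (d - Suc l))" by blast
  moreover from this have "2 * h * 2 ^ (d - Suc l) = h * 2 ^ (Suc d - Suc l)" by (simp add: Suc_diff_le flip: power_Suc Suc_diff_Suc)
  ultimately show ?case using step.hyps(3) by (intro exI[of _ l]) (simp add: apex.simps[of x y])
qed

definition no_triangle_at :: "(nat \<times> nat) list \<Rightarrow> nat \<times> nat \<Rightarrow> bool" where
  "no_triangle_at ps = (\<lambda>(v, h).
     \<not> list_ex (\<lambda>p. separates h (2 * v) p \<and> separates (2 * h) v p) ps \<or>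
     \<not> list_ex (\<lambda>p. separates h (2 * v + 1) p \<and> separates (2 * h) v p) ps)"

text \<open>The side between two siblings is used only by paths with their apex there, so a full
  triangle is detected at the apex of its path \<open>q\<close>. Testing the apexes within one
  colour class covers all triangles.\<close>

lemma no_full_triangle:
  assumes lev: "\<And>x y. (x, y) \<in> set ps \<Longrightarrow> on_level D x \<and> on_level D y \<and> x \<noteq> y"
    and check: "list_all (\<lambda>(x, y). no_triangle_at ps (apex x y 1)) ps"
    and mem: "p \<in> set ps" "q \<in> set ps" "r \<in> set ps"
  shows "\<not> full_triangle v p q r"
proof
  assume full: "full_triangle v p q r"
  obtain x y where q: "q = (x, y)" by force
  have Q: "on_level D x" "on_level D y" "x \<noteq> y" using lev mem(2) unfolding q by blast+
  from full have "uses (2 * v) (2 * v + 1) (x, y)" unfolding q by (simp add: full_triangle_def)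
  from apex_eq[OF Q this, of 1] obtain l where l: "l < D" "on_level l v" "apex x y 1 = (v, 2 ^ (D - Suc l))" by auto
  let ?h = "2 ^ (D - Suc l) :: nat"
  have "no_triangle_at ps (v, ?h)"
    using check mem(2) l(3) unfolding q by (auto simp: list_all_iff)
  moreover have h: "2 * ?h = 2 ^ (D - l)" using l(1) by (simp add: Suc_diff_Suc flip: power_Suc)
  have L: "on_level (Suc l) (2 * v)" "on_level (Suc l) (2 * v + 1)" "l \<le> D" "Suc l \<le> D"
    using l by (auto simp: on_level_def)
  have "separates ?h (2 * v) p \<and> separates (2 * ?h) v p"
  proof -
    obtain a b where p: "p = (a, b)" by force
    have P: "on_level D a" "on_level D b" using lev mem(1) unfolding p by blast+
    show ?thesis using full
      unfolding p h separates_iff[OF P L(1,4)] separates_iff[OF P l(2) L(3)] by (simp add: full_triangle_def uses_def)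
  qed
  moreover have "separates ?h (2 * v + 1) r \<and> separates (2 * ?h) v r"
  proof -
    obtain a b where r: "r = (a, b)" by force
    have R: "on_level D a" "on_level D b" using lev mem(3) unfolding r by blast+
    show ?thesis using full
      unfolding r h separates_iff[OF R L(2,4)] separates_iff[OF R l(2) L(3)] by (simp add: full_triangle_def uses_def)
  qed
  ultimately show False using mem(1,3) by (auto simp: no_triangle_at_def list_ex_iff)
qed

section \<open>Three colours\<close>

text \<open>The plans and the list \<open>chord_list\<close> below, which realises \<open>g17\<close>, were found by computer search.\<close>

definition "g0 = Node 6 3 1 Leaf Leaf"
definition "g1 = Node 7 5 1 g0 Leaf"
definition "g2 = Node 9 3 1 Leaf g1"
definition "g3 = Node 9 8 1 g2 Leaf"
definition "g4 = Node 8 6 3 g3 Leaf"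
definition "g5 = Node 8 7 1 g4 Leaf"
definition "g6 = Node 6 4 4 g5 Leaf"
definition "g7 = Node 6 5 1 g6 Leaf"
definition "g8 = Node 5 3 3 g7 Leaf"
definition "g9 = Node 5 4 1 g8 Leaf"
definition "g10 = Node 7 5 4 Leaf (mirror g7)"
definition "g11 = Node 7 6 1 g10 Leaf"
definition "g12 = Node 6 2 3 g9 g11"
definition "g13 = Node 8 4 3 (mirror g11) (mirror g11)"
definition "g14 = Node 8 3 3 Leaf g13"
definition "g15 = Node 4 1 5 g12 g14"
definition "g16 = Node 4 1 3 Leaf (mirror g12)"
definition "g17 = Node 0 0 4 g15 g16"

lemma UNIV_col3: "UNIV = {C0, C1, C2}"
  using col3.exhaust by auto

section \<open>Excluding words in which three colours occur early\<close>

lemma rainbow: "distinct [a, b, c] \<Longrightarrow> {a, b, c} = (UNIV :: col3 set)"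
  by (cases a; cases b; cases c) (auto simp: UNIV_col3)

lemma ok_Node1:
  assumes "ok (Node k i 1 l r) w"
  obtains z where "set (take i w) \<inter> {z} \<inter> set (drop i w) = {}" "ok l (take i w @ [z])" "ok r ([z] @ drop i w)"
  using assms by (auto simp: length_Suc_conv)

lemma ok_Node3:
  assumes "ok (Node k i 3 l r) w"
  obtains x y z where "set (take i w) \<inter> {x, y, z} \<inter> set (drop i w) = {}"
    "ok l (take i w @ [x, y, z])" "ok r ([z, y, x] @ drop i w)"
  using assms by (auto simp: length_Suc_conv numeral_3_eq_3)

lemma ok_Node4:
  assumes "ok (Node k i 4 l r) w"
  obtains x y z u where "set (take i w) \<inter> {x, y, z, u} \<inter> set (drop i w) = {}"
    "ok l (take i w @ [x, y, z, u])" "ok r ([u, z, y, x] @ drop i w)"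
  using assms by (auto simp: length_Suc_conv eval_nat_numeral)

lemma ok_Node5:
  assumes "ok (Node k i 5 l r) w"
  obtains x y z u v where "set (take i w) \<inter> {x, y, z, u, v} \<inter> set (drop i w) = {}"
    "ok l (take i w @ [x, y, z, u, v])" "ok r ([v, u, z, y, x] @ drop i w)"
  using assms by (auto simp: length_Suc_conv eval_nat_numeral)

text \<open>Both halves show every colour, so any colour of the new path is common to all three
  sides.\<close>

lemma not_ok_g0:
  assumes "distinct [a, b, c]" "distinct [d, e, f :: col3]"
  shows "\<not> ok g0 [a, b, c, d, e, f]"
proof
  assume "ok g0 [a, b, c, d, e, f]"
  then obtain z where "set (take 3 [a, b, c, d, e, f]) \<inter> {z} \<inter> set (drop 3 [a, b, c, d, e, f]) = {}"
    unfolding g0_def by (rule ok_Node1)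
  then have "{a, b, c} \<inter> {z} \<inter> {d, e, f} = {}" by simp
  then show False unfolding rainbow[OF assms(1)] rainbow[OF assms(2)] by simp
qed

text \<open>The new path must avoid \<open>t\<close> and \<open>y\<close>, hence has colour
  \<open>u\<close>, and the left child receives the rainbow triples \<open>u\<close>,
  \<open>t\<close>, \<open>y\<close> and \<open>y\<close>, \<open>t\<close>,
  \<open>u\<close>.\<close>

lemma not_ok_g1:
  assumes "distinct [u, y, t :: col3]"
  shows "\<not> ok g1 [u, t, y, y, t, t, y]"
proof
  assume "ok g1 [u, t, y, y, t, t, y]"
  then obtain r where r: "set (take 5 [u, t, y, y, t, t, y]) \<inter> {r} \<inter> set (drop 5 [u, t, y, y, t, t, y]) = {}"
    "ok g0 (take 5 [u, t, y, y, t, t, y] @ [r])"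
    unfolding g1_def by (rule ok_Node1)
  then have "ok g0 [u, t, y, y, t, r]" and "r \<noteq> t" "r \<noteq> y" by auto
  moreover from this have "r = u" using assms by (cases r; cases t; cases y; cases u) auto
  ultimately show False using not_ok_g0[of u t y y t u] assms by auto
qed

text \<open>The new path avoids all of \<open>x\<close>, \<open>y\<close>, \<open>t\<close>,
  \<open>s\<close>, so these share two colours and the inequalities force \<open>x = t\<close> and
  \<open>s = y\<close>.\<close>

lemma not_ok_g2:
  assumes "distinct [a, b, c :: col3]" "x \<noteq> y" "y \<noteq> t" "s \<noteq> t"
  shows "\<not> ok g2 [a, b, c, x, y, y, t, t, s]"
proof
  let ?w = "[a, b, c, x, y, y, t, t, s]"
  assume "ok g2 ?w"
  then obtain u where u: "set (take 3 ?w) \<inter> {u} \<inter> set (drop 3 ?w) = {}" "ok g1 ([u] @ drop 3 ?w)"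
    unfolding g2_def by (rule ok_Node1)
  then have "{a, b, c} \<inter> {u} \<inter> {x, y, t, s} = {}" by simp
  then have "u \<notin> {x, y, t, s}" unfolding rainbow[OF assms(1)] by auto
  then have "distinct [u, y, t]" "x = t" "s = y"
    using assms(2-4) by (cases u; cases x; cases y; cases t; cases s; simp)+
  with u(2) not_ok_g1[of u y t] show False by simp
qed

text \<open>The first kind of node: the last of several equal letters is split off and replaced by a
  different one. The same happens in \<open>g5\<close>, \<open>g7\<close>, \<open>g9\<close> and
  \<open>g11\<close>.\<close>

lemma not_ok_g3:
  assumes "distinct [a, b, c :: col3]" "x \<noteq> y" "y \<noteq> t"
  shows "\<not> ok g3 [a, b, c, x, y, y, t, t, t]"
proof
  let ?w = "[a, b, c, x, y, y, t, t, t]"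
  assume "ok g3 ?w"
  then obtain s where s: "set (take 8 ?w) \<inter> {s} \<inter> set (drop 8 ?w) = {}" "ok g2 (take 8 ?w @ [s])"
    unfolding g3_def by (rule ok_Node1)
  then have "s \<noteq> t" "ok g2 [a, b, c, x, y, y, t, t, s]" by auto
  with not_ok_g2[OF assms] show False by blast
qed

text \<open>The second kind of node: two unequal letters are split off and replaced by a constant
  block in the third colour. The same happens in \<open>g6\<close>, \<open>g8\<close> and
  \<open>g10\<close>.\<close>

lemma not_ok_g4:
  assumes "distinct [a, b, c :: col3]" "x \<noteq> y" "y \<noteq> z"
  shows "\<not> ok g4 [a, b, c, x, y, y, y, z]"
proof
  let ?w = "[a, b, c, x, y, y, y, z]"
  assume "ok g4 ?w"
  then obtain p q r where p: "set (take 6 ?w) \<inter> {p, q, r} \<inter> set (drop 6 ?w) = {}" "ok g3 (take 6 ?w @ [p, q, r])"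
    unfolding g4_def by (rule ok_Node3)
  then have "({a, b, c} \<union> {x, y}) \<inter> {p, q, r} \<inter> {y, z} = {}" by auto
  then have "{p, q, r} \<inter> {y, z} = {}" unfolding rainbow[OF assms(1)] by simp
  then have "q = p" "r = p" "y \<noteq> p" using assms(3) by (cases p; cases q; cases r; cases y; cases z; simp)+
  with p(2) not_ok_g3[OF assms(1,2)] show False by simp
qed

lemma not_ok_g5:
  assumes "distinct [a, b, c :: col3]" "x \<noteq> y"
  shows "\<not> ok g5 [a, b, c, x, y, y, y, y]"
proof
  let ?w = "[a, b, c, x, y, y, y, y]"
  assume "ok g5 ?w"
  then obtain z where z: "set (take 7 ?w) \<inter> {z} \<inter> set (drop 7 ?w) = {}" "ok g4 (take 7 ?w @ [z])"
    unfolding g5_def by (rule ok_Node1)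
  then have "y \<noteq> z" by auto
  with z(2) not_ok_g4[OF assms] show False by simp
qed

lemma not_ok_g6:
  assumes "distinct [a, b, c :: col3]" "x \<noteq> z"
  shows "\<not> ok g6 [a, b, c, x, x, z]"
proof
  let ?w = "[a, b, c, x, x, z]"
  assume "ok g6 ?w"
  then obtain p q r s where p: "set (take 4 ?w) \<inter> {p, q, r, s} \<inter> set (drop 4 ?w) = {}" "ok g5 (take 4 ?w @ [p, q, r, s])"
    unfolding g6_def by (rule ok_Node4)
  then have "({a, b, c} \<union> {x}) \<inter> {p, q, r, s} \<inter> {x, z} = {}" by auto
  then have *: "{p, q, r, s} \<inter> {x, z} = {}" unfolding rainbow[OF assms(1)] by simp
  have "v = p" if "v \<in> {q, r, s}" for v
    using that * assms(2) by (cases v; cases p; cases x; cases z) auto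
  then have "q = p" "r = p" "s = p" by auto
  moreover have "x \<noteq> p" using * by auto
  ultimately show False using p(2) not_ok_g5[OF assms(1)] by simp
qed

lemma not_ok_g7:
  assumes "distinct [a, b, c :: col3]"
  shows "\<not> ok g7 [a, b, c, x, x, x]"
proof
  let ?w = "[a, b, c, x, x, x]"
  assume "ok g7 ?w"
  then obtain z where z: "set (take 5 ?w) \<inter> {z} \<inter> set (drop 5 ?w) = {}" "ok g6 (take 5 ?w @ [z])"
    unfolding g7_def by (rule ok_Node1)
  then have "x \<noteq> z" by auto
  with z(2) not_ok_g6[OF assms] show False by simp
qed

lemma not_ok_g8:
  assumes "distinct [a, b, c :: col3]" "x \<noteq> y"
  shows "\<not> ok g8 [a, b, c, x, y]"
proof
  let ?w = "[a, b, c, x, y]"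
  assume "ok g8 ?w"
  then obtain p q r where p: "set (take 3 ?w) \<inter> {p, q, r} \<inter> set (drop 3 ?w) = {}" "ok g7 (take 3 ?w @ [p, q, r])"
    unfolding g8_def by (rule ok_Node3)
  then have "{a, b, c} \<inter> {p, q, r} \<inter> {x, y} = {}" by simp
  then have "{p, q, r} \<inter> {x, y} = {}" unfolding rainbow[OF assms(1)] by simp
  then have "q = p" "r = p" using assms(2) by (cases p; cases q; cases r; cases x; cases y; simp)+
  with p(2) not_ok_g7[OF assms(1)] show False by simp
qed

lemma not_ok_g9:
  assumes "distinct [a, b, c :: col3]"
  shows "\<not> ok g9 [a, b, c, x, x]"
proof
  let ?w = "[a, b, c, x, x]"
  assume "ok g9 ?w"
  then obtain z where z: "set (take 4 ?w) \<inter> {z} \<inter> set (drop 4 ?w) = {}" "ok g8 (take 4 ?w @ [z])"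
    unfolding g9_def by (rule ok_Node1)
  then have "x \<noteq> z" by auto
  with z(2) not_ok_g8[OF assms] show False by simp
qed

text \<open>Here the three colours may occur anywhere among the first five letters. The block of the
  third colour is followed by \<open>f\<close> and \<open>g\<close> at the right child, where the
  reversed word starts with a rainbow triple, as \<open>g7\<close> requires.\<close>

lemma not_ok_g10:
  assumes "{a, b, c, d, e} = (UNIV :: col3 set)" "f \<noteq> g"
  shows "\<not> ok g10 [a, b, c, d, e, f, g]"
proof
  let ?w = "[a, b, c, d, e, f, g]"
  assume "ok g10 ?w"
  then obtain p q r s where p: "set (take 5 ?w) \<inter> {p, q, r, s} \<inter> set (drop 5 ?w) = {}"
    "ok (mirror g7) ([s, r, q, p] @ drop 5 ?w)"
    unfolding g10_def by (rule ok_Node4)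
  then have "{a, b, c, d, e} \<inter> {p, q, r, s} \<inter> {f, g} = {}" by simp
  then have *: "{p, q, r, s} \<inter> {f, g} = {}" unfolding assms(1) by simp
  have "v = p" if "v \<in> {q, r, s}" for v
    using that * assms(2) by (cases v; cases p; cases f; cases g) auto
  then have "q = p" "r = p" "s = p" by auto
  moreover have "distinct [g, f, p]" using * assms(2) by auto
  ultimately show False using p(2) not_ok_g7[of g f p p] by (simp add: ok_mirror)
qed

lemma not_ok_g11:
  assumes "{a, b, c, d, e} = (UNIV :: col3 set)"
  shows "\<not> ok g11 [a, b, c, d, e, f, f]"
proof
  let ?w = "[a, b, c, d, e, f, f]"
  assume "ok g11 ?w"
  then obtain z where z: "set (take 6 ?w) \<inter> {z} \<inter> set (drop 6 ?w) = {}" "ok g10 (take 6 ?w @ [z])"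
    unfolding g11_def by (rule ok_Node1)
  then have "f \<noteq> z" by auto
  with z(2) not_ok_g10[OF assms] show False by simp
qed

section \<open>Propositional constraints for the upper plans\<close>

text \<open>The next three notions are spelled out colour by colour so that propositional reasoning applies.\<close>

definition same :: "col3 \<Rightarrow> col3 \<Rightarrow> bool" where
  "same x y \<longleftrightarrow> x = C0 \<and> y = C0 \<or> x = C1 \<and> y = C1 \<or> x = C2 \<and> y = C2"

lemma same_iff: "same x y \<longleftrightarrow> x = y"
  by (cases x; cases y) (auto simp: same_def)

definition all_colours :: "col3 list \<Rightarrow> bool" where
  "all_colours xs \<longleftrightarrow> (\<forall>c\<in>{C0, C1, C2}. list_ex (\<lambda>x. x = c) xs)"

lemma all_colours_iff: "all_colours xs \<longleftrightarrow> set xs = UNIV"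
  unfolding all_colours_def list_ex_iff UNIV_col3[symmetric] by auto

definition no_common :: "col3 list \<Rightarrow> col3 list \<Rightarrow> col3 list \<Rightarrow> bool" where
  "no_common A B C \<longleftrightarrow>
     (\<forall>c\<in>{C0, C1, C2}. \<not> (list_ex (\<lambda>x. x = c) A \<and> list_ex (\<lambda>x. x = c) B \<and> list_ex (\<lambda>x. x = c) C))"

lemma no_common_iff: "no_common A B C \<longleftrightarrow> set A \<inter> set B \<inter> set C = {}"
proof -
  have "no_common A B C \<longleftrightarrow> (\<forall>c\<in>UNIV. \<not> (c \<in> set A \<and> c \<in> set B \<and> c \<in> set C))"
    unfolding no_common_def UNIV_col3 list_ex_iff by blast
  then show ?thesis by blast
qed

lemma one_colour:
  "x = C0 \<or> x = C1 \<or> x = C2" "\<not> (x = C0 \<and> x = C1)" "\<not> (x = C0 \<and> x = C2)" "\<not> (x = C1 \<and> x = C2)"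
  by (cases x; simp)+

text \<open>From here on the lower plans enter only through two forbidden patterns: a rainbow triple
  followed by an equal pair (\<open>g9\<close>), and five letters with all colours followed by an
  equal pair (\<open>g11\<close>).\<close>

lemma ok_g12:
  assumes "ok g12 [a, b, c, d, e, f]"
  obtains x y z where "no_common [a, b] [x, y, z] [c, d, e, f]" "\<not> (all_colours [a, b, x] \<and> same y z)"
    "\<not> (all_colours [z, y, x, c, d] \<and> same e f)"
proof -
  let ?w = "[a, b, c, d, e, f]"
  from assms obtain x y z where x: "set (take 2 ?w) \<inter> {x, y, z} \<inter> set (drop 2 ?w) = {}"
    "ok g9 (take 2 ?w @ [x, y, z])" "ok g11 ([z, y, x] @ drop 2 ?w)"
    unfolding g12_def by (rule ok_Node3)
  show thesis
  proof
    show "no_common [a, b] [x, y, z] [c, d, e, f]" using x(1) by (simp add: no_common_iff)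
    show "\<not> (all_colours [a, b, x] \<and> same y z)"
    proof
      assume *: "all_colours [a, b, x] \<and> same y z"
      then have "distinct [a, b, x]" by (cases a; cases b; cases x) (auto simp: all_colours_def)
      then show False using x(2) * not_ok_g9[of a b x z] by (simp add: same_iff)
    qed
    show "\<not> (all_colours [z, y, x, c, d] \<and> same e f)"
      using x(3) not_ok_g11[of z y x c d f] by (auto simp: all_colours_iff same_iff)
  qed
qed

lemma ok_g13:
  assumes "ok g13 [a, b, c, d, e, f, g, h]"
  obtains x y z where "no_common [a, b, c, d] [x, y, z] [e, f, g, h]" "\<not> (all_colours [z, y, x, d, c] \<and> same a b)"
    "\<not> (all_colours [h, g, f, e, x] \<and> same y z)"
proof -
  let ?w = "[a, b, c, d, e, f, g, h]"
  from assms obtain x y z where x: "set (take 4 ?w) \<inter> {x, y, z} \<inter> set (drop 4 ?w) = {}"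
    "ok (mirror g11) (take 4 ?w @ [x, y, z])" "ok (mirror g11) ([z, y, x] @ drop 4 ?w)"
    unfolding g13_def by (rule ok_Node3)
  show thesis
  proof
    show "no_common [a, b, c, d] [x, y, z] [e, f, g, h]" using x(1) by (simp add: no_common_iff)
    show "\<not> (all_colours [z, y, x, d, c] \<and> same a b)"
      using x(2) not_ok_g11[of z y x d c a] by (auto simp: all_colours_iff same_iff ok_mirror)
    show "\<not> (all_colours [h, g, f, e, x] \<and> same y z)"
      using x(3) not_ok_g11[of h g f e x z] by (auto simp: all_colours_iff same_iff ok_mirror)
  qed
qed

text \<open>The conclusion confines the colours of the four root paths to the pattern
  \<open>a\<close>, \<open>b\<close>, \<open>b\<close>, \<open>b\<close> with \<open>a\<close>
  different from \<open>b\<close>, the one that \<open>g16\<close> refutes on the other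
  side.\<close>

lemma ok_g15:
  assumes "ok g15 [a, b, c, d]"
  shows "same b c \<and> same c d \<and> \<not> same a b"
proof -
  let ?w = "[a, b, c, d]"
  from assms obtain p q r s t where p: "set (take 1 ?w) \<inter> {p, q, r, s, t} \<inter> set (drop 1 ?w) = {}"
    "ok g12 (take 1 ?w @ [p, q, r, s, t])" "ok g14 ([t, s, r, q, p] @ drop 1 ?w)"
    unfolding g15_def by (rule ok_Node5)
  then have nc: "no_common [a] [p, q, r, s, t] [b, c, d]" by (simp add: no_common_iff)
  have "ok g12 [a, p, q, r, s, t]" using p(2) by simp
  then obtain x y z where X: "no_common [a, p] [x, y, z] [q, r, s, t]" "\<not> (all_colours [a, p, x] \<and> same y z)"
    "\<not> (all_colours [z, y, x, q, r] \<and> same s t)"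
    by (rule ok_g12)
  let ?v = "[t, s, r, q, p, b, c, d]"
  have "ok g14 ?v" using p(3) by simp
  then obtain i j k where I: "set (take 3 ?v) \<inter> {i, j, k} \<inter> set (drop 3 ?v) = {}" "ok g13 ([k, j, i] @ drop 3 ?v)"
    unfolding g14_def by (rule ok_Node3)
  then have nc': "no_common [t, s, r] [i, j, k] [q, p, b, c, d]" by (simp add: no_common_iff)
  have "ok g13 [k, j, i, q, p, b, c, d]" using I(2) by simp
  then obtain l m n where L: "no_common [k, j, i, q] [l, m, n] [p, b, c, d]" "\<not> (all_colours [n, m, l, q, i] \<and> same k j)"
    "\<not> (all_colours [d, c, b, p, l] \<and> same m n)"
    by (rule ok_g13)
  \<comment> \<open>Eighteen letters with three possible colours each; \<open>one_colour\<close>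
    says that each letter has exactly one of them.\<close>
  show ?thesis
    using nc X nc' L one_colour[of a] one_colour[of b] one_colour[of c] one_colour[of d]
      one_colour[of p] one_colour[of q] one_colour[of r] one_colour[of s] one_colour[of t]
      one_colour[of x] one_colour[of y] one_colour[of z] one_colour[of i] one_colour[of j] one_colour[of k]
      one_colour[of l] one_colour[of m] one_colour[of n]
    unfolding no_common_def all_colours_def same_def ball_simps list_ex_Nil_iff list_ex_Cons_iff simp_thms
    by sat
qed

text \<open>The root paths arrive at the right child in reverse order, and mirroring
  \<open>g12\<close> restores the order in which the exceptional letter \<open>a\<close> comes
  first.\<close>

lemma not_ok_g16:
  assumes "same b c" "same c d" "\<not> same a b"
  shows "\<not> ok g16 [d, c, b, a]"
proof
  let ?w = "[d, c, b, a]"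
  assume "ok g16 ?w"
  then obtain p q r where p: "set (take 1 ?w) \<inter> {p, q, r} \<inter> set (drop 1 ?w) = {}"
    "ok (mirror g12) ([r, q, p] @ drop 1 ?w)"
    unfolding g16_def by (rule ok_Node3)
  then have nc: "no_common [d] [p, q, r] [c, b, a]" by (simp add: no_common_iff)
  have "ok g12 [a, b, c, p, q, r]" using p(2) by (simp add: ok_mirror)
  then obtain x y z where "no_common [a, b] [x, y, z] [c, p, q, r]" "\<not> (all_colours [a, b, x] \<and> same y z)"
    "\<not> (all_colours [z, y, x, c, p] \<and> same q r)"
    by (rule ok_g12)
  with nc assms show False
    using one_colour[of a] one_colour[of b] one_colour[of c] one_colour[of d]
      one_colour[of p] one_colour[of q] one_colour[of r] one_colour[of x] one_colour[of y] one_colour[of z]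
    unfolding no_common_def all_colours_def same_def ball_simps list_ex_Nil_iff list_ex_Cons_iff simp_thms
    by sat
qed

theorem not_ok_g17: "\<not> ok g17 ([] :: col3 list)"
proof
  assume "ok g17 ([] :: col3 list)"
  then obtain a b c d :: col3 where "ok g15 [a, b, c, d]" "ok g16 [d, c, b, a]"
    unfolding g17_def by (rule ok_Node4) simp
  then show False using ok_g15 not_ok_g16 by blast
qed

section \<open>The family\<close>

text \<open>In preorder of \<open>g17\<close>, as \<open>turns\<close> expects it. The first four
  pairs are the paths over the root, joining leaves below 24576 to leaves from 24576 on.\<close>

definition chord_list :: "(nat \<times> nat) list" where
  "chord_list = [
   (16384, 32760), (24320, 32760), (24320, 30208), (24320, 24576), (16384, 24320),
   (18432, 23296), (18432, 20480), (19448, 20480), (19456, 20480), (16384, 18432),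
   (16896, 18432), (17408, 18432), (16896, 17408), (16392, 16896), (16512, 16896),
   (16640, 16896), (16512, 16640), (16392, 16512), (16394, 16512), (16416, 16512),
   (16448, 16512), (16416, 16448), (16394, 16416), (16396, 16416), (16400, 16416),
   (16396, 16400), (16384, 16392), (16394, 16396), (16392, 16394), (19448, 19456),
   (18432, 19448), (18432, 19446), (18432, 19200), (18432, 18944), (18944, 19200),
   (19200, 19446), (19200, 19444), (19200, 19392), (19200, 19328), (19328, 19392),
   (19392, 19444), (19392, 19440), (19392, 19424), (19424, 19440), (19446, 19448),
   (19440, 19444), (19444, 19446), (20480, 23296), (20480, 23040), (20480, 22528),
   (23296, 24320), (23296, 24064), (23296, 23552), (22528, 23040), (23040, 23296),
   (23044, 23296), (23104, 23296), (23168, 23296), (23104, 23168), (23044, 23104),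
   (23045, 23104), (23056, 23104), (23072, 23104), (23056, 23072), (23045, 23056),
   (23046, 23056), (23048, 23056), (23046, 23048), (23040, 23044), (23045, 23046),
   (23044, 23045), (23552, 24064), (24064, 24320), (24068, 24320), (24128, 24320),
   (24192, 24320), (24128, 24192), (24068, 24128), (24069, 24128), (24080, 24128),
   (24096, 24128), (24080, 24096), (24069, 24080), (24070, 24080), (24072, 24080),
   (24070, 24072), (24064, 24068), (24069, 24070), (24068, 24069), (24576, 30208),
   (24576, 29696), (24576, 28672), (30208, 32760), (30208, 31744), (30208, 30720),
   (28672, 29696), (29696, 30208), (29704, 30208), (29824, 30208), (29952, 30208),
   (29824, 29952), (29704, 29824), (29706, 29824), (29728, 29824), (29760, 29824),
   (29728, 29760), (29706, 29728), (29708, 29728), (29712, 29728), (29708, 29712),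
   (29696, 29704), (29706, 29708), (29704, 29706), (30720, 31744), (31744, 32758),
   (31744, 32512), (31744, 32256), (32256, 32512), (32512, 32758), (32512, 32756),
   (32512, 32704), (32512, 32640), (32640, 32704), (32704, 32756), (32704, 32752),
   (32704, 32736), (32736, 32752), (32758, 32760), (32752, 32756), (32756, 32758)]"

definition chord_colours :: "nat list" where
  "chord_colours = [
   0, 2, 2, 2, 2, 2, 1, 3, 1, 0, 1, 0, 1, 2, 1, 0, 1, 2, 2, 1, 0, 1, 1, 0, 1, 0, 1, 0, 0, 3, 3,
   3, 0, 0, 2, 2, 2, 1, 0, 0, 0, 0, 1, 0, 0, 1, 1, 0, 1, 0, 0, 3, 0, 1, 1, 1, 0, 2, 2, 2, 2, 0,
   3, 0, 1, 1, 2, 0, 2, 2, 0, 3, 3, 2, 1, 0, 0, 2, 2, 0, 0, 1, 0, 0, 1, 1, 2, 2, 0, 1, 3, 1, 0,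
   1, 0, 3, 3, 3, 0, 0, 2, 3, 2, 0, 2, 1, 0, 0, 1, 1, 0, 1, 1, 1, 2, 1, 0, 1, 2, 2, 1, 0, 1, 1,
   0, 1, 0, 1, 0, 0]"

definition colour_class :: "nat \<Rightarrow> (nat \<times> nat) list" where
  "colour_class k = map fst (filter (\<lambda>e. snd e = k) (zip chord_list chord_colours))"

lemma chord_list_leaves: "list_all (\<lambda>p. 16384 \<le> fst p \<and> fst p < snd p \<and> snd p < 32768) chord_list"
  by code_simp

lemma chord_list_plan: "plan_width g17 0 \<and> path_count g17 = length chord_list \<and> height g17 \<le> 14"
  by code_simp

text \<open>The computation that makes the list a realisation of the plan: each recorded path really
  uses the side of the triangle under which it is recorded.\<close>

lemma chord_list_turns: "list_all correct_turns (turns g17 [] chord_list 1 16384)"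
  by code_simp

text \<open>The check behind the upper bound; each class is tested only at the apexes of its own
  paths.\<close>

lemma colour_class_no_triangle:
  "list_all (\<lambda>k. list_all (\<lambda>p. no_triangle_at (colour_class k) (apex (fst p) (snd p) 1)) (colour_class k)) [0, 1, 2, 3]"
  by code_simp

lemma chord_colours: "length chord_colours = length chord_list \<and> list_all (\<lambda>k. k < 4) chord_colours"
  by code_simp

lemma chord_list_laminar: "sorted_wrt laminar_pair chord_list"
  by code_simp

lemma leaf_pair:
  assumes "(x, y) \<in> set chord_list"
  shows "on_level 14 x" "on_level 14 y" "x < y"
  using chord_list_leaves assms by (auto simp: list_all_iff on_level_def)

lemma chords_chord_list: "chords 14 (set chord_list)"
proof -
  have "laminar_pair p q" if "p \<in> set chord_list" "q \<in> set chord_list" for p q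
  proof -
    from that obtain i j where ij: "i < length chord_list" "p = chord_list ! i" "j < length chord_list" "q = chord_list ! j"
      by (auto simp: in_set_conv_nth)
    have sym: "laminar_pair a b \<longleftrightarrow> laminar_pair b a" for a b by (auto simp: laminar_pair_def)
    consider "i < j" | "j < i" | "i = j" by linarith
    then show ?thesis
    proof cases
      case 1
      then show ?thesis using sorted_wrt_nth_less[OF chord_list_laminar 1] ij by simp
    next
      case 2
      then show ?thesis using sorted_wrt_nth_less[OF chord_list_laminar 2] ij sym by simp
    qed (simp add: ij laminar_pair_def)
  qed
  then show ?thesis using leaf_pair unfolding chords_def by fastforce
qed

lemma turns_on_paths:
  assumes "(v, s, A, B, C) \<in> set (turns t w ps u z)"
  shows "set A \<union> set B \<union> set C \<subseteq> set w \<union> set ps"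
  using assms
proof (induction t arbitrary: w ps u z)
  case (Node k i m l r)
  have sub: "set (take n xs) \<subseteq> set xs" "set (drop n xs) \<subseteq> set xs" for n and xs :: "'a list"
    by (rule set_take_subset, rule set_drop_subset)
  from Node.prems consider "A = take i w" "B = take m ps" "C = drop i w"
    | "(v, s, A, B, C) \<in> set (turns l (take i w @ take m ps) (drop m ps) (2 * u) (z div 2))"
    | "(v, s, A, B, C) \<in> set (turns r (rev (take m ps) @ drop i w) (drop (m + path_count l) ps) (2 * u + 1) (z div 2))"
    by auto
  then show ?case
  proof cases
    case 1
    then show ?thesis using sub by blast
  next
    case 2
    from Node.IH(1)[OF this] have "set A \<union> set B \<union> set C \<subseteq> set (take i w) \<union> set (take m ps) \<union> set (drop m ps)"
      by simp
    then show ?thesis using sub by blast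
  next
    case 3
    from Node.IH(2)[OF this] have "set A \<union> set B \<union> set C \<subseteq>
        set (take m ps) \<union> set (drop i w) \<union> set (drop (m + path_count l) ps)"
      by simp
    then show ?thesis using sub by blast
  qed
qed simp

text \<open>A colouring without a monochromatic full triangle would, read along
  \<open>turns\<close>, establish \<open>ok g17 []\<close>, contrary to
  \<open>not_ok_g17\<close>.\<close>

lemma not_three_colourable:
  fixes f :: "nat \<times> nat \<Rightarrow> nat"
  assumes "\<And>p. p \<in> set chord_list \<Longrightarrow> f p < 3"
  shows "\<exists>v\<in>{1..<2 ^ 14}. \<exists>p\<in>set chord_list. \<exists>q\<in>set chord_list. \<exists>r\<in>set chord_list.
    f p = f q \<and> f q = f r \<and> full_triangle v p q r"
proof (rule ccontr)
  assume no: "\<not> ?thesis"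
  \<comment> \<open>All values other than 0 and 1 become \<open>C2\<close>; on the chords the only
    such value is 2, so no two colours are merged.\<close>
  define g where "g p = (if f p = 0 then C0 else if f p = 1 then C1 else C2)" for p
  have g: "f p = f q" if "g p = g q" "p \<in> set chord_list" "q \<in> set chord_list" for p q
    using that(1) assms[OF that(2)] assms[OF that(3)] by (auto simp: g_def split: if_splits)
  have "ok g17 (map g [])"
  proof (rule ok_turns[of g17 "[]" chord_list 1 "2 ^ 14"])
    show "plan_width g17 (length [])" "path_count g17 \<le> length chord_list" using chord_list_plan by simp_all
    fix v s A B C assume entry: "(v, s, A, B, C) \<in> set (turns g17 [] chord_list 1 (2 ^ 14))"
    have cor: "correct_turns (v, s, A, B, C)"
      using chord_list_turns entry by (simp add: list_all_iff)
    obtain l where l: "on_level l v" "l < 14" "s = 2 ^ (14 - l)"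
      using turns_level[OF entry, of 0 14] chord_list_plan by (auto simp: on_level_0)
    have "(2::nat) ^ Suc l \<le> 2 ^ 14" using l(2) by (intro power_increasing) auto
    then have v: "v \<in> {1..<2 ^ 14}" using l(1) one_le_power[of "2::nat" l] by (auto simp: on_level_def simp del: one_le_power)
    have sub: "set A \<subseteq> set chord_list" "set B \<subseteq> set chord_list" "set C \<subseteq> set chord_list"
      using turns_on_paths[OF entry] by auto
    have lev: "on_level 14 x \<and> on_level 14 y" if "(x, y) \<in> set A \<union> set B \<union> set C" for x y
      using that sub leaf_pair by blast
    show "g ` set A \<inter> g ` set B \<inter> g ` set C = {}"
    proof (rule ccontr)
      assume "g ` set A \<inter> g ` set B \<inter> g ` set C \<noteq> {}"
      then obtain p q r where pqr: "p \<in> set A" "q \<in> set B" "r \<in> set C" "g p = g q" "g q = g r" by fastforce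
      have "full_triangle v p q r" by (rule correct_turns_full[OF cor l lev pqr(1-3)])
      moreover have "f p = f q" "f q = f r" using g pqr sub by blast+
      ultimately show False using no v pqr(1-3) sub by blast
    qed
  qed
  then show False using not_ok_g17 by simp
qed

lemma four_colours:
  obtains c :: "nat \<times> nat \<Rightarrow> nat" where "\<And>p. p \<in> set chord_list \<Longrightarrow> c p < 4"
    "\<And>p. p \<in> set chord_list \<Longrightarrow> p \<in> set (colour_class (c p))"
proof
  define c where "c p = the (map_of (zip chord_list chord_colours) p)" for p
  have c: "(p, c p) \<in> set (zip chord_list chord_colours)" if "p \<in> set chord_list" for p
  proof -
    have "p \<in> dom (map_of (zip chord_list chord_colours))"
      using that chord_colours by (simp add: dom_map_of_zip)
    then show ?thesis unfolding c_def by (auto dest: map_of_SomeD)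
  qed
  show "c p < 4" if "p \<in> set chord_list" for p
    using set_zip_rightD[OF c[OF that]] chord_colours by (auto simp: list_all_iff)
  show "p \<in> set (colour_class (c p))" if "p \<in> set chord_list" for p
    using c[OF that] by (force simp: colour_class_def)
qed

theorem theorem4:
  shows "\<exists>P :: nat vwalk set. NCS P \<and> PCFN P = 4"
proof (intro exI conjI)
  show "NCS (paths_of (set chord_list))" by (rule NCS_chords[OF chords_chord_list])
  obtain c where c: "\<And>p. p \<in> set chord_list \<Longrightarrow> c p < (4::nat)"
    "\<And>p. p \<in> set chord_list \<Longrightarrow> p \<in> set (colour_class (c p))"
    by (rule four_colours) blast
  show "PCFN (paths_of (set chord_list)) = 4"
  proof (rule PCFN_chords[of _ 14 c])
    show "on_level 14 x \<and> on_level 14 y \<and> x \<noteq> y" if "(x, y) \<in> set chord_list" for x y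
      using leaf_pair[OF that] by simp
    show "c p < 4" if "p \<in> set chord_list" for p by (rule c(1)[OF that])
    show "\<not> full_triangle v p q r"
      if "p \<in> set chord_list" "q \<in> set chord_list" "r \<in> set chord_list" "c p = c q" "c q = c r" for v p q r
    proof (rule no_full_triangle)
      show "p \<in> set (colour_class (c p))" "q \<in> set (colour_class (c p))" "r \<in> set (colour_class (c p))"
        using c(2) that by metis+
      show "on_level 14 x \<and> on_level 14 y \<and> x \<noteq> y" if "(x, y) \<in> set (colour_class (c p))" for x y
      proof -
        have "(x, y) \<in> set chord_list" using that by (auto simp: colour_class_def dest: set_zip_leftD)
        then show ?thesis using leaf_pair[of x y] by simp
      qed
      have "c p \<in> set [0, 1, 2, 3]" using c(1)[OF that(1)] by auto
      then show "list_all (\<lambda>(x, y). no_triangle_at (colour_class (c p)) (apex x y 1)) (colour_class (c p))"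
        using colour_class_no_triangle unfolding list_all_iff case_prod_beta by blast
    qed
    show "\<exists>v\<in>{1..<2 ^ 14}. \<exists>p\<in>set chord_list. \<exists>q\<in>set chord_list. \<exists>r\<in>set chord_list.
        f p = f q \<and> f q = f r \<and> full_triangle v p q r"
      if "\<And>p. p \<in> set chord_list \<Longrightarrow> f p < 3" for f :: "nat \<times> nat \<Rightarrow> nat"
      by (rule not_three_colourable) (rule that)
  qed
qed

end
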